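(* There is a duality (contravariant equivalence of categories) between the category of Boolean inverse $\wedge$-semigroups and their proper morphisms and the category of Hausdorff Boolean groupoids and the proper continuous covering functors between them.
   Context: Semigroups. All inverse semigroups have a zero $0$, with order the natural partial order ($s\le t$ iff $s=te$ for some idempotent $e$); $E(S)$ is the semilattice of idempotents. $S$ is an inverse $\wedge$-semigroup if each pair of elements has a meet. Elements $s,t$ are compatible if $s^{-1}t$ and $st^{-1}$ are idempotents. $S$ is distributive if every finite non-empty compatible subset (pairwise compatible) has a join, and multiplication on the left and on the right by any element distributes over such joins (the resulting joins existing). A Boolean algebra here means a generalized Boolean algebra: a distributive lattice with bottom element $0$, not necessarily with a top, such that for all $a,b$ there is an element $b\setminus a$ with $a\vee b=a\vee(b\setminus a)$ and $a\wedge(b\setminus a)=0$; homomorphisms of Boolean algebras are lattice homomorphisms preserving the bottom element. A distributive inverse semigroup is Boolean if $E(S)$ is a Boolean algebra; a Boolean inverse $\wedge$-semigroup is a Boolean inverse semigroup that is also an inverse $\wedge$-semigroup. A filter in $S$ is a non-empty subset $F$ not containing $0$ that is upward closed and down directed (for $x,y\in F$ there is $z\in F$ with $z\le x,y$); an ultrafilter is a maximal filter. A morphism $\theta\colon S\to T$ of Boolean inverse $\wedge$-semigroups is a semigroup homomorphism preserving binary meets whose restriction $E(S)\to E(T)$ is a homomorphism of Boolean algebras. It is proper if the inverse image of every ultrafilter in $T$ is an ultrafilter in $S$. Groupoids. A groupoid $G$ is a small category with all arrows invertible, identified with its set of arrows; $G_o$ is its set of identities, $\mathbf{d}(g)=g^{-1}g$,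 $\mathbf{r}(g)=gg^{-1}$. A topological groupoid is a groupoid with a topology for which multiplication and inversion are continuous; it is étale if $\mathbf{d}\colon G\to G_o$ is a local homeomorphism. A local bisection is a subset $A\subseteq G$ with $A^{-1}A, AA^{-1}\subseteq G_o$. A Boolean space is a Hausdorff space with a basis of compact-open sets. A Boolean groupoid is an étale topological groupoid with a basis of compact-open local bisections whose space of identities is a Boolean space; a Hausdorff Boolean groupoid is one that is Hausdorff as a space. A functor $\theta\colon G\to H$ of groupoids is a covering functor if it is star-injective ($\theta(g)=\theta(g')$ and $\mathbf{d}(g)=\mathbf{d}(g')$ imply $g=g'$) and star-surjective (if $\mathbf{d}(h)=\theta(e)$ with $e$ an identity then there is $g$ with $\mathbf{d}(g)=e$ and $\theta(g)=h$). A continuous map is proper if inverse images of compact sets are compact. *)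

theory Defs
  imports "HOL-Analysis.Analysis" "HOL-Algebra.Lattice"
begin

section \<open>Boolean inverse meet-semigroups\<close>

record 'a zero_semigroup = "'a partial_object" +
  mult :: "'a \<Rightarrow> 'a \<Rightarrow> 'a" (infixl "\<cdot>\<index>" 70)
  zero :: 'a

definition inverse_semigroup :: "'a zero_semigroup \<Rightarrow> bool" where
  "inverse_semigroup S \<longleftrightarrow>
     (\<forall>s\<in>carrier S. \<forall>t\<in>carrier S. s \<cdot>\<^bsub>S\<^esub> t \<in> carrier S) \<and>
     (\<forall>s\<in>carrier S. \<forall>t\<in>carrier S. \<forall>u\<in>carrier S.
        (s \<cdot>\<^bsub>S\<^esub> t) \<cdot>\<^bsub>S\<^esub> u = s \<cdot>\<^bsub>S\<^esub> (t \<cdot>\<^bsub>S\<^esub> u)) \<and>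
     (\<forall>s\<in>carrier S. \<exists>!t. t \<in> carrier S \<and>
        s \<cdot>\<^bsub>S\<^esub> t \<cdot>\<^bsub>S\<^esub> s = s \<and> t \<cdot>\<^bsub>S\<^esub> s \<cdot>\<^bsub>S\<^esub> t = t) \<and>
     zero S \<in> carrier S \<and>
     (\<forall>s\<in>carrier S. zero S \<cdot>\<^bsub>S\<^esub> s = zero S \<and> s \<cdot>\<^bsub>S\<^esub> zero S = zero S)"

definition sg_inv :: "'a zero_semigroup \<Rightarrow> 'a \<Rightarrow> 'a" where
  "sg_inv S s = (THE t. t \<in> carrier S \<and>
     s \<cdot>\<^bsub>S\<^esub> t \<cdot>\<^bsub>S\<^esub> s = s \<and> t \<cdot>\<^bsub>S\<^esub> s \<cdot>\<^bsub>S\<^esub> t = t)"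

definition idems :: "'a zero_semigroup \<Rightarrow> 'a set" where
  "idems S = {e \<in> carrier S. e \<cdot>\<^bsub>S\<^esub> e = e}"

definition nat_le :: "'a zero_semigroup \<Rightarrow> 'a \<Rightarrow> 'a \<Rightarrow> bool" where
  "nat_le S s t \<longleftrightarrow> (\<exists>e\<in>idems S. s = t \<cdot>\<^bsub>S\<^esub> e)"

definition nat_order :: "'a zero_semigroup \<Rightarrow> 'a gorder" where
  "nat_order S = \<lparr>carrier = carrier S, eq = (=), le = nat_le S\<rparr>"

definition idem_order :: "'a zero_semigroup \<Rightarrow> 'a gorder" where
  "idem_order S = \<lparr>carrier = idems S, eq = (=), le = nat_le S\<rparr>"

definition compatible :: "'a zero_semigroup \<Rightarrow> 'a \<Rightarrow> 'a \<Rightarrow> bool" where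
  "compatible S s t \<longleftrightarrow> sg_inv S s \<cdot>\<^bsub>S\<^esub> t \<in> idems S \<and> s \<cdot>\<^bsub>S\<^esub> sg_inv S t \<in> idems S"

definition is_join :: "'a zero_semigroup \<Rightarrow> 'a set \<Rightarrow> 'a \<Rightarrow> bool" where
  "is_join S A j \<longleftrightarrow> least (nat_order S) j (Upper (nat_order S) A)"

definition distributive_inverse_semigroup :: "'a zero_semigroup \<Rightarrow> bool" where
  "distributive_inverse_semigroup S \<longleftrightarrow> inverse_semigroup S \<and>
     (\<forall>A. finite A \<and> A \<noteq> {} \<and> A \<subseteq> carrier S \<and> (\<forall>s\<in>A. \<forall>t\<in>A. compatible S s t) \<longrightarrow>
        (\<exists>j. is_join S A j) \<and>
        (\<forall>j. is_join S A j \<longrightarrow> (\<forall>c\<in>carrier S.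
           is_join S ((\<lambda>a. c \<cdot>\<^bsub>S\<^esub> a) ` A) (c \<cdot>\<^bsub>S\<^esub> j) \<and>
           is_join S ((\<lambda>a. a \<cdot>\<^bsub>S\<^esub> c) ` A) (j \<cdot>\<^bsub>S\<^esub> c))))"

text \<open>A generalized Boolean algebra with bottom \<open>z\<close>; there need not be a top.\<close>

definition gen_boolean_algebra :: "'a gorder \<Rightarrow> 'a \<Rightarrow> bool" where
  "gen_boolean_algebra L z \<longleftrightarrow> lattice L \<and> least L z (carrier L) \<and>
     (\<forall>x\<in>carrier L. \<forall>y\<in>carrier L. \<forall>w\<in>carrier L.
        x \<sqinter>\<^bsub>L\<^esub> (y \<squnion>\<^bsub>L\<^esub> w) = (x \<sqinter>\<^bsub>L\<^esub> y) \<squnion>\<^bsub>L\<^esub> (x \<sqinter>\<^bsub>L\<^esub> w)) \<and>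
     (\<forall>a\<in>carrier L. \<forall>b\<in>carrier L. \<exists>c\<in>carrier L.
        a \<squnion>\<^bsub>L\<^esub> b = a \<squnion>\<^bsub>L\<^esub> c \<and> a \<sqinter>\<^bsub>L\<^esub> c = z)"

definition boolean_inverse_meet_semigroup :: "'a zero_semigroup \<Rightarrow> bool" where
  "boolean_inverse_meet_semigroup S \<longleftrightarrow> distributive_inverse_semigroup S \<and>
     gen_boolean_algebra (idem_order S) (zero S) \<and> lower_semilattice (nat_order S)"

definition sg_filter :: "'a zero_semigroup \<Rightarrow> 'a set \<Rightarrow> bool" where
  "sg_filter S F \<longleftrightarrow> F \<subseteq> carrier S \<and> F \<noteq> {} \<and> zero S \<notin> F \<and>
     (\<forall>x\<in>F. \<forall>y\<in>carrier S. nat_le S x y \<longrightarrow> y \<in> F) \<and>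
     (\<forall>x\<in>F. \<forall>y\<in>F. \<exists>z\<in>F. nat_le S z x \<and> nat_le S z y)"

definition sg_ultrafilter :: "'a zero_semigroup \<Rightarrow> 'a set \<Rightarrow> bool" where
  "sg_ultrafilter S F \<longleftrightarrow> sg_filter S F \<and> (\<forall>F'. sg_filter S F' \<and> F \<subseteq> F' \<longrightarrow> F' = F)"

definition ultrafilters :: "'a zero_semigroup \<Rightarrow> 'a set set" where
  "ultrafilters S = {F. sg_ultrafilter S F}"

text \<open>
  Arrows of both categories are extensional functions (\<open>undefined\<close> off the carrier of the
  source), so that equality of arrows is equality in HOL. The hom-sets are polymorphic:
  source and target may have different carrier types.
\<close>

definition bim_hom :: "'a zero_semigroup \<Rightarrow> 'b zero_semigroup \<Rightarrow> ('a \<Rightarrow> 'b) set" where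
  "bim_hom S T = {\<theta> \<in> carrier S \<rightarrow>\<^sub>E carrier T.
     boolean_inverse_meet_semigroup S \<and> boolean_inverse_meet_semigroup T \<and>
     (\<forall>s\<in>carrier S. \<forall>t\<in>carrier S. \<theta> (s \<cdot>\<^bsub>S\<^esub> t) = \<theta> s \<cdot>\<^bsub>T\<^esub> \<theta> t) \<and>
     (\<forall>s\<in>carrier S. \<forall>t\<in>carrier S.
        \<theta> (s \<sqinter>\<^bsub>nat_order S\<^esub> t) = \<theta> s \<sqinter>\<^bsub>nat_order T\<^esub> \<theta> t) \<and>
     (\<forall>e\<in>idems S. \<forall>f\<in>idems S.
        \<theta> (e \<sqinter>\<^bsub>idem_order S\<^esub> f) = \<theta> e \<sqinter>\<^bsub>idem_order T\<^esub> \<theta> f \<and>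
        \<theta> (e \<squnion>\<^bsub>idem_order S\<^esub> f) = \<theta> e \<squnion>\<^bsub>idem_order T\<^esub> \<theta> f) \<and>
     \<theta> (zero S) = zero T \<and>
     (\<forall>F\<in>ultrafilters T. {s \<in> carrier S. \<theta> s \<in> F} \<in> ultrafilters S)}"

definition bim_iso :: "'a zero_semigroup \<Rightarrow> 'b zero_semigroup \<Rightarrow> ('a \<Rightarrow> 'b) \<Rightarrow> bool" where
  "bim_iso S T \<theta> \<longleftrightarrow> \<theta> \<in> bim_hom S T \<and>
     (\<exists>\<phi>\<in>bim_hom T S. compose (carrier S) \<phi> \<theta> = (\<lambda>s\<in>carrier S. s) \<and>
                      compose (carrier T) \<theta> \<phi> = (\<lambda>t\<in>carrier T. t))"


section \<open>Hausdorff Boolean groupoids\<close>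

text \<open>
  A groupoid is given by its arrows; objects are identified with identity arrows.
  \<open>gcomp G g h\<close> is meaningful only if \<open>gsrc G g = gtgt G h\<close>. The source and target of \<open>g\<close>
  are \<open>d(g) = g\<^sup>-\<^sup>1g\<close> and \<open>r(g) = gg\<^sup>-\<^sup>1\<close>.
\<close>

record 'g top_groupoid = "'g partial_object" +
  gsrc :: "'g \<Rightarrow> 'g"
  gtgt :: "'g \<Rightarrow> 'g"
  gcomp :: "'g \<Rightarrow> 'g \<Rightarrow> 'g"
  gtop :: "'g topology"

definition groupoid :: "'g top_groupoid \<Rightarrow> bool" where
  "groupoid G \<longleftrightarrow>
     (\<forall>g\<in>carrier G. gsrc G g \<in> carrier G \<and> gtgt G g \<in> carrier G \<and>
        gsrc G (gsrc G g) = gsrc G g \<and> gtgt G (gsrc G g) = gsrc G g \<and>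
        gsrc G (gtgt G g) = gtgt G g \<and> gtgt G (gtgt G g) = gtgt G g \<and>
        gcomp G g (gsrc G g) = g \<and> gcomp G (gtgt G g) g = g) \<and>
     (\<forall>g\<in>carrier G. \<forall>h\<in>carrier G. gsrc G g = gtgt G h \<longrightarrow>
        gcomp G g h \<in> carrier G \<and>
        gsrc G (gcomp G g h) = gsrc G h \<and> gtgt G (gcomp G g h) = gtgt G g) \<and>
     (\<forall>g\<in>carrier G. \<forall>h\<in>carrier G. \<forall>k\<in>carrier G.
        gsrc G g = gtgt G h \<and> gsrc G h = gtgt G k \<longrightarrow>
        gcomp G (gcomp G g h) k = gcomp G g (gcomp G h k)) \<and>
     (\<forall>g\<in>carrier G. \<exists>h\<in>carrier G. gsrc G h = gtgt G g \<and> gtgt G h = gsrc G g \<and>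
        gcomp G h g = gsrc G g \<and> gcomp G g h = gtgt G g)"

definition ginv :: "'g top_groupoid \<Rightarrow> 'g \<Rightarrow> 'g" where
  "ginv G g = (THE h. h \<in> carrier G \<and> gsrc G h = gtgt G g \<and> gtgt G h = gsrc G g \<and>
     gcomp G h g = gsrc G g \<and> gcomp G g h = gtgt G g)"

definition gids :: "'g top_groupoid \<Rightarrow> 'g set" where
  "gids G = {e \<in> carrier G. gsrc G e = e}"

definition gset_mult :: "'g top_groupoid \<Rightarrow> 'g set \<Rightarrow> 'g set \<Rightarrow> 'g set" where
  "gset_mult G A B = {gcomp G a b |a b. a \<in> A \<and> b \<in> B \<and> gsrc G a = gtgt G b}"

definition topological_groupoid :: "'g top_groupoid \<Rightarrow> bool" where
  "topological_groupoid G \<longleftrightarrow> groupoid G \<and> topspace (gtop G) = carrier G \<and>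
     continuous_map
       (subtopology (prod_topology (gtop G) (gtop G)) {(g, h). gsrc G g = gtgt G h})
       (gtop G) (\<lambda>(g, h). gcomp G g h) \<and>
     continuous_map (gtop G) (gtop G) (ginv G)"

definition local_homeomorphism :: "'x topology \<Rightarrow> 'y topology \<Rightarrow> ('x \<Rightarrow> 'y) \<Rightarrow> bool" where
  "local_homeomorphism X Y f \<longleftrightarrow> (\<forall>x\<in>topspace X. \<exists>U. x \<in> U \<and> openin X U \<and>
     openin Y (f ` U) \<and> homeomorphic_map (subtopology X U) (subtopology Y (f ` U)) f)"

definition etale_groupoid :: "'g top_groupoid \<Rightarrow> bool" where
  "etale_groupoid G \<longleftrightarrow> topological_groupoid G \<and>
     local_homeomorphism (gtop G) (subtopology (gtop G) (gids G)) (gsrc G)"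

definition local_bisection :: "'g top_groupoid \<Rightarrow> 'g set \<Rightarrow> bool" where
  "local_bisection G A \<longleftrightarrow> A \<subseteq> carrier G \<and>
     gset_mult G (ginv G ` A) A \<subseteq> gids G \<and> gset_mult G A (ginv G ` A) \<subseteq> gids G"

text \<open>The open sets satisfying \<open>P\<close> form a basis of \<open>X\<close>.\<close>

definition has_basis_of :: "'x topology \<Rightarrow> ('x set \<Rightarrow> bool) \<Rightarrow> bool" where
  "has_basis_of X P \<longleftrightarrow>
     (\<forall>U x. openin X U \<and> x \<in> U \<longrightarrow> (\<exists>V. openin X V \<and> P V \<and> x \<in> V \<and> V \<subseteq> U))"

definition boolean_space :: "'x topology \<Rightarrow> bool" where
  "boolean_space X \<longleftrightarrow> Hausdorff_space X \<and> has_basis_of X (compactin X)"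

definition boolean_groupoid :: "'g top_groupoid \<Rightarrow> bool" where
  "boolean_groupoid G \<longleftrightarrow> etale_groupoid G \<and>
     has_basis_of (gtop G) (\<lambda>V. compactin (gtop G) V \<and> local_bisection G V) \<and>
     boolean_space (subtopology (gtop G) (gids G))"

definition hausdorff_boolean_groupoid :: "'g top_groupoid \<Rightarrow> bool" where
  "hausdorff_boolean_groupoid G \<longleftrightarrow> boolean_groupoid G \<and> Hausdorff_space (gtop G)"

definition groupoid_functor :: "'g top_groupoid \<Rightarrow> 'h top_groupoid \<Rightarrow> ('g \<Rightarrow> 'h) \<Rightarrow> bool" where
  "groupoid_functor G H \<theta> \<longleftrightarrow> \<theta> \<in> carrier G \<rightarrow> carrier H \<and>
     (\<forall>g\<in>carrier G. \<theta> (gsrc G g) = gsrc H (\<theta> g) \<and> \<theta> (gtgt G g) = gtgt H (\<theta> g)) \<and>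
     (\<forall>g\<in>carrier G. \<forall>h\<in>carrier G. gsrc G g = gtgt G h \<longrightarrow>
        \<theta> (gcomp G g h) = gcomp H (\<theta> g) (\<theta> h))"

definition covering_functor :: "'g top_groupoid \<Rightarrow> 'h top_groupoid \<Rightarrow> ('g \<Rightarrow> 'h) \<Rightarrow> bool" where
  "covering_functor G H \<theta> \<longleftrightarrow> groupoid_functor G H \<theta> \<and>
     (\<forall>g\<in>carrier G. \<forall>g'\<in>carrier G. \<theta> g = \<theta> g' \<and> gsrc G g = gsrc G g' \<longrightarrow> g = g') \<and>
     (\<forall>e\<in>gids G. \<forall>h\<in>carrier H. gsrc H h = \<theta> e \<longrightarrow>
        (\<exists>g\<in>carrier G. gsrc G g = e \<and> \<theta> g = h))"

text \<open>
  The library's \<^const>\<open>proper_map\<close> (closed with compact fibres) is a different notion in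
  general, so properness is spelled out as compactness of inverse images of compact sets.
\<close>

definition hbg_hom :: "'g top_groupoid \<Rightarrow> 'h top_groupoid \<Rightarrow> ('g \<Rightarrow> 'h) set" where
  "hbg_hom G H = {\<theta> \<in> carrier G \<rightarrow>\<^sub>E carrier H.
     hausdorff_boolean_groupoid G \<and> hausdorff_boolean_groupoid H \<and>
     covering_functor G H \<theta> \<and> continuous_map (gtop G) (gtop H) \<theta> \<and>
     (\<forall>K. compactin (gtop H) K \<longrightarrow> compactin (gtop G) {g \<in> carrier G. \<theta> g \<in> K})}"

definition hbg_iso :: "'g top_groupoid \<Rightarrow> 'h top_groupoid \<Rightarrow> ('g \<Rightarrow> 'h) \<Rightarrow> bool" where
  "hbg_iso G H \<theta> \<longleftrightarrow> \<theta> \<in> hbg_hom G H \<and>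
     (\<exists>\<phi>\<in>hbg_hom H G. compose (carrier G) \<phi> \<theta> = (\<lambda>g\<in>carrier G. g) \<and>
                      compose (carrier H) \<theta> \<phi> = (\<lambda>h\<in>carrier H. h))"


section \<open>The two functors and the comparison maps\<close>

definition up_closure :: "'a zero_semigroup \<Rightarrow> 'a set \<Rightarrow> 'a set" where
  "up_closure S A = {s \<in> carrier S. \<exists>a\<in>A. nat_le S a s}"

definition sg_set_mult :: "'a zero_semigroup \<Rightarrow> 'a set \<Rightarrow> 'a set \<Rightarrow> 'a set" where
  "sg_set_mult S A B = {a \<cdot>\<^bsub>S\<^esub> b |a b. a \<in> A \<and> b \<in> B}"

definition uf_containing :: "'a zero_semigroup \<Rightarrow> 'a \<Rightarrow> 'a set set" where
  "uf_containing S s = {F \<in> ultrafilters S. s \<in> F}"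

text \<open>The groupoid of ultrafilters, topologised by the sets \<^const>\<open>uf_containing\<close>.\<close>

definition uf_groupoid :: "'a zero_semigroup \<Rightarrow> 'a set top_groupoid" where
  "uf_groupoid S =
     \<lparr>carrier = ultrafilters S,
      gsrc = (\<lambda>A. up_closure S (sg_set_mult S (sg_inv S ` A) A)),
      gtgt = (\<lambda>A. up_closure S (sg_set_mult S A (sg_inv S ` A))),
      gcomp = (\<lambda>A B. up_closure S (sg_set_mult S A B)),
      gtop = topology_generated_by (uf_containing S ` carrier S)\<rparr>"

definition uf_map :: "'a zero_semigroup \<Rightarrow> 'b zero_semigroup \<Rightarrow> ('a \<Rightarrow> 'b) \<Rightarrow> 'b set \<Rightarrow> 'a set" where
  "uf_map S T \<theta> = (\<lambda>F\<in>ultrafilters T. {s \<in> carrier S. \<theta> s \<in> F})"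

text \<open>The semigroup of compact-open local bisections.\<close>

definition kb_semigroup :: "'g top_groupoid \<Rightarrow> 'g set zero_semigroup" where
  "kb_semigroup G =
     \<lparr>carrier = {A. compactin (gtop G) A \<and> openin (gtop G) A \<and> local_bisection G A},
      mult = gset_mult G,
      zero = {}\<rparr>"

definition kb_map :: "'g top_groupoid \<Rightarrow> 'h top_groupoid \<Rightarrow> ('g \<Rightarrow> 'h) \<Rightarrow> 'h set \<Rightarrow> 'g set" where
  "kb_map G H \<phi> = (\<lambda>B\<in>carrier (kb_semigroup H). {g \<in> carrier G. \<phi> g \<in> B})"

definition bim_unit :: "'a zero_semigroup \<Rightarrow> 'a \<Rightarrow> 'a set set" where
  "bim_unit S = (\<lambda>s\<in>carrier S. uf_containing S s)"

definition hbg_unit :: "'g top_groupoid \<Rightarrow> 'g \<Rightarrow> 'g set set" where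
  "hbg_unit G = (\<lambda>g\<in>carrier G. {B \<in> carrier (kb_semigroup G). g \<in> B})"

end

theory Submission
  imports Defs
begin

text \<open>
  An ultrafilter \<open>A\<close> of a Boolean inverse meet-semigroup is recovered from its source
  \<open>(A\<inverse>A)\<up>\<close> and any one of its elements, and \<open>(AB)\<up>\<close> is an ultrafilter whenever \<open>B\<close> is an
  ultrafilter whose range is the source of the filter \<open>A\<close>; this makes the ultrafilters a
  groupoid in which the sets \<open>V s\<close> of ultrafilters containing \<open>s\<close> are a basis of compact-open
  local bisections. Relative complements give separation (\<open>V s \<subseteq> V t\<close> only if \<open>s \<le> t\<close>) and
  compactness, and distributivity makes ultrafilters prime, so that every compact-open local
  bisection is some \<open>V s\<close>. Conversely, in a Hausdorff Boolean groupoid the members of an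
  ultrafilter of compact-open local bisections are compact and closed with the finite
  intersection property, hence share a point \<open>g\<close>, and the ultrafilter consists of all
  bisections through \<open>g\<close>. Most equations between ultrafilters are proved as inclusions, which
  maximality turns into equalities.
\<close>

section \<open>Inverse semigroups with zero\<close>

text \<open>Meets of arbitrary pairs are where the two sides of the duality meet. On the semigroup
  side they allow a complement of \<open>t\<close> to be taken inside \<open>s\<close> even when
  \<open>s\<close> and \<open>t\<close> are not compatible, and this yields disjoint basic
  neighbourhoods, that is, a Hausdorff groupoid. On the groupoid side the Hausdorff property makes
  compact sets closed, so that intersections and differences of compact-open bisections stay
  compact, and meets exist. The clauses of a morphism speak of meets, joins, zero and ultrafilters,
  but a multiplicative bijection respects all of them, because each is expressible through the
  product. The unit of a semigroup is therefore only shown to be bijective and multiplicative.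
  Dually, the unit of a groupoid is only shown to be a functor and a homeomorphism.\<close>

locale inverse_sg =
  fixes S :: "'a zero_semigroup" (structure)
  assumes inverse_sg: "inverse_semigroup S"
begin

abbreviation inv' ("_\<star>" [999] 1000) where "s\<star> \<equiv> sg_inv S s"
abbreviation nle (infix "\<preceq>" 50) where "s \<preceq> t \<equiv> nat_le S s t"
abbreviation E where "E \<equiv> idems S"

lemma mult_closed [simp, intro]: "s \<in> carrier S \<Longrightarrow> t \<in> carrier S \<Longrightarrow> s \<cdot> t \<in> carrier S"
  and assoc: "s \<in> carrier S \<Longrightarrow> t \<in> carrier S \<Longrightarrow> u \<in> carrier S \<Longrightarrow> (s \<cdot> t) \<cdot> u = s \<cdot> (t \<cdot> u)"
  and zero_closed [simp, intro]: "zero S \<in> carrier S"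
  and zero_left [simp]: "s \<in> carrier S \<Longrightarrow> zero S \<cdot> s = zero S"
  and zero_right [simp]: "s \<in> carrier S \<Longrightarrow> s \<cdot> zero S = zero S"
  using inverse_sg unfolding inverse_semigroup_def by blast+

lemma inv_ex1: "s \<in> carrier S \<Longrightarrow> \<exists>!t. t \<in> carrier S \<and> s \<cdot> t \<cdot> s = s \<and> t \<cdot> s \<cdot> t = t"
  using inverse_sg unfolding inverse_semigroup_def by (elim conjE) (rule bspec)

lemma inv_props:
  assumes "s \<in> carrier S"
  shows inv_closed [simp, intro]: "s\<star> \<in> carrier S"
    and inv_left: "s \<cdot> s\<star> \<cdot> s = s"
    and inv_right: "s\<star> \<cdot> s \<cdot> s\<star> = s\<star>"
  using theI'[OF inv_ex1[OF assms]] unfolding sg_inv_def by blast+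

lemma inv_unique:
  assumes "s \<in> carrier S" "t \<in> carrier S" "s \<cdot> t \<cdot> s = s" "t \<cdot> s \<cdot> t = t"
  shows "s\<star> = t"
  unfolding sg_inv_def using the1_equality[OF inv_ex1[OF assms(1)]] assms by blast

lemma inv_left' [simp]: "s \<in> carrier S \<Longrightarrow> s \<cdot> (s\<star> \<cdot> s) = s"
  using inv_left assoc by simp

lemma inv_right' [simp]: "s \<in> carrier S \<Longrightarrow> s\<star> \<cdot> (s \<cdot> s\<star>) = s\<star>"
  using inv_right assoc by simp

lemma inv_left2 [simp]: "s \<in> carrier S \<Longrightarrow> t \<in> carrier S \<Longrightarrow> s \<cdot> (s\<star> \<cdot> (s \<cdot> t)) = s \<cdot> t"
  using inv_left by (metis assoc inv_closed mult_closed)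

lemma inv_right2 [simp]: "s \<in> carrier S \<Longrightarrow> t \<in> carrier S \<Longrightarrow> s\<star> \<cdot> (s \<cdot> (s\<star> \<cdot> t)) = s\<star> \<cdot> t"
  using inv_right by (metis assoc inv_closed mult_closed)

lemma inv_inv [simp]: "s \<in> carrier S \<Longrightarrow> s\<star>\<star> = s"
  by (rule inv_unique) (auto simp: inv_left inv_right)

lemma idem_closed [simp]: "e \<in> E \<Longrightarrow> e \<in> carrier S"
  and idem_idem [simp]: "e \<in> E \<Longrightarrow> e \<cdot> e = e"
  by (auto simp: idems_def)

lemma idemI: "e \<in> carrier S \<Longrightarrow> e \<cdot> e = e \<Longrightarrow> e \<in> E"
  unfolding idems_def by blast

lemma idem_inv [simp]: "e \<in> E \<Longrightarrow> e\<star> = e"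
  by (rule inv_unique) auto

lemma idem_idem2 [simp]: "e \<in> E \<Longrightarrow> s \<in> carrier S \<Longrightarrow> e \<cdot> (e \<cdot> s) = e \<cdot> s"
  by (metis assoc idem_closed idem_idem)

text \<open>With \<open>x\<close> the inverse of \<open>e \<cdot> f\<close>, the element
  \<open>f \<cdot> x \<cdot> e\<close> is an inverse too. Uniqueness gives
  \<open>x = f \<cdot> x \<cdot> e\<close>, a form that is visibly idempotent; since an idempotent
  is its own inverse, \<open>e \<cdot> f = x\<close>.\<close>

lemma idem_mult [simp, intro]:
  assumes e: "e \<in> E" and f: "f \<in> E"
  shows "e \<cdot> f \<in> E"
proof -
  define x where "x = (e \<cdot> f)\<star>"
  have c: "e \<in> carrier S" "f \<in> carrier S" "x \<in> carrier S" using assms by (auto simp: x_def)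
  have 1: "(e \<cdot> f) \<cdot> x \<cdot> (e \<cdot> f) = e \<cdot> f" "x \<cdot> (e \<cdot> f) \<cdot> x = x"
    using c by (auto simp: x_def inv_left inv_right)
  have 2: "x \<cdot> (e \<cdot> (f \<cdot> (x \<cdot> e))) = x \<cdot> e"
    using 1(2) c by (metis assoc mult_closed)
  have "x = f \<cdot> x \<cdot> e" unfolding x_def
  proof (rule inv_unique, unfold x_def[symmetric])
    show "e \<cdot> f \<cdot> (f \<cdot> x \<cdot> e) \<cdot> (e \<cdot> f) = e \<cdot> f"
      using 1(1) c e f by (simp add: assoc)
    show "f \<cdot> x \<cdot> e \<cdot> (e \<cdot> f) \<cdot> (f \<cdot> x \<cdot> e) = f \<cdot> x \<cdot> e"
      using 2 c e f by (simp add: assoc)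
  qed (use c in auto)
  then have "x \<cdot> x = (f \<cdot> x \<cdot> e) \<cdot> (f \<cdot> x \<cdot> e)" by simp
  also have "\<dots> = f \<cdot> x \<cdot> e" using 2 c by (simp add: assoc)
  finally have "x \<in> E" using \<open>x = f \<cdot> x \<cdot> e\<close> c by (auto intro: idemI)
  then have "x\<star> = x" by simp
  moreover have "x\<star> = e \<cdot> f" using c by (simp add: x_def)
  ultimately show ?thesis using \<open>x \<in> E\<close> by simp
qed

text \<open>Both \<open>e \<cdot> f\<close> and \<open>f \<cdot> e\<close> are inverses of the
  idempotent \<open>e \<cdot> f\<close>.\<close>

lemma idem_comm:
  assumes e: "e \<in> E" and f: "f \<in> E"
  shows "e \<cdot> f = f \<cdot> e"
proof -
  have 1: "x \<cdot> (y \<cdot> (x \<cdot> y)) = x \<cdot> y" if "x \<in> E" "y \<in> E" for x y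
    using idem_idem[OF idem_mult[OF that]] that by (metis assoc idem_closed mult_closed)
  have "(e \<cdot> f)\<star> = f \<cdot> e"
    by (rule inv_unique) (use 1 assms in \<open>auto simp: assoc\<close>)
  then show ?thesis using assms by simp
qed

lemma idem_comm2: "e \<in> E \<Longrightarrow> f \<in> E \<Longrightarrow> s \<in> carrier S \<Longrightarrow> e \<cdot> (f \<cdot> s) = f \<cdot> (e \<cdot> s)"
  by (metis assoc idem_closed idem_comm)

lemma dom_idem [simp, intro]: "s \<in> carrier S \<Longrightarrow> s\<star> \<cdot> s \<in> E"
  and ran_idem [simp, intro]: "s \<in> carrier S \<Longrightarrow> s \<cdot> s\<star> \<in> E"
  by (auto intro!: idemI simp: assoc)

text \<open>The inner factors \<open>t \<cdot> t\<star>\<close> and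
  \<open>s\<star> \<cdot> s\<close> are idempotents and may be swapped.\<close>

lemma inv_mult [simp]:
  assumes "s \<in> carrier S" "t \<in> carrier S"
  shows "(s \<cdot> t)\<star> = t\<star> \<cdot> s\<star>"
proof (rule inv_unique)
  have c: "(t \<cdot> t\<star>) \<cdot> (s\<star> \<cdot> s) = (s\<star> \<cdot> s) \<cdot> (t \<cdot> t\<star>)"
    using assms by (intro idem_comm) auto
  have "s \<cdot> t \<cdot> (t\<star> \<cdot> s\<star>) \<cdot> (s \<cdot> t) = s \<cdot> ((t \<cdot> t\<star>) \<cdot> (s\<star> \<cdot> s)) \<cdot> t"
    using assms by (simp add: assoc)
  also have "\<dots> = s \<cdot> t" unfolding c using assms by (simp add: assoc)
  finally show "s \<cdot> t \<cdot> (t\<star> \<cdot> s\<star>) \<cdot> (s \<cdot> t) = s \<cdot> t" .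
  have "t\<star> \<cdot> s\<star> \<cdot> (s \<cdot> t) \<cdot> (t\<star> \<cdot> s\<star>) = t\<star> \<cdot> ((s\<star> \<cdot> s) \<cdot> (t \<cdot> t\<star>)) \<cdot> s\<star>"
    using assms by (simp add: assoc)
  also have "\<dots> = t\<star> \<cdot> s\<star>" unfolding c[symmetric] using assms by (simp add: assoc)
  finally show "t\<star> \<cdot> s\<star> \<cdot> (s \<cdot> t) \<cdot> (t\<star> \<cdot> s\<star>) = t\<star> \<cdot> s\<star>" .
qed (use assms in auto)

lemma conj_idem [simp, intro]:
  assumes "t \<in> carrier S" "e \<in> E"
  shows "t\<star> \<cdot> (e \<cdot> t) \<in> E"
proof (rule idemI)
  have "t\<star> \<cdot> (e \<cdot> t) \<cdot> (t\<star> \<cdot> (e \<cdot> t)) = t\<star> \<cdot> (e \<cdot> ((t \<cdot> t\<star>) \<cdot> (e \<cdot> t)))"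
    using assms by (simp add: assoc)
  also have "\<dots> = t\<star> \<cdot> (e \<cdot> (e \<cdot> ((t \<cdot> t\<star>) \<cdot> t)))"
    using assms by (subst idem_comm2) auto
  also have "\<dots> = t\<star> \<cdot> (e \<cdot> t)" using assms by (simp add: assoc)
  finally show "t\<star> \<cdot> (e \<cdot> t) \<cdot> (t\<star> \<cdot> (e \<cdot> t)) = t\<star> \<cdot> (e \<cdot> t)" .
qed (use assms in auto)

section \<open>The natural partial order\<close>

lemma leI_right: "t \<in> carrier S \<Longrightarrow> e \<in> E \<Longrightarrow> t \<cdot> e \<preceq> t"
  unfolding nat_le_def by blast

text \<open>The order is defined with the idempotent on the right; conjugation moves it there, since
  \<open>e \<cdot> t = t \<cdot> (t\<star> \<cdot> (e \<cdot> t))\<close>.\<close>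

lemma leI_left:
  assumes "t \<in> carrier S" "e \<in> E" shows "e \<cdot> t \<preceq> t"
proof -
  have "t \<cdot> (t\<star> \<cdot> (e \<cdot> t)) = (t \<cdot> t\<star>) \<cdot> (e \<cdot> t)" using assms by (simp add: assoc)
  also have "\<dots> = e \<cdot> t" using assms by (subst idem_comm2) (auto simp: assoc)
  finally have *: "e \<cdot> t = t \<cdot> (t\<star> \<cdot> (e \<cdot> t))" ..
  show ?thesis by (subst *) (use assms in \<open>auto intro: leI_right\<close>)
qed

text \<open>The unknown idempotent behind \<open>s \<preceq> t\<close> can be replaced by a
  canonical one, the domain of \<open>s\<close>. This and \<open>le_ranD\<close> are the usual way
  to exploit the order below.\<close>

lemma le_domD:
  assumes "s \<preceq> t" "t \<in> carrier S"
  shows "t \<cdot> (s\<star> \<cdot> s) = s"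
proof -
  obtain e where e: "e \<in> E" "s = t \<cdot> e" using assms(1) by (auto simp: nat_le_def)
  have "t \<cdot> (s\<star> \<cdot> s) = t \<cdot> (e \<cdot> ((t\<star> \<cdot> t) \<cdot> e))" using e assms by (simp add: assoc)
  also have "\<dots> = t \<cdot> ((t\<star> \<cdot> t) \<cdot> (e \<cdot> e))" using e assms by (subst idem_comm2) auto
  also have "\<dots> = s" using e assms by (simp add: assoc)
  finally show ?thesis .
qed

lemma le_closed [simp, intro]: "s \<preceq> t \<Longrightarrow> t \<in> carrier S \<Longrightarrow> s \<in> carrier S"
  unfolding nat_le_def by auto

lemma le_ranD:
  assumes "s \<preceq> t" "t \<in> carrier S"
  shows "(s \<cdot> s\<star>) \<cdot> t = s"
proof -
  obtain e where e: "e \<in> E" "s = t \<cdot> e" using assms(1) by (auto simp: nat_le_def)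
  have "(s \<cdot> s\<star>) \<cdot> t = t \<cdot> (e \<cdot> ((t\<star> \<cdot> t)))" using e assms by (simp add: assoc)
  also have "\<dots> = t \<cdot> ((t\<star> \<cdot> t) \<cdot> e)" using e assms by (subst idem_comm) auto
  also have "\<dots> = s" using e assms by (simp add: assoc)
  finally show ?thesis .
qed

lemma le_refl [simp, intro]: "s \<in> carrier S \<Longrightarrow> s \<preceq> s"
  using leI_right[of s "s\<star> \<cdot> s"] by simp

lemma le_trans [trans]:
  assumes "s \<preceq> t" "t \<preceq> u" "u \<in> carrier S" shows "s \<preceq> u"
proof -
  obtain e f where "e \<in> E" "s = t \<cdot> e" "f \<in> E" "t = u \<cdot> f" using assms by (auto simp: nat_le_def)
  then have "s = u \<cdot> (f \<cdot> e)" "f \<cdot> e \<in> E" using assms by (auto simp: assoc)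
  then show ?thesis unfolding nat_le_def by blast
qed

lemma le_antisym:
  assumes "s \<preceq> t" "t \<preceq> s" "t \<in> carrier S" shows "s = t"
proof -
  have s: "s \<in> carrier S" using assms by blast
  have "s = t \<cdot> (s\<star> \<cdot> s)" using le_domD[OF assms(1,3)] ..
  also have "\<dots> = s \<cdot> (t\<star> \<cdot> t) \<cdot> (s\<star> \<cdot> s)" using le_domD[OF assms(2) s] by simp
  also have "\<dots> = s \<cdot> ((s\<star> \<cdot> s) \<cdot> (t\<star> \<cdot> t))" using assms s by (subst idem_comm) (auto simp: assoc)
  also have "\<dots> = s \<cdot> (s\<star> \<cdot> (s \<cdot> (t\<star> \<cdot> t)))"
    using assms s by (simp add: assoc)
  also have "\<dots> = t" using le_domD[OF assms(2) s] assms(3) s by (metis inv_left2 idem_closed dom_idem)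
  finally show ?thesis .
qed

lemma le_mult_left: "s \<preceq> t \<Longrightarrow> t \<in> carrier S \<Longrightarrow> u \<in> carrier S \<Longrightarrow> u \<cdot> s \<preceq> u \<cdot> t"
  unfolding nat_le_def by (metis assoc idem_closed)

lemma le_mult_right:
  assumes "s \<preceq> t" "t \<in> carrier S" "u \<in> carrier S" shows "s \<cdot> u \<preceq> t \<cdot> u"
proof -
  have "s \<cdot> u = (s \<cdot> s\<star>) \<cdot> (t \<cdot> u)" using le_ranD[OF assms(1,2)] assms
    by (metis assoc idem_closed le_closed ran_idem)
  then show ?thesis using assms by (metis leI_left le_closed mult_closed ran_idem)
qed

lemma le_mult: "s \<preceq> t \<Longrightarrow> u \<preceq> v \<Longrightarrow> t \<in> carrier S \<Longrightarrow> v \<in> carrier S \<Longrightarrow> s \<cdot> u \<preceq> t \<cdot> v"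
  by (meson le_closed le_mult_left le_mult_right le_trans mult_closed)

lemma le_inv:
  assumes "s \<preceq> t" "t \<in> carrier S" shows "s\<star> \<preceq> t\<star>"
proof -
  obtain e where "e \<in> E" "s = t \<cdot> e" using assms by (auto simp: nat_le_def)
  then show ?thesis using assms by (simp add: leI_left)
qed

lemma le_dom: "s \<preceq> t \<Longrightarrow> t \<in> carrier S \<Longrightarrow> s\<star> \<cdot> s \<preceq> t\<star> \<cdot> t"
  by (simp add: le_inv le_mult)

lemma zero_idem [simp, intro]: "zero S \<in> E" by (rule idemI) auto

lemma zero_le [simp, intro]: "s \<in> carrier S \<Longrightarrow> zero S \<preceq> s"
  using leI_right[of s "zero S"] by simp

lemma le_zero: "s \<preceq> zero S \<Longrightarrow> s = zero S"
  unfolding nat_le_def by auto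

lemma dom_zero: "s \<in> carrier S \<Longrightarrow> s\<star> \<cdot> s = zero S \<Longrightarrow> s = zero S"
  using inv_left' by fastforce

lemma le_idem: "s \<preceq> e \<Longrightarrow> e \<in> E \<Longrightarrow> s \<in> E"
  unfolding nat_le_def by auto

lemma idem_le_iff: "e \<in> E \<Longrightarrow> f \<in> E \<Longrightarrow> e \<preceq> f \<longleftrightarrow> f \<cdot> e = e"
  using le_domD[of e f] leI_right[of f e] by (auto)

lemma nat_order_partial_order: "partial_order (nat_order S)"
  by unfold_locales (auto simp: nat_order_def intro: le_antisym le_trans)

lemma idem_order_partial_order: "partial_order (idem_order S)"
  by unfold_locales (auto simp: idem_order_def intro: le_antisym le_trans)

lemma is_join_iff:
  assumes "A \<subseteq> carrier S"
  shows "is_join S A j \<longleftrightarrow> j \<in> carrier S \<and> (\<forall>a\<in>A. a \<preceq> j) \<and>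
    (\<forall>u\<in>carrier S. (\<forall>a\<in>A. a \<preceq> u) \<longrightarrow> j \<preceq> u)"
proof -
  have *: "A \<inter> carrier S = A" using assms by blast
  show ?thesis unfolding is_join_def least_def Upper_def nat_order_def by (auto simp: *)
qed

subsection \<open>Filters\<close>

abbreviation finv where "finv A \<equiv> sg_inv S ` A"
abbreviation fmul where "fmul A B \<equiv> up_closure S (sg_set_mult S A B)"
abbreviation fsrc where "fsrc A \<equiv> fmul (finv A) A"
abbreviation frng where "frng A \<equiv> fmul A (finv A)"

lemma filter_closed [simp]: "sg_filter S F \<Longrightarrow> x \<in> F \<Longrightarrow> x \<in> carrier S"
  and filter_nonempty: "sg_filter S F \<Longrightarrow> F \<noteq> {}"
  and filter_zero: "sg_filter S F \<Longrightarrow> zero S \<notin> F"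
  and filter_up: "sg_filter S F \<Longrightarrow> x \<in> F \<Longrightarrow> x \<preceq> y \<Longrightarrow> y \<in> carrier S \<Longrightarrow> y \<in> F"
  and filter_dir: "sg_filter S F \<Longrightarrow> x \<in> F \<Longrightarrow> y \<in> F \<Longrightarrow> \<exists>z\<in>F. z \<preceq> x \<and> z \<preceq> y"
  unfolding sg_filter_def by auto

lemma mem_fmul: "x \<in> fmul A B \<longleftrightarrow> x \<in> carrier S \<and> (\<exists>a\<in>A. \<exists>b\<in>B. a \<cdot> b \<preceq> x)"
  unfolding up_closure_def sg_set_mult_def by blast

lemma fmul_subset: "fmul A B \<subseteq> carrier S"
  unfolding up_closure_def by blast

lemma mult_mem_fmul:
  "a \<in> A \<Longrightarrow> b \<in> B \<Longrightarrow> a \<in> carrier S \<Longrightarrow> b \<in> carrier S \<Longrightarrow> a \<cdot> b \<in> fmul A B"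
  unfolding mem_fmul using le_refl mult_closed by blast

lemma mem_finv: "A \<subseteq> carrier S \<Longrightarrow> x \<in> finv A \<longleftrightarrow> x \<in> carrier S \<and> x\<star> \<in> A"
  by (auto simp: subset_iff) (metis image_eqI inv_inv)

lemma finv_finv: "A \<subseteq> carrier S \<Longrightarrow> finv (finv A) = A"
  by (force simp: image_image)

lemma filter_subset: "sg_filter S F \<Longrightarrow> F \<subseteq> carrier S" by auto

lemma filter_finv:
  assumes "sg_filter S A" shows "sg_filter S (finv A)"
proof -
  have 1: "zero S \<notin> finv A" using assms by (auto simp: mem_finv filter_subset filter_zero)
  show ?thesis unfolding sg_filter_def
  proof (intro conjI ballI impI)
    fix x y assume "x \<in> finv A" "y \<in> carrier S" "x \<preceq> y"
    then show "y \<in> finv A" using assms by (auto simp: mem_finv filter_subset intro: filter_up le_inv)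
  next
    fix x y assume "x \<in> finv A" "y \<in> finv A"
    then have xy: "x\<star> \<in> A" "y\<star> \<in> A" "x \<in> carrier S" "y \<in> carrier S"
      using assms by (auto simp: mem_finv filter_subset)
    then obtain z where z: "z \<in> A" "z \<preceq> x\<star>" "z \<preceq> y\<star>" using filter_dir[OF assms] by blast
    then have "z\<star> \<preceq> x" "z\<star> \<preceq> y" using xy by (metis inv_closed inv_inv le_inv)+
    then show "\<exists>z\<in>finv A. z \<preceq> x \<and> z \<preceq> y" using z by blast
  qed (use assms 1 filter_nonempty in auto)
qed

text \<open>Directedness makes diagonal products suffice: if \<open>z\<close> is below
  \<open>a\<close> and \<open>b\<close>, then \<open>z\<star> \<cdot> z\<close> is below
  \<open>a\<star> \<cdot> b\<close>.\<close>

lemma mem_fsrc: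
  assumes "sg_filter S A"
  shows "x \<in> fsrc A \<longleftrightarrow> x \<in> carrier S \<and> (\<exists>a\<in>A. a\<star> \<cdot> a \<preceq> x)"
proof (intro iffI conjI)
  assume "x \<in> fsrc A"
  then obtain a b where ab: "a \<in> A" "b \<in> A" "a\<star> \<cdot> b \<preceq> x" "x \<in> carrier S" by (auto simp: mem_fmul)
  then obtain z where z: "z \<in> A" "z \<preceq> a" "z \<preceq> b" using filter_dir[OF assms] by blast
  then have "z\<star> \<cdot> z \<preceq> a\<star> \<cdot> b" using ab assms by (simp add: le_mult le_inv)
  then show "\<exists>a\<in>A. a\<star> \<cdot> a \<preceq> x" using z ab by (meson le_trans)
qed (auto simp: mem_fmul)

lemma frng_eq: "A \<subseteq> carrier S \<Longrightarrow> frng A = fsrc (finv A)"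
  by (simp add: finv_finv)

lemma mem_frng:
  assumes "sg_filter S A"
  shows "x \<in> frng A \<longleftrightarrow> x \<in> carrier S \<and> (\<exists>a\<in>A. a \<cdot> a\<star> \<preceq> x)"
  using mem_fsrc[OF filter_finv[OF assms], of x] assms by (auto simp: finv_finv[OF filter_subset])

lemma dom_mem_fsrc: "sg_filter S A \<Longrightarrow> a \<in> A \<Longrightarrow> a\<star> \<cdot> a \<in> fsrc A"
  by (subst mem_fsrc) (auto intro!: bexI[of _ a])

lemma ran_mem_frng: "sg_filter S A \<Longrightarrow> a \<in> A \<Longrightarrow> a \<cdot> a\<star> \<in> frng A"
  by (subst mem_frng) (auto intro!: bexI[of _ a])

text \<open>If \<open>e\<close> is above \<open>b\<star> \<cdot> b\<close> and \<open>z\<close> is a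
  member below \<open>a\<close> and \<open>b\<close>, then
  \<open>z = z \<cdot> (z\<star> \<cdot> z)\<close> is below \<open>a \<cdot> e\<close>.\<close>

lemma filter_mult_src:
  assumes A: "sg_filter S A" and "a \<in> A" "e \<in> fsrc A"
  shows "a \<cdot> e \<in> A"
proof -
  obtain b where b: "b \<in> A" "b\<star> \<cdot> b \<preceq> e" and e: "e \<in> carrier S" using assms by (auto simp: mem_fsrc)
  obtain z where z: "z \<in> A" "z \<preceq> a" "z \<preceq> b" using filter_dir[OF A] assms b by blast
  have c: "a \<in> carrier S" "b \<in> carrier S" "z \<in> carrier S" using assms b z by auto
  have "z\<star> \<cdot> z \<preceq> e" using z b c e by (meson le_dom le_trans)
  then have "z \<cdot> (z\<star> \<cdot> z) \<preceq> a \<cdot> e" using z c e by (intro le_mult)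
  then show ?thesis using filter_up[OF A z(1)] c e by simp
qed

text \<open>Both sides are the upward closure of the set of triple products, because multiplication
  is monotone.\<close>

lemma fmul_assoc:
  assumes "A \<subseteq> carrier S" "B \<subseteq> carrier S" "C \<subseteq> carrier S"
  shows "fmul (fmul A B) C = fmul A (fmul B C)"
proof (rule Set.set_eqI)
  fix x
  have "x \<in> fmul (fmul A B) C \<longleftrightarrow> x \<in> carrier S \<and> (\<exists>a\<in>A. \<exists>b\<in>B. \<exists>c\<in>C. a \<cdot> b \<cdot> c \<preceq> x)"
    unfolding mem_fmul[of x] bex_simps
  proof (intro conj_cong refl iffI)
    assume x: "x \<in> carrier S" and "\<exists>a\<in>fmul A B. \<exists>b\<in>C. a \<cdot> b \<preceq> x"
    then obtain y a b c where *: "y \<in> carrier S" "a \<in> A" "b \<in> B" "a \<cdot> b \<preceq> y" "c \<in> C" "y \<cdot> c \<preceq> x"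
      unfolding Bex_def mem_fmul by blast
    then have "a \<cdot> b \<cdot> c \<preceq> y \<cdot> c" using assms by (auto intro: le_mult_right)
    then have "a \<cdot> b \<cdot> c \<preceq> x" using * x le_trans by blast
    then show "\<exists>a\<in>A. \<exists>b\<in>B. \<exists>c\<in>C. a \<cdot> b \<cdot> c \<preceq> x" using * by blast
  next
    assume x: "x \<in> carrier S" and "\<exists>a\<in>A. \<exists>b\<in>B. \<exists>c\<in>C. a \<cdot> b \<cdot> c \<preceq> x"
    then show "\<exists>a\<in>fmul A B. \<exists>b\<in>C. a \<cdot> b \<preceq> x"
      unfolding Bex_def mem_fmul using assms by (metis le_refl mult_closed subset_iff)
  qed
  also have "\<dots> \<longleftrightarrow> x \<in> carrier S \<and> (\<exists>a\<in>A. \<exists>b\<in>B. \<exists>c\<in>C. a \<cdot> (b \<cdot> c) \<preceq> x)"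
    using assms by (auto simp: subset_iff assoc)
  also have "\<dots> \<longleftrightarrow> x \<in> fmul A (fmul B C)"
    unfolding mem_fmul[of x]
  proof (intro conj_cong refl iffI)
    assume x: "x \<in> carrier S" and "\<exists>a\<in>A. \<exists>b\<in>fmul B C. a \<cdot> b \<preceq> x"
    then obtain y a b c where *: "y \<in> carrier S" "a \<in> A" "b \<in> B" "b \<cdot> c \<preceq> y" "c \<in> C" "a \<cdot> y \<preceq> x"
      unfolding Bex_def mem_fmul by blast
    then have "a \<cdot> (b \<cdot> c) \<preceq> a \<cdot> y" using assms by (auto intro: le_mult_left)
    then have "a \<cdot> (b \<cdot> c) \<preceq> x" using * x le_trans by blast
    then show "\<exists>a\<in>A. \<exists>b\<in>B. \<exists>c\<in>C. a \<cdot> (b \<cdot> c) \<preceq> x" using * by blast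
  next
    assume x: "x \<in> carrier S" and "\<exists>a\<in>A. \<exists>b\<in>B. \<exists>c\<in>C. a \<cdot> (b \<cdot> c) \<preceq> x"
    then show "\<exists>a\<in>A. \<exists>b\<in>fmul B C. a \<cdot> b \<preceq> x"
      unfolding Bex_def mem_fmul using assms by (metis le_refl mult_closed subset_iff)
  qed
  finally show "x \<in> fmul (fmul A B) C \<longleftrightarrow> x \<in> fmul A (fmul B C)" .
qed

lemma fmul_fsrc: assumes A: "sg_filter S A" shows "fmul A (fsrc A) = A"
proof (rule Set.set_eqI)
  fix x show "x \<in> fmul A (fsrc A) \<longleftrightarrow> x \<in> A"
  proof
    assume "x \<in> fmul A (fsrc A)"
    then show "x \<in> A" using filter_mult_src[OF A] filter_up[OF A] unfolding mem_fmul[of x] by blast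
  next
    assume x: "x \<in> A"
    then have "x\<star> \<cdot> x \<in> fsrc A" "x \<in> carrier S" "x \<cdot> (x\<star> \<cdot> x) \<preceq> x" using A by (auto intro: dom_mem_fsrc)
    then show "x \<in> fmul A (fsrc A)" using x unfolding mem_fmul[of x] by blast
  qed
qed

text \<open>Associativity turns the left unit law into the right one.\<close>

lemma fmul_frng: assumes A: "sg_filter S A" shows "fmul (frng A) A = A"
proof -
  have "fmul (frng A) A = fmul A (fsrc A)" using A by (intro fmul_assoc) auto
  then show ?thesis using fmul_fsrc[OF A] by simp
qed

lemma filter_mult_rng: "sg_filter S A \<Longrightarrow> a \<in> A \<Longrightarrow> e \<in> frng A \<Longrightarrow> e \<cdot> a \<in> A"
  using mult_mem_fmul[of e "frng A" a A] fmul_frng[of A] mem_fmul[of e A "finv A"] by auto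

lemma finv_fmul:
  assumes "A \<subseteq> carrier S" "B \<subseteq> carrier S"
  shows "finv (fmul A B) = fmul (finv B) (finv A)"
proof -
  have sub: "fmul A B \<subseteq> carrier S" unfolding up_closure_def by blast
  have "x\<star> \<in> fmul A B \<longleftrightarrow> x \<in> fmul (finv B) (finv A)" if x: "x \<in> carrier S" for x
  proof -
    have "a \<cdot> b \<preceq> x\<star> \<longleftrightarrow> b\<star> \<cdot> a\<star> \<preceq> x" if "a \<in> A" "b \<in> B" for a b
      using le_inv[of "a \<cdot> b" "x\<star>"] le_inv[of "b\<star> \<cdot> a\<star>" x] that x assms by (auto simp: subset_iff)
    then show ?thesis using x by (auto simp: mem_fmul)
  qed
  moreover have "fmul (finv B) (finv A) \<subseteq> carrier S" unfolding up_closure_def by blast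
  ultimately show ?thesis using mem_finv[OF sub] by blast
qed

section \<open>Products of composable filters\<close>

context
  fixes A B assumes A: "sg_filter S A" and B: "sg_filter S B" and AB: "fsrc A = frng B"
begin

text \<open>The idempotents \<open>b \<cdot> b\<star>\<close> and \<open>a\<star> \<cdot> a\<close>
  lie in the common filter \<open>fsrc A = frng B\<close>, so either factor can be cut down to fit
  the other without leaving its filter.\<close>

lemma composable_mult:
  assumes "a \<in> A" "b \<in> B"
  shows "a \<cdot> (b \<cdot> b\<star>) \<in> A" "(a\<star> \<cdot> a) \<cdot> b \<in> B"
proof -
  have "b \<cdot> b\<star> \<in> frng B" "a\<star> \<cdot> a \<in> fsrc A" using assms A B by (auto intro: dom_mem_fsrc ran_mem_frng)
  then show "a \<cdot> (b \<cdot> b\<star>) \<in> A" "(a\<star> \<cdot> a) \<cdot> b \<in> B"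
    using filter_mult_src[OF A] filter_mult_rng[OF B] assms AB by auto
qed

text \<open>The delicate point is that zero is excluded: \<open>a \<cdot> b = zero S\<close> would
  force \<open>a \<cdot> (b \<cdot> b\<star>) = zero S\<close>, an element of
  \<open>A\<close>.\<close>

lemma filter_fmul: "sg_filter S (fmul A B)"
  unfolding sg_filter_def
proof (intro conjI ballI impI)
  show "fmul A B \<subseteq> carrier S" by (auto simp: mem_fmul)
  obtain a b where "a \<in> A" "b \<in> B" using filter_nonempty[OF A] filter_nonempty[OF B] by blast
  then have "a \<cdot> b \<in> fmul A B" using A B by (auto intro!: mult_mem_fmul)
  then show "fmul A B \<noteq> {}" by blast
  show "zero S \<notin> fmul A B"
  proof
    assume "zero S \<in> fmul A B"
    then obtain a b where ab: "a \<in> A" "b \<in> B" "a \<cdot> b = zero S" by (auto simp: mem_fmul dest: le_zero)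
    then have "a \<cdot> (b \<cdot> b\<star>) = zero S" using A B by (metis assoc filter_closed inv_closed zero_left)
    then show False using composable_mult(1)[OF ab(1,2)] filter_zero[OF A] by simp
  qed
  fix x y
  show "y \<in> fmul A B" if "x \<in> fmul A B" "y \<in> carrier S" "x \<preceq> y"
    using that unfolding mem_fmul by (meson le_trans)
  assume "x \<in> fmul A B" "y \<in> fmul A B"
  then obtain a b a' b' where *: "a \<in> A" "b \<in> B" "a' \<in> A" "b' \<in> B" "a \<cdot> b \<preceq> x" "a' \<cdot> b' \<preceq> y"
    "x \<in> carrier S" "y \<in> carrier S" unfolding mem_fmul by blast
  obtain z w where zw: "z \<in> A" "z \<preceq> a" "z \<preceq> a'" "w \<in> B" "w \<preceq> b" "w \<preceq> b'"
    using filter_dir[OF A *(1,3)] filter_dir[OF B *(2,4)] by blast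
  have "z \<cdot> w \<preceq> x" "z \<cdot> w \<preceq> y" using * zw A B by (meson filter_closed le_mult le_trans)+
  moreover have "z \<cdot> w \<in> fmul A B" using zw A B by (auto intro!: mult_mem_fmul)
  ultimately show "\<exists>z\<in>fmul A B. z \<preceq> x \<and> z \<preceq> y" by blast
qed

lemma fsrc_fmul: "fsrc (fmul A B) = fsrc B"
proof (rule Set.set_eqI)
  fix x show "x \<in> fsrc (fmul A B) \<longleftrightarrow> x \<in> fsrc B"
  proof
    assume "x \<in> fsrc (fmul A B)"
    then obtain y a b where *: "x \<in> carrier S" "y\<star> \<cdot> y \<preceq> x" "y \<in> carrier S" "a \<in> A" "b \<in> B" "a \<cdot> b \<preceq> y"
      unfolding mem_fsrc[OF filter_fmul] unfolding Bex_def mem_fmul by blast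
    have c: "a \<in> carrier S" "b \<in> carrier S" using * A B by auto
    \<comment> \<open>Cutting \<open>b\<close> down by the domain of \<open>a\<close> keeps it in
      \<open>B\<close> and gives it exactly the domain of \<open>a \<cdot> b\<close>.\<close>
    have "((a\<star> \<cdot> a) \<cdot> b)\<star> \<cdot> ((a\<star> \<cdot> a) \<cdot> b) = (a \<cdot> b)\<star> \<cdot> (a \<cdot> b)"
      using c by (simp add: assoc)
    also have "\<dots> \<preceq> x" using * le_dom by (meson le_trans)
    finally show "x \<in> fsrc B" using composable_mult(2)[OF *(4,5)] *(1) by (auto simp: mem_fsrc[OF B])
  next
    assume "x \<in> fsrc B"
    then obtain b where b: "b \<in> B" "b\<star> \<cdot> b \<preceq> x" "x \<in> carrier S" by (auto simp: mem_fsrc[OF B])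
    obtain a where a: "a \<in> A" using filter_nonempty[OF A] by blast
    have c: "a \<in> carrier S" "b \<in> carrier S" using a b A B by auto
    have "(a \<cdot> b)\<star> \<cdot> (a \<cdot> b) = b\<star> \<cdot> ((a\<star> \<cdot> a) \<cdot> b)" using c by (simp add: assoc)
    also have "\<dots> \<preceq> b\<star> \<cdot> b" using c by (intro le_mult leI_left) auto
    finally have "(a \<cdot> b)\<star> \<cdot> (a \<cdot> b) \<preceq> x" using b by (meson le_trans)
    moreover have "a \<cdot> b \<in> fmul A B" using a b c by (auto intro!: mult_mem_fmul)
    ultimately show "x \<in> fsrc (fmul A B)" using b(3) unfolding mem_fsrc[OF filter_fmul] by blast
  qed
qed

end

text \<open>Inversion reverses products and exchanges sources with ranges, so this is
  \<open>fsrc_fmul\<close> for the inverse filters.\<close>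

lemma frng_fmul:
  assumes A: "sg_filter S A" and B: "sg_filter S B" and AB: "fsrc A = frng B"
  shows "frng (fmul A B) = frng A"
proof -
  have s: "A \<subseteq> carrier S" "B \<subseteq> carrier S" using A B by auto
  have "frng (fmul A B) = fsrc (fmul (finv B) (finv A))"
    by (subst frng_eq[OF fmul_subset]) (simp only: finv_fmul[OF s])
  also have "\<dots> = frng A"
    using fsrc_fmul[OF filter_finv[OF B] filter_finv[OF A]] AB s by (simp add: finv_finv)
  finally show ?thesis .
qed

text \<open>The source and the range of \<open>A\<close> are products of \<open>A\<close> with its
  inverse filter, so the laws for products apply to them.\<close>

lemma
  assumes A: "sg_filter S A"
  shows filter_fsrc: "sg_filter S (fsrc A)" and filter_frng: "sg_filter S (frng A)"
    and fsrc_fsrc: "fsrc (fsrc A) = fsrc A" and frng_fsrc: "frng (fsrc A) = fsrc A"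
    and fsrc_frng: "fsrc (frng A) = frng A" and frng_frng: "frng (frng A) = frng A"
proof -
  have c: "A \<subseteq> carrier S" and I: "sg_filter S (finv A)" using A filter_finv by auto
  have 1: "fsrc (finv A) = frng A" and 2: "fsrc A = frng (finv A)" using c by (auto simp: finv_finv)
  show "sg_filter S (fsrc A)" "sg_filter S (frng A)" using filter_fmul[OF I A 1] filter_fmul[OF A I 2] .
  show "fsrc (fsrc A) = fsrc A" "frng (fsrc A) = fsrc A"
    using fsrc_fmul[OF I A 1] frng_fmul[OF I A 1] 2 by auto
  show "fsrc (frng A) = frng A" "frng (frng A) = frng A"
    using fsrc_fmul[OF A I 2] frng_fmul[OF A I 2] 1 by auto
qed

text \<open>Below any member \<open>x\<close> of one filter there is a member \<open>z\<close> that
  is also below \<open>s\<close>, and \<open>z = s \<cdot> (z\<star> \<cdot> z)\<close> is rebuilt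
  from \<open>s\<close> and an element of the common source.\<close>

lemma filter_eqI:
  assumes A: "sg_filter S A" and B: "sg_filter S B" and AB: "fsrc A = fsrc B" and s: "s \<in> A" "s \<in> B"
  shows "A = B"
proof -
  have "X \<subseteq> Y" if X: "sg_filter S X" and Y: "sg_filter S Y" and XY: "fsrc X = fsrc Y" "s \<in> X" "s \<in> Y" for X Y
  proof
    fix x assume x: "x \<in> X"
    then obtain z where z: "z \<in> X" "z \<preceq> x" "z \<preceq> s" using filter_dir[OF X] XY by blast
    then have "z\<star> \<cdot> z \<in> fsrc X" using X by (auto intro: dom_mem_fsrc)
    then have "s \<cdot> (z\<star> \<cdot> z) \<in> Y" using XY filter_mult_src[OF Y] by auto
    moreover have "s \<cdot> (z\<star> \<cdot> z) = z" using le_domD[OF z(3)] XY X by auto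
    ultimately show "x \<in> Y" using z x X filter_up[OF Y] by auto
  qed
  then show ?thesis using assms by (metis subset_antisym)
qed

text \<open>Both filters contain \<open>e\<close> and have the same source, so
  \<open>filter_eqI\<close> applies.\<close>

lemma filter_idem_fsrc:
  assumes A: "sg_filter S A" and e: "e \<in> A" "e \<in> E"
  shows "fsrc A = A"
proof (rule filter_eqI[of _ _ e])
  show "e \<in> fsrc A" using e A by (auto simp: mem_fsrc[OF A] intro!: bexI[of _ e])
qed (use A e in \<open>auto simp: filter_fsrc fsrc_fsrc\<close>)

text \<open>This lifts an identity filter \<open>F\<close> to an arrow that starts at
  \<open>F\<close> and passes through \<open>s\<close>; the set \<open>A\<close> is the upward
  closure of the translate of \<open>F\<close> by \<open>s\<close>.\<close>

lemma filter_translate: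
  assumes F: "sg_filter S F" "fsrc F = F" and s: "s \<in> carrier S" "s\<star> \<cdot> s \<in> F"
  defines "A \<equiv> {x \<in> carrier S. \<exists>f\<in>F. s \<cdot> f \<preceq> x}"
  shows "sg_filter S A" "fsrc A = F" "s \<in> A"
proof -
  \<comment> \<open>Members of \<open>F\<close> below \<open>s\<star> \<cdot> s\<close> are
    idempotents and are recovered from \<open>s \<cdot> z\<close> as its domain, so translating by
    \<open>s\<close> loses no information about \<open>F\<close>.\<close>
  have small: "\<exists>z\<in>F. z \<preceq> f \<and> z \<in> E \<and> (s \<cdot> z)\<star> \<cdot> (s \<cdot> z) = z" if f: "f \<in> F" for f
  proof -
    obtain z where z: "z \<in> F" "z \<preceq> f" "z \<preceq> s\<star> \<cdot> s" using filter_dir[OF F(1) f s(2)] by blast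
    then have zE: "z \<in> E" using s by (meson dom_idem le_idem)
    have "(s \<cdot> z)\<star> \<cdot> (s \<cdot> z) = z \<cdot> ((s\<star> \<cdot> s) \<cdot> z)" using zE s by (simp add: assoc)
    also have "\<dots> = z" using z(3) zE s by (simp add: idem_le_iff)
    finally show ?thesis using z zE by blast
  qed
  have sA: "s \<cdot> z \<in> A" if "z \<in> F" for z
    using that F(1) s(1) le_refl mult_closed filter_closed unfolding A_def by blast
  show filter: "sg_filter S A" unfolding sg_filter_def
  proof (intro conjI ballI impI)
    show "A \<subseteq> carrier S" by (auto simp: A_def)
    show "A \<noteq> {}" using sA s(2) by blast
    show "zero S \<notin> A"
    proof
      assume "zero S \<in> A"
      then obtain f where f: "f \<in> F" "s \<cdot> f = zero S" by (auto simp: A_def dest: le_zero)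
      then obtain z where z: "z \<in> F" "z \<preceq> f" "(s \<cdot> z)\<star> \<cdot> (s \<cdot> z) = z" using small by blast
      have "s \<cdot> z \<preceq> s \<cdot> f" using z f F s by (intro le_mult_left) auto
      then have "s \<cdot> z = zero S" using f le_zero by simp
      then have "z = zero S" using z by simp
      then show False using z filter_zero[OF F(1)] by simp
    qed
    fix x y
    show "y \<in> A" if "x \<in> A" "y \<in> carrier S" "x \<preceq> y"
      using that by (auto simp: A_def intro: le_trans)
    assume "x \<in> A" "y \<in> A"
    then obtain f g where fg: "f \<in> F" "g \<in> F" "s \<cdot> f \<preceq> x" "s \<cdot> g \<preceq> y" "x \<in> carrier S" "y \<in> carrier S"
      by (auto simp: A_def)
    then obtain z where z: "z \<in> F" "z \<preceq> f" "z \<preceq> g" using filter_dir[OF F(1)] by blast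
    then have "s \<cdot> z \<preceq> x" "s \<cdot> z \<preceq> y" using fg F s by (meson filter_closed le_mult_left le_trans)+
    moreover have "s \<cdot> z \<in> A" using z by (intro sA)
    ultimately show "\<exists>z\<in>A. z \<preceq> x \<and> z \<preceq> y" by blast
  qed
  show "s \<in> A" using sA[OF s(2)] s(1) by simp
  show "fsrc A = F"
  proof (rule Set.set_eqI)
    fix x show "x \<in> fsrc A \<longleftrightarrow> x \<in> F"
    proof
      assume "x \<in> fsrc A"
      then obtain a f where *: "x \<in> carrier S" "a \<in> carrier S" "a\<star> \<cdot> a \<preceq> x" "f \<in> F" "s \<cdot> f \<preceq> a"
        unfolding mem_fsrc[OF filter] by (auto simp: A_def)
      then obtain z where z: "z \<in> F" "z \<preceq> f" "(s \<cdot> z)\<star> \<cdot> (s \<cdot> z) = z" using small by blast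
      have "s \<cdot> z \<preceq> a" using z * F s by (meson filter_closed le_mult_left le_trans)
      then have "z \<preceq> a\<star> \<cdot> a" using le_dom[of "s \<cdot> z" a] z * by simp
      then show "x \<in> F" using * z filter_up[OF F(1)] le_trans by blast
    next
      assume x: "x \<in> F"
      then obtain z where z: "z \<in> F" "z \<preceq> x" "(s \<cdot> z)\<star> \<cdot> (s \<cdot> z) = z" using small by blast
      moreover have "s \<cdot> z \<in> A" using z by (intro sA)
      ultimately show "x \<in> fsrc A" using x F unfolding mem_fsrc[OF filter] by (metis filter_closed)
    qed
  qed
qed

end

section \<open>Meets and joins of two elements\<close>

lemma greatest_Lower2_iff:
  assumes "x \<in> carrier L" "y \<in> carrier L"
  shows "greatest L m (Lower L {x, y}) \<longleftrightarrow> m \<in> carrier L \<and> le L m x \<and> le L m y \<and>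
    (\<forall>z\<in>carrier L. le L z x \<and> le L z y \<longrightarrow> le L z m)"
  using assms unfolding greatest_def Lower_def by auto

lemma least_Upper2_iff:
  assumes "x \<in> carrier L" "y \<in> carrier L"
  shows "least L m (Upper L {x, y}) \<longleftrightarrow> m \<in> carrier L \<and> le L x m \<and> le L y m \<and>
    (\<forall>z\<in>carrier L. le L x z \<and> le L y z \<longrightarrow> le L m z)"
  using assms unfolding least_def Upper_def by auto

text \<open>The meet is a Hilbert choice among greatest lower bounds; antisymmetry leaves a single
  candidate.\<close>

lemma (in partial_order) meet_eqI:
  assumes "x \<in> carrier L" "y \<in> carrier L" "m \<in> carrier L" "m \<sqsubseteq> x" "m \<sqsubseteq> y"
    "\<And>z. z \<in> carrier L \<Longrightarrow> z \<sqsubseteq> x \<Longrightarrow> z \<sqsubseteq> y \<Longrightarrow> z \<sqsubseteq> m"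
  shows "x \<sqinter> y = m"
  unfolding meet_def Lattice.inf_def
  by (rule some_equality) (use assms in \<open>auto simp: greatest_Lower2_iff intro: le_antisym\<close>)

lemma (in partial_order) join_eqI:
  assumes "x \<in> carrier L" "y \<in> carrier L" "m \<in> carrier L" "x \<sqsubseteq> m" "y \<sqsubseteq> m"
    "\<And>z. z \<in> carrier L \<Longrightarrow> x \<sqsubseteq> z \<Longrightarrow> y \<sqsubseteq> z \<Longrightarrow> m \<sqsubseteq> z"
  shows "x \<squnion> y = m"
  unfolding join_def Lattice.sup_def
  by (rule some_equality) (use assms in \<open>auto simp: least_Upper2_iff intro: le_antisym\<close>)

section \<open>Groupoids\<close>

locale grpd =
  fixes G :: "'g top_groupoid"
  assumes grpd: "groupoid G"
begin

abbreviation src where "src \<equiv> gsrc G"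
abbreviation tgt where "tgt \<equiv> gtgt G"
abbreviation gc (infixl "\<odot>" 70) where "g \<odot> h \<equiv> gcomp G g h"
abbreviation iv where "iv \<equiv> ginv G"

lemma unit_laws [simp]:
  assumes "g \<in> carrier G"
  shows "src g \<in> carrier G" "tgt g \<in> carrier G" "src (src g) = src g" "tgt (src g) = src g"
    "src (tgt g) = tgt g" "tgt (tgt g) = tgt g" "g \<odot> src g = g" "tgt g \<odot> g = g"
  using grpd assms unfolding groupoid_def by auto

lemma comp_laws [simp]:
  assumes "g \<in> carrier G" "h \<in> carrier G" "src g = tgt h"
  shows "g \<odot> h \<in> carrier G" "src (g \<odot> h) = src h" "tgt (g \<odot> h) = tgt g"
  using grpd assms unfolding groupoid_def by auto

lemma comp_assoc:
  assumes "g \<in> carrier G" "h \<in> carrier G" "k \<in> carrier G" "src g = tgt h" "src h = tgt k"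
  shows "(g \<odot> h) \<odot> k = g \<odot> (h \<odot> k)"
  using grpd assms unfolding groupoid_def by auto

lemma inverse_ex:
  "g \<in> carrier G \<Longrightarrow> \<exists>h\<in>carrier G. src h = tgt g \<and> tgt h = src g \<and> h \<odot> g = src g \<and> g \<odot> h = tgt g"
  using grpd unfolding groupoid_def by auto

lemma inverse_unique:
  assumes "g \<in> carrier G" "h \<in> carrier G" "k \<in> carrier G"
    and "src h = tgt g" "tgt h = src g" "h \<odot> g = src g" "src k = tgt g" "tgt k = src g" "g \<odot> k = tgt g"
  shows "h = k"
proof -
  have "h = h \<odot> (g \<odot> k)" using assms by (metis unit_laws(7))
  also have "\<dots> = k" using assms by (metis comp_assoc unit_laws(8))
  finally show ?thesis .
qed

lemma inv_eqI:
  assumes "g \<in> carrier G" "h \<in> carrier G" "src h = tgt g" "tgt h = src g" "h \<odot> g = src g" "g \<odot> h = tgt g"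
  shows "iv g = h"
  unfolding ginv_def
proof (rule the_equality)
  fix k assume "k \<in> carrier G \<and> src k = tgt g \<and> tgt k = src g \<and> k \<odot> g = src g \<and> g \<odot> k = tgt g"
  then show "k = h" using assms by (intro inverse_unique[of g k h]) auto
qed (use assms in auto)

lemma inv_laws [simp]:
  assumes "g \<in> carrier G"
  shows "iv g \<in> carrier G" "src (iv g) = tgt g" "tgt (iv g) = src g" "iv g \<odot> g = src g" "g \<odot> iv g = tgt g"
proof -
  obtain h where h: "h \<in> carrier G" "src h = tgt g" "tgt h = src g" "h \<odot> g = src g" "g \<odot> h = tgt g"
    using inverse_ex[OF assms] by blast
  then have "iv g = h" using assms by (intro inv_eqI)
  with h show "iv g \<in> carrier G" "src (iv g) = tgt g" "tgt (iv g) = src g" "iv g \<odot> g = src g" "g \<odot> iv g = tgt g"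
    by auto
qed

lemma iv_iv [simp]: "g \<in> carrier G \<Longrightarrow> iv (iv g) = g"
  by (rule inv_eqI) auto

lemma inv_cancel [simp]:
  assumes "g \<in> carrier G" "h \<in> carrier G"
  shows "src g = tgt h \<Longrightarrow> iv g \<odot> (g \<odot> h) = h" "tgt g = tgt h \<Longrightarrow> g \<odot> (iv g \<odot> h) = h"
    "src h = tgt g \<Longrightarrow> (h \<odot> g) \<odot> iv g = h" "src h = src g \<Longrightarrow> (h \<odot> iv g) \<odot> g = h"
proof -
  show "src g = tgt h \<Longrightarrow> iv g \<odot> (g \<odot> h) = h" "tgt g = tgt h \<Longrightarrow> g \<odot> (iv g \<odot> h) = h"
    using assms by (simp_all add: comp_assoc[symmetric])
  show "src h = tgt g \<Longrightarrow> (h \<odot> g) \<odot> iv g = h" "src h = src g \<Longrightarrow> (h \<odot> iv g) \<odot> g = h"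
    using assms unit_laws(7)[of h] by (simp_all add: comp_assoc)
qed

lemma gids_iff: "e \<in> gids G \<longleftrightarrow> e \<in> carrier G \<and> src e = e"
  by (auto simp: gids_def)

lemma gids_tgt: "e \<in> gids G \<Longrightarrow> tgt e = e"
  by (metis gids_iff unit_laws(4))

lemma src_gids [simp]: "g \<in> carrier G \<Longrightarrow> src g \<in> gids G"
  and tgt_gids [simp]: "g \<in> carrier G \<Longrightarrow> tgt g \<in> gids G"
  by (auto simp: gids_iff)

text \<open>If \<open>a\<close> and \<open>b\<close> have the same target, then
  \<open>iv a \<odot> b\<close> is defined and lies in the product of the inverse of
  \<open>A\<close> with \<open>A\<close>. When it is an identity, it equals both its source and its
  target, hence \<open>a = b\<close>. Dually for equal sources. Later proofs use the injectivity
  form.\<close>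

lemma local_bisection_iff:
  "local_bisection G A \<longleftrightarrow> A \<subseteq> carrier G \<and> inj_on src A \<and> inj_on tgt A"
proof
  assume L: "local_bisection G A"
  then have A: "A \<subseteq> carrier G" by (simp add: local_bisection_def)
  have "a = b" if ab: "a \<in> A" "b \<in> A" "tgt a = tgt b" for a b
  proof -
    have c: "a \<in> carrier G" "b \<in> carrier G" using ab A by auto
    have "iv a \<odot> b \<in> gset_mult G (iv ` A) A" unfolding gset_mult_def using ab c by fastforce
    then have "iv a \<odot> b \<in> gids G" using L by (auto simp: local_bisection_def)
    then have "src b = iv a \<odot> b" "src a = iv a \<odot> b" using c ab gids_tgt by (fastforce simp: gids_iff)+
    then show ?thesis using c ab by (metis inv_cancel(2) unit_laws(7))
  qed
  moreover have "a = b" if ab: "a \<in> A" "b \<in> A" "src a = src b" for a b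
  proof -
    have c: "a \<in> carrier G" "b \<in> carrier G" using ab A by auto
    have "a \<odot> iv b \<in> gset_mult G A (iv ` A)" unfolding gset_mult_def using ab c by fastforce
    then have "a \<odot> iv b \<in> gids G" using L by (auto simp: local_bisection_def)
    then have "tgt b = a \<odot> iv b" "tgt a = a \<odot> iv b" using c ab gids_tgt by (fastforce simp: gids_iff)+
    then show ?thesis using c ab by (metis inv_cancel(4) unit_laws(8))
  qed
  ultimately show "A \<subseteq> carrier G \<and> inj_on src A \<and> inj_on tgt A" using A by (auto simp: inj_on_def)
next
  assume A: "A \<subseteq> carrier G \<and> inj_on src A \<and> inj_on tgt A"
  have "iv a \<odot> b \<in> gids G" if "a \<in> A" "b \<in> A" "src (iv a) = tgt b" for a b
  proof -
    have "a \<in> carrier G" "a = b" using that A by (auto simp: inj_on_def subset_iff)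
    then show ?thesis by auto
  qed
  moreover have "a \<odot> iv b \<in> gids G" if "a \<in> A" "b \<in> A" "src a = tgt (iv b)" for a b
  proof -
    have "a \<in> carrier G" "a = b" using that A by (auto simp: inj_on_def subset_iff)
    then show ?thesis by auto
  qed
  ultimately show "local_bisection G A"
    using A unfolding local_bisection_def gset_mult_def by auto
qed

end

section \<open>Boolean inverse meet-semigroups and their ultrafilters\<close>

context inverse_sg
begin

abbreviation uf where "uf \<equiv> sg_ultrafilter S"
text \<open>Orthogonality is phrased through lower bounds instead of meets, so that it makes sense
  in any inverse semigroup with zero.\<close>

abbreviation disj where "disj x t \<equiv> (\<forall>z. z \<preceq> x \<longrightarrow> z \<preceq> t \<longrightarrow> z = zero S)"

lemma uf_filter: "uf F \<Longrightarrow> sg_filter S F"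
  by (simp add: sg_ultrafilter_def)

text \<open>A larger filter containing \<open>t\<close> would also contain some \<open>x\<close>
  disjoint from \<open>t\<close>, and then a common lower bound of the two, which is zero.\<close>

lemma ufI:
  assumes F: "sg_filter S F" and sep: "\<And>t. t \<in> carrier S \<Longrightarrow> t \<notin> F \<Longrightarrow> \<exists>x\<in>F. disj x t"
  shows "uf F"
  unfolding sg_ultrafilter_def
proof (intro conjI allI impI F)
  fix F' assume F': "sg_filter S F' \<and> F \<subseteq> F'"
  have False if t: "t \<in> F'" "t \<notin> F" for t
  proof -
    obtain x where x: "x \<in> F" "disj x t" using sep[OF _ t(2)] filter_closed[of F' t] t F' by blast
    then obtain z where "z \<in> F'" "z \<preceq> x" "z \<preceq> t" using F' t filter_dir[of F' x t] by blast
    then show False using x F' filter_zero by blast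
  qed
  then show "F' = F" using F' by blast
qed

lemma uf_extends:
  assumes F: "sg_filter S F" shows "\<exists>U. uf U \<and> F \<subseteq> U"
proof -
  define Z where "Z = {H. sg_filter S H \<and> F \<subseteq> H}"
  have "\<exists>M\<in>Z. \<forall>X\<in>Z. M \<subseteq> X \<longrightarrow> X = M"
  proof (rule subset_Zorn_nonempty)
    show "Z \<noteq> {}" using F by (auto simp: Z_def)
    fix C assume C: "C \<noteq> {}" "subset.chain Z C"
    then have CZ: "H \<in> C \<Longrightarrow> sg_filter S H \<and> F \<subseteq> H" for H by (auto simp: Z_def subset.chain_def)
    have "sg_filter S (\<Union>C)"
      unfolding sg_filter_def
    proof (intro conjI ballI impI)
      show "\<Union>C \<subseteq> carrier S" using CZ filter_subset by blast
      show "\<Union>C \<noteq> {}" using C CZ filter_nonempty by fastforce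
      show "zero S \<notin> \<Union>C" using CZ filter_zero by auto
      fix x y
      show "y \<in> \<Union>C" if "x \<in> \<Union>C" "y \<in> carrier S" "x \<preceq> y" using that CZ filter_up by blast
      assume "x \<in> \<Union>C" "y \<in> \<Union>C"
      then obtain H K where HK: "H \<in> C" "K \<in> C" "x \<in> H" "y \<in> K" by blast
      then have "H \<subseteq> K \<or> K \<subseteq> H" using C by (auto simp: subset.chain_def)
      then obtain L where "L \<in> C" "x \<in> L" "y \<in> L" using HK by blast
      then show "\<exists>z\<in>\<Union>C. z \<preceq> x \<and> z \<preceq> y" using CZ[of L] filter_dir[of L x y] by blast
    qed
    then show "\<Union>C \<in> Z" using C CZ by (auto simp: Z_def)
  qed
  then obtain M where M0: "M \<in> Z" "\<forall>X\<in>Z. M \<subseteq> X \<longrightarrow> X = M" by blast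
  have M: "sg_filter S M" "F \<subseteq> M" using M0(1) by (simp_all add: Z_def)
  have "\<And>X. sg_filter S X \<Longrightarrow> F \<subseteq> X \<Longrightarrow> M \<subseteq> X \<Longrightarrow> X = M"
    using M0(2) by (simp add: Z_def)
  then have "uf M" using M unfolding sg_ultrafilter_def by (meson subset_trans)
  then show ?thesis using M by blast
qed

lemma uf_exists:
  assumes "s \<in> carrier S" "s \<noteq> zero S" shows "\<exists>U. uf U \<and> s \<in> U"
proof -
  have "sg_filter S {x \<in> carrier S. s \<preceq> x}"
    using assms unfolding sg_filter_def by (auto dest: le_zero intro: le_trans)
  then show ?thesis using uf_extends assms by blast
qed

end

lemma nat_order_simps [simp]: "carrier (nat_order S) = carrier S" "le (nat_order S) = nat_le S"
  by (simp_all add: nat_order_def)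

lemma idem_order_simps [simp]: "carrier (idem_order S) = idems S" "le (idem_order S) = nat_le S"
  by (simp_all add: idem_order_def)

locale bim =
  fixes S :: "'a zero_semigroup" (structure)
  assumes bim: "boolean_inverse_meet_semigroup S"

sublocale bim \<subseteq> inverse_sg
  by unfold_locales (use bim in \<open>simp add: boolean_inverse_meet_semigroup_def distributive_inverse_semigroup_def\<close>)

context bim
begin

abbreviation mt (infixl "\<sqinter>\<^sub>n" 70) where "s \<sqinter>\<^sub>n t \<equiv> meet (nat_order S) s t"
abbreviation V where "V \<equiv> uf_containing S"

lemma nat_order_lower_semilattice: "lower_semilattice (nat_order S)"
  and idem_gen_boolean_algebra: "gen_boolean_algebra (idem_order S) (zero S)"
  and distributive: "distributive_inverse_semigroup S"
  using bim by (simp_all add: boolean_inverse_meet_semigroup_def)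

lemma meet_laws:
  assumes "s \<in> carrier S" "t \<in> carrier S"
  shows meet_closed [simp, intro]: "s \<sqinter>\<^sub>n t \<in> carrier S"
    and meet_le1 [simp, intro]: "s \<sqinter>\<^sub>n t \<preceq> s" and meet_le2 [simp, intro]: "s \<sqinter>\<^sub>n t \<preceq> t"
proof -
  interpret L: lower_semilattice "nat_order S" by (rule nat_order_lower_semilattice)
  show "s \<sqinter>\<^sub>n t \<in> carrier S" "s \<sqinter>\<^sub>n t \<preceq> s" "s \<sqinter>\<^sub>n t \<preceq> t"
    using L.meet_closed[of s t] L.meet_left[of s t] L.meet_right[of s t] assms by simp_all
qed

lemma le_meet: "s \<in> carrier S \<Longrightarrow> t \<in> carrier S \<Longrightarrow> z \<preceq> s \<Longrightarrow> z \<preceq> t \<Longrightarrow> z \<preceq> s \<sqinter>\<^sub>n t"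
proof -
  interpret L: lower_semilattice "nat_order S" by (rule nat_order_lower_semilattice)
  show "s \<in> carrier S \<Longrightarrow> t \<in> carrier S \<Longrightarrow> z \<preceq> s \<Longrightarrow> z \<preceq> t \<Longrightarrow> z \<preceq> s \<sqinter>\<^sub>n t"
    using L.meet_le[of z s t] by auto
qed

lemma joins_exist:
  assumes "finite A" "A \<noteq> {}" "A \<subseteq> carrier S" "\<And>s t. s \<in> A \<Longrightarrow> t \<in> A \<Longrightarrow> compatible S s t"
  shows "\<exists>j. is_join S A j"
    and "is_join S A j \<Longrightarrow> c \<in> carrier S \<Longrightarrow> is_join S ((\<lambda>a. a \<cdot> c) ` A) (j \<cdot> c)"
  using distributive assms unfolding distributive_inverse_semigroup_def by blast+

lemma idem_meet:
  assumes "e \<in> E" "f \<in> E" shows "meet (idem_order S) e f = e \<cdot> f"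
proof (rule partial_order.meet_eqI[OF idem_order_partial_order], unfold idem_order_simps)
  fix z assume z: "z \<in> E" "z \<preceq> e" "z \<preceq> f"
  then show "z \<preceq> e \<cdot> f" using assms by (simp add: idem_le_iff assoc)
qed (use assms in \<open>auto intro: leI_right leI_left\<close>)

text \<open>This restates the Boolean axiom through product and order. The element \<open>e\<close>
  is the largest one below \<open>b\<close> orthogonal to \<open>a\<close>: if \<open>x\<close> is
  another, distributivity gives \<open>x = x \<cdot> e\<close>, because \<open>b\<close> is the join
  of \<open>a\<close> and \<open>e\<close>. If \<open>e\<close> vanishes, that join is
  \<open>a\<close>.\<close>

lemma idem_complement:
  assumes a: "a \<in> E" and b: "b \<in> E" and ab: "a \<preceq> b"
  shows "\<exists>e\<in>E. e \<preceq> b \<and> a \<cdot> e = zero S \<and> (\<forall>x\<in>E. x \<preceq> b \<longrightarrow> x \<cdot> a = zero S \<longrightarrow> x \<preceq> e) \<and>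
    (e = zero S \<longrightarrow> b \<preceq> a)"
proof -
  let ?L = "idem_order S"
  interpret L: lattice ?L using idem_gen_boolean_algebra by (simp add: gen_boolean_algebra_def)
  obtain e where e: "e \<in> E" "join ?L a b = join ?L a e" "meet ?L a e = zero S"
    using idem_gen_boolean_algebra a b unfolding gen_boolean_algebra_def idem_order_simps by blast
  have dist: "meet ?L x (join ?L y w) = join ?L (meet ?L x y) (meet ?L x w)"
    if "x \<in> E" "y \<in> E" "w \<in> E" for x y w
    using idem_gen_boolean_algebra that unfolding gen_boolean_algebra_def idem_order_simps by blast
  have b_eq: "join ?L a b = b"
    by (rule L.join_eqI) (use a b ab in auto)
  have be: "join ?L a e = b" using b_eq e by simp
  have zero_join: "join ?L (zero S) y = y" if "y \<in> E" for y
    by (rule L.join_eqI) (use that in auto)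
  show ?thesis
  proof (intro bexI[of _ e] conjI ballI impI)
    show "e \<preceq> b" using L.join_right[of a e] be a e by simp
    show "a \<cdot> e = zero S" using e a by (simp add: idem_meet)
    show "x \<preceq> e" if x: "x \<in> E" "x \<preceq> b" "x \<cdot> a = zero S" for x
    proof -
      have "b \<cdot> x = x" using x b by (simp add: idem_le_iff)
      then have "x = meet ?L x (join ?L a e)" using x b be by (simp add: idem_meet idem_comm)
      also have "\<dots> = x \<cdot> e" using x a e by (simp add: dist idem_meet zero_join)
      finally have "x = x \<cdot> e" .
      then show ?thesis using x e by (metis idem_closed leI_left)
    qed
    show "b \<preceq> a" if "e = zero S"
    proof -
      have "join ?L a e = a" by (rule L.join_eqI) (use a that in auto)
      then show ?thesis using be a by simp
    qed
  qed (rule e)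
qed

text \<open>The witness is the difference of \<open>s\<close> and \<open>t\<close>: inside
  \<open>s\<star> \<cdot> s\<close> take the complement \<open>e\<close> of the domain of the meet
  \<open>m\<close> of \<open>s\<close> and \<open>t\<close>, and restrict \<open>s\<close> to it. A
  \<open>z\<close> below \<open>s\<close> and disjoint from \<open>t\<close> satisfies
  \<open>z \<cdot> a = zero S\<close>, where \<open>a\<close> is the domain of \<open>m\<close>,
  since that product is below both \<open>z\<close> and \<open>t\<close>. The last conjunct lets the
  complement detect the order.\<close>

lemma relative_complement:
  assumes s: "s \<in> carrier S" and t: "t \<in> carrier S"
  shows "\<exists>x\<in>carrier S. x \<preceq> s \<and> disj x t \<and> (\<forall>z. z \<preceq> s \<longrightarrow> disj z t \<longrightarrow> z \<preceq> x) \<and> (x = zero S \<longrightarrow> s \<preceq> t)"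
proof -
  define m where "m = s \<sqinter>\<^sub>n t"
  define a where "a = m\<star> \<cdot> m"
  have m: "m \<in> carrier S" "m \<preceq> s" "m \<preceq> t" using s t by (auto simp: m_def)
  have a: "a \<in> E" "a \<preceq> s\<star> \<cdot> s" "s \<cdot> a = m" using m s by (auto simp: a_def le_dom le_domD)
  obtain e where e: "e \<in> E" "e \<preceq> s\<star> \<cdot> s" "a \<cdot> e = zero S"
      "\<And>x. x \<in> E \<Longrightarrow> x \<preceq> s\<star> \<cdot> s \<Longrightarrow> x \<cdot> a = zero S \<Longrightarrow> x \<preceq> e" "e = zero S \<Longrightarrow> s\<star> \<cdot> s \<preceq> a"
    using idem_complement[of a "s\<star> \<cdot> s"] a s by auto
  have dse: "(s\<star> \<cdot> s) \<cdot> e = e" using e s by (simp add: idem_le_iff)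
  show ?thesis
  proof (intro bexI[of _ "s \<cdot> e"] conjI allI impI)
    show "s \<cdot> e \<preceq> s" using s e by (auto intro: leI_right)
    show "z = zero S" if z: "z \<preceq> s \<cdot> e" "z \<preceq> t" for z
    proof -
      have zS: "z \<in> carrier S" using z t by blast
      have "z \<preceq> s" using z s e leI_right le_trans by blast
      then have "z \<preceq> m" using z s t by (auto simp: m_def intro: le_meet)
      then have 1: "a \<cdot> (z\<star> \<cdot> z) = z\<star> \<cdot> z"
        using le_dom[of z m] m a zS by (simp add: idem_le_iff flip: a_def)
      have "(s \<cdot> e)\<star> \<cdot> (s \<cdot> e) = e \<cdot> ((s\<star> \<cdot> s) \<cdot> e)" using s e by (simp add: assoc)
      also have "\<dots> = e" unfolding dse using e by simp
      finally have 2: "e \<cdot> (z\<star> \<cdot> z) = z\<star> \<cdot> z"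
        using le_dom[OF z(1)] s e zS by (simp add: idem_le_iff)
      have "z\<star> \<cdot> z = (a \<cdot> e) \<cdot> (z\<star> \<cdot> z)"
        using 1 2 a(1) e(1) zS by (metis assoc dom_idem idem_closed)
      then have "z\<star> \<cdot> z = zero S" using e(3) zS by (metis zero_left dom_idem idem_closed)
      then show ?thesis by (rule dom_zero[OF zS])
    qed
    show "z \<preceq> s \<cdot> e" if z: "z \<preceq> s" "disj z t" for z
    proof -
      have zS: "z \<in> carrier S" using z s by blast
      have sz: "s \<cdot> (z\<star> \<cdot> z) = z" using z s by (simp add: le_domD)
      have "z \<cdot> a = s \<cdot> ((z\<star> \<cdot> z) \<cdot> a)" using sz s zS a by (metis assoc dom_idem idem_closed)
      also have "\<dots> = m \<cdot> (z\<star> \<cdot> z)" using a s zS idem_comm[of "z\<star> \<cdot> z" a]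
        by (metis assoc dom_idem idem_closed)
      finally have eq: "z \<cdot> a = m \<cdot> (z\<star> \<cdot> z)" .
      have "z \<cdot> a \<preceq> m" unfolding eq using m zS by (auto intro: leI_right)
      then have "z \<cdot> a \<preceq> t" using m t le_trans by blast
      moreover have "z \<cdot> a \<preceq> z" using zS a by (auto intro: leI_right)
      ultimately have "z \<cdot> a = zero S" using z by blast
      then have "(z\<star> \<cdot> z) \<cdot> a = zero S" using zS a by (simp add: assoc)
      then have "z\<star> \<cdot> z \<preceq> e" using e(4) zS z s le_dom by blast
      then show ?thesis using le_mult_left[of "z\<star> \<cdot> z" e s] s e sz by simp
    qed
    show "s \<preceq> t" if "s \<cdot> e = zero S"
    proof -
      have "e = s\<star> \<cdot> (s \<cdot> e)" using dse s e by (simp add: assoc)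
      then have "s\<star> \<cdot> s \<preceq> a" using e(5) that s by simp
      then have "s \<preceq> m" using le_mult_left[of "s\<star> \<cdot> s" a s] a s by simp
      then show ?thesis using m t le_trans by blast
    qed
  qed (use s e in auto)
qed

text \<open>This is the converse of \<open>ufI\<close>. If every member of \<open>F\<close> had a
  nonzero lower bound in common with \<open>t\<close>, the elements above some meet of a member with
  \<open>t\<close> would form a filter that contains \<open>F\<close> and \<open>t\<close>, against
  maximality.\<close>

lemma uf_sep:
  assumes U: "uf F" and t: "t \<in> carrier S" "t \<notin> F" and s: "s \<in> F"
  shows "\<exists>x\<in>F. x \<preceq> s \<and> disj x t"
proof -
  have F: "sg_filter S F" using U by (rule uf_filter)
  have "\<exists>x\<in>F. disj x t"
  proof (rule ccontr)
    assume neg: "\<not> ?thesis"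
    define H where "H = {y \<in> carrier S. \<exists>x\<in>F. x \<sqinter>\<^sub>n t \<preceq> y}"
    have "sg_filter S H" unfolding sg_filter_def
    proof (intro conjI ballI impI)
      show "H \<subseteq> carrier S" by (auto simp: H_def)
      have "s \<in> H" using s F t meet_le1 filter_closed unfolding H_def by blast
      then show "H \<noteq> {}" by blast
      show "zero S \<notin> H"
      proof
        assume "zero S \<in> H"
        then obtain x where x: "x \<in> F" "x \<sqinter>\<^sub>n t = zero S" using F t by (auto simp: H_def dest: le_zero)
        then have "disj x t" using le_meet[of x t] t F by (auto dest: le_zero)
        then show False using neg x by blast
      qed
      fix x y
      show "y \<in> H" if "x \<in> H" "y \<in> carrier S" "x \<preceq> y" using that le_trans unfolding H_def by blast
      assume "x \<in> H" "y \<in> H"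
      then obtain p q where pq: "p \<in> F" "q \<in> F" "p \<sqinter>\<^sub>n t \<preceq> x" "q \<sqinter>\<^sub>n t \<preceq> y" "x \<in> carrier S" "y \<in> carrier S"
        by (auto simp: H_def)
      then obtain z where z: "z \<in> F" "z \<preceq> p" "z \<preceq> q" using filter_dir[OF F] by blast
      have c: "p \<in> carrier S" "q \<in> carrier S" "z \<in> carrier S" using pq z F by auto
      have "z \<sqinter>\<^sub>n t \<preceq> p" "z \<sqinter>\<^sub>n t \<preceq> q" "z \<sqinter>\<^sub>n t \<preceq> t"
        using le_trans[OF meet_le1 z(2)] le_trans[OF meet_le1 z(3)] c t(1) by auto
      then have "z \<sqinter>\<^sub>n t \<preceq> x" "z \<sqinter>\<^sub>n t \<preceq> y"
        using le_trans[OF le_meet pq(3,5)] le_trans[OF le_meet pq(4,6)] c t(1) by auto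
      moreover have "z \<sqinter>\<^sub>n t \<in> H" using z c t le_refl meet_closed unfolding H_def by blast
      ultimately show "\<exists>z\<in>H. z \<preceq> x \<and> z \<preceq> y" by blast
    qed
    moreover have "F \<subseteq> H" using F t meet_le1 filter_closed unfolding H_def by blast
    ultimately have "H = F" using U by (auto simp: sg_ultrafilter_def)
    moreover have "t \<in> H" using s F t meet_le2 filter_closed unfolding H_def by blast
    ultimately show False using t by simp
  qed
  then obtain x where x: "x \<in> F" "disj x t" by blast
  obtain z where z: "z \<in> F" "z \<preceq> x" "z \<preceq> s" using filter_dir[OF F x(1) s] by blast
  then have "disj z t" using le_trans[OF _ z(2)] x F by auto
  then show ?thesis using z by blast
qed

section \<open>The sets of ultrafilters containing a given element\<close>

lemma mem_V: "F \<in> V s \<longleftrightarrow> uf F \<and> s \<in> F"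
  by (simp add: uf_containing_def ultrafilters_def)

text \<open>The part of \<open>s\<close> outside \<open>t\<close> is nonzero, and no ultrafilter
  containing that part can contain \<open>t\<close>.\<close>

lemma separation:
  assumes "s \<in> carrier S" "t \<in> carrier S" "\<not> s \<preceq> t"
  shows "\<exists>F. F \<in> V s \<and> F \<notin> V t"
proof -
  obtain x where x: "x \<in> carrier S" "x \<preceq> s" "disj x t" "x \<noteq> zero S"
    using relative_complement[OF assms(1,2)] assms(3) by blast
  obtain F where F: "uf F" "x \<in> F" using uf_exists x by blast
  have f: "sg_filter S F" using F uf_filter by blast
  have "s \<in> F" using filter_up[OF f] F x assms by blast
  moreover have "t \<notin> F" using filter_dir[OF f F(2)] filter_zero[OF f] x by metis
  ultimately show ?thesis using F by (auto simp: mem_V)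
qed

lemma V_mono: "s \<preceq> t \<Longrightarrow> t \<in> carrier S \<Longrightarrow> V s \<subseteq> V t"
  using filter_up uf_filter by (auto simp: mem_V)

lemma V_subset_iff: "s \<in> carrier S \<Longrightarrow> t \<in> carrier S \<Longrightarrow> V s \<subseteq> V t \<longleftrightarrow> s \<preceq> t"
  using separation V_mono by blast

lemma V_inj: "s \<in> carrier S \<Longrightarrow> t \<in> carrier S \<Longrightarrow> V s = V t \<Longrightarrow> s = t"
  by (metis V_subset_iff le_antisym order_refl)

lemma V_zero [simp]: "V (zero S) = {}"
  using filter_zero uf_filter by (auto simp: mem_V)

lemma V_meet:
  assumes "s \<in> carrier S" "t \<in> carrier S" shows "V (s \<sqinter>\<^sub>n t) = V s \<inter> V t"
proof
  show "V (s \<sqinter>\<^sub>n t) \<subseteq> V s \<inter> V t" using assms V_mono by auto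
  show "V s \<inter> V t \<subseteq> V (s \<sqinter>\<^sub>n t)"
  proof
    fix F assume "F \<in> V s \<inter> V t"
    then have F: "uf F" "sg_filter S F" "s \<in> F" "t \<in> F"
      by (auto simp: mem_V uf_filter)
    then obtain z where "z \<in> F" "z \<preceq> s" "z \<preceq> t" using filter_dir by blast
    then have "s \<sqinter>\<^sub>n t \<in> F" using filter_up[OF F(2)] le_meet assms by blast
    then show "F \<in> V (s \<sqinter>\<^sub>n t)" using F by (simp add: mem_V)
  qed
qed

text \<open>If \<open>F\<close> missed every member of \<open>A\<close>, repeated separation would
  give one \<open>x\<close> in \<open>F\<close> below \<open>j\<close> and disjoint from all of
  them, and distributivity would make \<open>x\<close> a join of zeros.\<close>

lemma uf_prime:
  assumes A: "finite A" "A \<noteq> {}" "A \<subseteq> carrier S" "\<And>s t. s \<in> A \<Longrightarrow> t \<in> A \<Longrightarrow> compatible S s t"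
    and j: "is_join S A j" and F: "uf F" "j \<in> F"
  shows "\<exists>a\<in>A. a \<in> F"
proof (rule ccontr)
  assume neg: "\<not> ?thesis"
  have f: "sg_filter S F" using F uf_filter by blast
  have "\<exists>x\<in>F. x \<preceq> j \<and> (\<forall>a\<in>A. disj x a)"
    using A(1,3) neg
  proof (induction A rule: finite_induct)
    case empty
    then show ?case using F f by (auto intro: bexI[of _ j])
  next
    case (insert a A)
    then obtain y where y: "y \<in> F" "y \<preceq> j" "\<forall>a\<in>A. disj y a" by auto
    obtain x where x: "x \<in> F" "x \<preceq> y" "disj x a"
      using uf_sep[OF F(1) _ _ y(1), of a] insert by auto
    have "x \<preceq> j" "\<forall>b\<in>A. disj x b" 
      using le_trans[OF x(2) y(2)] x(3) y(3) le_trans[OF _ x(2)] y(1) f F(2) by auto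
    then show ?case using x by blast
  qed
  then obtain x where x: "x \<in> F" "x \<preceq> j" "\<And>a. a \<in> A \<Longrightarrow> disj x a" by blast
  have c: "x \<in> carrier S" "j \<in> carrier S" using x F f by auto
  have jx: "j \<cdot> (x\<star> \<cdot> x) = x" using x c le_domD by blast
  \<comment> \<open>Multiplying by the domain of \<open>x\<close> turns the join \<open>j\<close>
    into \<open>x\<close>, while it sends each \<open>a\<close> to an element below both
    \<open>a\<close> and \<open>x\<close>, that is, to zero.\<close>
  have join: "is_join S ((\<lambda>a. a \<cdot> (x\<star> \<cdot> x)) ` A) x"
    using joins_exist(2)[OF A j, of "x\<star> \<cdot> x"] c jx by simp
  have "a \<cdot> (x\<star> \<cdot> x) = zero S" if a: "a \<in> A" for a
  proof -
    have "a \<preceq> j" using j a A(3) by (auto simp: is_join_iff)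
    then have "a \<cdot> (x\<star> \<cdot> x) \<preceq> x" using le_mult_right[of a j "x\<star> \<cdot> x"] c jx by simp
    moreover have "a \<cdot> (x\<star> \<cdot> x) \<preceq> a" using a A c by (auto intro: leI_right)
    ultimately show ?thesis using x(3)[OF a] by blast
  qed
  moreover have "(\<lambda>a. a \<cdot> (x\<star> \<cdot> x)) ` A \<subseteq> carrier S" using A c by auto
  ultimately have "x \<preceq> zero S" using join by (subst (asm) is_join_iff) auto
  then show False using x filter_zero[OF f] le_zero by auto
qed

lemma V_join:
  assumes A: "finite A" "A \<noteq> {}" "A \<subseteq> carrier S" "\<And>s t. s \<in> A \<Longrightarrow> t \<in> A \<Longrightarrow> compatible S s t"
    and j: "is_join S A j"
  shows "V j = \<Union>(V ` A)"
proof
  show "V j \<subseteq> \<Union>(V ` A)" using uf_prime[OF A j] by (auto simp: mem_V)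
  show "\<Union>(V ` A) \<subseteq> V j" using j A(3) V_mono by (auto simp: is_join_iff)
qed

subsection \<open>Multiplying ultrafilters\<close>

text \<open>Separation of \<open>t\<close> from the product is pulled back along \<open>a\<close> to
  separation of \<open>a\<star> \<cdot> t\<close> from \<open>B\<close>, and the separating
  \<open>b\<close> is carried forward again to \<open>a \<cdot> b\<close>.\<close>

lemma uf_fmul:
  assumes A: "sg_filter S A" and B: "uf B" and AB: "fsrc A = frng B"
  shows "uf (fmul A B)"
proof (rule ufI)
  have B': "sg_filter S B" using B by (rule uf_filter)
  show "sg_filter S (fmul A B)" using filter_fmul[OF A B' AB] .
  fix t assume t: "t \<in> carrier S" "t \<notin> fmul A B"
  obtain a where a: "a \<in> A" using filter_nonempty[OF A] by blast
  have aS: "a \<in> carrier S" using a A by auto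
  have "(a \<cdot> a\<star>) \<cdot> t \<preceq> t" using aS t by (auto intro: leI_left)
  then have "a\<star> \<cdot> t \<notin> B" using t a aS unfolding mem_fmul by (metis assoc inv_closed)
  moreover obtain b0 where b0: "b0 \<in> B" using filter_nonempty[OF B'] by blast
  ultimately obtain b where b: "b \<in> B" "disj b (a\<star> \<cdot> t)" using uf_sep[OF B] t aS by blast
  have bS: "b \<in> carrier S" using b B' by auto
  have "a \<cdot> b \<in> fmul A B" using a b aS bS by (intro mult_mem_fmul)
  moreover have "disj (a \<cdot> b) t"
  proof (intro allI impI)
    fix x assume x: "x \<preceq> a \<cdot> b" "x \<preceq> t"
    have xS: "x \<in> carrier S" using x t by blast
    have "a\<star> \<cdot> x \<preceq> (a\<star> \<cdot> a) \<cdot> b" using le_mult_left[OF x(1), of "a\<star>"] aS bS by (simp add: assoc)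
    then have "a\<star> \<cdot> x \<preceq> b" using leI_left[of b "a\<star> \<cdot> a"] aS bS le_trans by blast
    moreover have "a\<star> \<cdot> x \<preceq> a\<star> \<cdot> t" using x t aS by (intro le_mult_left) auto
    ultimately have 0: "a\<star> \<cdot> x = zero S" using b by blast
    \<comment> \<open>Being below \<open>a \<cdot> b\<close>, the element \<open>x\<close> is
      recovered from \<open>a\<star> \<cdot> x\<close> by multiplying with \<open>a\<close>.\<close>
    have "x = (a \<cdot> b) \<cdot> (x\<star> \<cdot> x)" using le_domD[OF x(1)] aS bS by simp
    then have "x = a \<cdot> (a\<star> \<cdot> x)" using aS bS xS by (metis assoc inv_closed inv_left2 mult_closed)
    then show "x = zero S" using 0 aS by simp
  qed
  ultimately show "\<exists>x\<in>fmul A B. disj x t" by blast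
qed

lemma uf_finv:
  assumes "uf A" shows "uf (finv A)"
proof (rule ufI)
  have A: "sg_filter S A" using assms by (rule uf_filter)
  have sub: "A \<subseteq> carrier S" using A by auto
  show "sg_filter S (finv A)" using filter_finv[OF A] .
  fix t assume t: "t \<in> carrier S" "t \<notin> finv A"
  then have "t\<star> \<notin> A" by (simp add: mem_finv[OF sub])
  moreover obtain a where "a \<in> A" using filter_nonempty[OF A] by blast
  ultimately obtain x where x: "x \<in> A" "disj x (t\<star>)" using uf_sep[OF assms] t by blast
  have xS: "x \<in> carrier S" using x sub by auto
  have "disj (x\<star>) t"
  proof (intro allI impI)
    fix z assume z: "z \<preceq> x\<star>" "z \<preceq> t"
    have zS: "z \<in> carrier S" using z t by blast
    have "z\<star> \<preceq> x" "z\<star> \<preceq> t\<star>" using le_inv[OF z(1)] le_inv[OF z(2)] xS t by auto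
    then have "z\<star> = zero S" using x by blast
    then have "z\<star>\<star> = zero S" by simp
    then show "z = zero S" using zS by simp
  qed
  then show "\<exists>x\<in>finv A. disj x t" using x by blast
qed

text \<open>The source is the product of the filter \<open>finv A\<close> with the ultrafilter
  \<open>A\<close>.\<close>

lemma uf_fsrc:
  assumes A: "uf A" shows "uf (fsrc A)"
proof (rule uf_fmul)
  have "sg_filter S A" using A by (rule uf_filter)
  then show "sg_filter S (finv A)" "fsrc (finv A) = frng A" by (simp_all add: filter_finv finv_finv filter_subset)
qed (rule A)

lemma uf_frng:
  assumes A: "uf A" shows "uf (frng A)"
proof -
  have "sg_filter S A" using A by (rule uf_filter)
  then show ?thesis using uf_fsrc[OF uf_finv[OF A]] by (simp add: finv_finv filter_subset)
qed

text \<open>The translate \<open>A\<close> of \<open>F\<close> along \<open>s\<close> is at first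
  only a filter, but its source \<open>F\<close> is an ultrafilter and \<open>A = fmul A F\<close>,
  so \<open>uf_fmul\<close> supplies maximality.\<close>

lemma uf_src_ex:
  assumes F: "uf F" "fsrc F = F" and s: "s \<in> carrier S" "s\<star> \<cdot> s \<in> F"
  shows "\<exists>A. uf A \<and> s \<in> A \<and> fsrc A = F"
proof -
  have f: "sg_filter S F" using F uf_filter by blast
  obtain A where A: "sg_filter S A" "fsrc A = F" "s \<in> A" using filter_translate[OF f F(2) s] by blast
  have "frng F = F" using frng_fsrc[OF f] F by simp
  then have "uf (fmul A F)" using A F by (intro uf_fmul) auto
  then show ?thesis using A fmul_fsrc[OF A(1)] by auto
qed

lemma uf_eqI:
  assumes "uf A" "uf B" "A \<subseteq> B" shows "A = B"
  using assms uf_filter unfolding sg_ultrafilter_def by blast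

end

section \<open>The groupoid of ultrafilters\<close>

lemma uf_groupoid_simps [simp]:
  "carrier (uf_groupoid S) = ultrafilters S"
  "gsrc (uf_groupoid S) A = up_closure S (sg_set_mult S (sg_inv S ` A) A)"
  "gtgt (uf_groupoid S) A = up_closure S (sg_set_mult S A (sg_inv S ` A))"
  "gcomp (uf_groupoid S) A B = up_closure S (sg_set_mult S A B)"
  "gtop (uf_groupoid S) = topology_generated_by (uf_containing S ` carrier S)"
  by (simp_all add: uf_groupoid_def)

lemma ultrafilters_iff [simp]: "F \<in> ultrafilters S \<longleftrightarrow> sg_ultrafilter S F"
  by (simp add: ultrafilters_def)

context bim
begin

lemma uf_closed: "uf F \<Longrightarrow> x \<in> F \<Longrightarrow> x \<in> carrier S"
  using uf_filter filter_closed by blast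

lemma uf_subset: "uf F \<Longrightarrow> F \<subseteq> carrier S"
  using uf_closed by blast

lemma Union_V [simp]: "\<Union>(V ` carrier S) = ultrafilters S"
proof -
  have "F \<in> \<Union>(V ` carrier S)" if F: "uf F" for F
  proof -
    obtain s where "s \<in> F" using filter_nonempty[OF uf_filter[OF F]] by blast
    then show ?thesis using F uf_closed by (auto simp: mem_V)
  qed
  then show ?thesis by (auto simp: mem_V)
qed

lemmas uf_dom_mem = dom_mem_fsrc[OF uf_filter]
lemmas uf_fmul' = uf_fmul[OF uf_filter]

abbreviation UG where "UG \<equiv> uf_groupoid S"
abbreviation UT where "UT \<equiv> topology_generated_by (uf_containing S ` carrier S)"

lemma uf_groupoid: "groupoid UG"
  unfolding groupoid_def uf_groupoid_simps ultrafilters_iff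
proof (intro conjI ballI impI)
  fix A assume "A \<in> ultrafilters S"
  then have A: "uf A" and f: "sg_filter S A" by (auto intro: uf_filter)
  show "uf (fsrc A)" "uf (frng A)" using uf_fsrc[OF A] uf_frng[OF A] .
  show "fsrc (fsrc A) = fsrc A" "frng (fsrc A) = fsrc A" "fsrc (frng A) = frng A" "frng (frng A) = frng A"
    "fmul A (fsrc A) = A" "fmul (frng A) A = A"
    using fsrc_fsrc[OF f] frng_fsrc[OF f] fsrc_frng[OF f] frng_frng[OF f] fmul_fsrc[OF f] fmul_frng[OF f] .
  show "\<exists>h\<in>ultrafilters S. fsrc h = frng A \<and> frng h = fsrc A \<and> fmul h A = fsrc A \<and> fmul A h = frng A"
    by (rule bexI[of _ "finv A"]) (use f uf_finv[OF A] in \<open>simp_all add: finv_finv[OF filter_subset]\<close>)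
next
  fix A B assume "A \<in> ultrafilters S" "B \<in> ultrafilters S" and AB: "fsrc A = frng B"
  then have A: "sg_filter S A" and B: "uf B" "sg_filter S B" by (auto intro: uf_filter)
  show "uf (fmul A B)" "fsrc (fmul A B) = fsrc B" "frng (fmul A B) = frng A"
    using uf_fmul[OF A B(1) AB] fsrc_fmul[OF A B(2) AB] frng_fmul[OF A B(2) AB] .
next
  fix A B C assume "A \<in> ultrafilters S" "B \<in> ultrafilters S" "C \<in> ultrafilters S"
  then show "fmul (fmul A B) C = fmul A (fmul B C)"
    by (intro fmul_assoc) (auto dest!: uf_filter intro: filter_closed)
qed

sublocale UG: grpd UG
  by unfold_locales (rule uf_groupoid)

lemma uf_ginv:
  assumes "uf A" shows "ginv UG A = finv A"
proof (rule UG.inv_eqI)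
  have f: "A \<subseteq> carrier S" using assms uf_filter filter_subset by blast
  show "gsrc UG (finv A) = gtgt UG A" "gtgt UG (finv A) = gsrc UG A" "gcomp UG (finv A) A = gsrc UG A"
    "gcomp UG A (finv A) = gtgt UG A" using f by (simp_all add: finv_finv)
qed (use assms uf_finv in simp_all)

lemma uf_gids_iff: "A \<in> gids UG \<longleftrightarrow> uf A \<and> (\<exists>e\<in>A. e \<in> E)"
proof
  assume "A \<in> gids UG"
  then have A: "uf A" "fsrc A = A" by (auto simp: gids_def)
  then have f: "sg_filter S A" by (simp add: uf_filter)
  obtain a where "a \<in> A" using filter_nonempty[OF f] by blast
  then have "a\<star> \<cdot> a \<in> A" "a\<star> \<cdot> a \<in> E" using dom_mem_fsrc[OF f] A f by auto
  then show "uf A \<and> (\<exists>e\<in>A. e \<in> E)" using A by blast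
next
  assume "uf A \<and> (\<exists>e\<in>A. e \<in> E)"
  then show "A \<in> gids UG" by (auto simp: gids_def filter_idem_fsrc uf_filter)
qed

section \<open>The topology on ultrafilters\<close>

lemma topspace_UT [simp]: "topspace UT = ultrafilters S"
  by (simp add: topology_generated_by_topspace)

lemma openin_V: "s \<in> carrier S \<Longrightarrow> openin UT (V s)"
  by (rule topology_generated_by_Basis) auto

text \<open>By \<open>V_meet\<close> the generating sets are closed under binary intersection, so
  this subbasis is already a basis.\<close>

lemma openin_UT_iff: "openin UT U \<longleftrightarrow> (\<forall>F\<in>U. \<exists>s\<in>carrier S. F \<in> V s \<and> V s \<subseteq> U)"
proof
  assume "openin UT U"
  then have "generate_topology_on (V ` carrier S) U" by (simp add: openin_topology_generated_by_iff)
  then show "\<forall>F\<in>U. \<exists>s\<in>carrier S. F \<in> V s \<and> V s \<subseteq> U"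
  proof induction
    case (Int a b)
    show ?case
    proof
      fix F assume "F \<in> a \<inter> b"
      then obtain s t where st: "s \<in> carrier S" "t \<in> carrier S" "F \<in> V s" "F \<in> V t" "V s \<subseteq> a" "V t \<subseteq> b"
        using Int.IH by blast
      then have "F \<in> V (s \<sqinter>\<^sub>n t)" "V (s \<sqinter>\<^sub>n t) \<subseteq> a \<inter> b" by (auto simp: V_meet)
      then show "\<exists>s\<in>carrier S. F \<in> V s \<and> V s \<subseteq> a \<inter> b" using st by blast
    qed
  next
    case (UN K)
    then show ?case by (meson Sup_upper UnionE subset_trans)
  qed auto
next
  assume U: "\<forall>F\<in>U. \<exists>s\<in>carrier S. F \<in> V s \<and> V s \<subseteq> U"
  show "openin UT U"
    by (subst openin_subopen) (use U openin_V in blast)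
qed

text \<open>An ultrafilter containing the idempotent \<open>s\<star> \<cdot> s\<close> is its own
  source, and \<open>uf_src_ex\<close> lifts it to an ultrafilter through \<open>s\<close>.\<close>

lemma V_dom: assumes s: "s \<in> carrier S" shows "fsrc ` V s = V (s\<star> \<cdot> s)"
proof
  show "fsrc ` V s \<subseteq> V (s\<star> \<cdot> s)"
    by (auto simp: mem_V uf_fsrc uf_dom_mem)
  show "V (s\<star> \<cdot> s) \<subseteq> fsrc ` V s"
  proof
    fix F assume "F \<in> V (s\<star> \<cdot> s)"
    then have F: "uf F" "s\<star> \<cdot> s \<in> F" by (auto simp: mem_V)
    then have "fsrc F = F" using s by (intro filter_idem_fsrc[OF uf_filter]) auto
    then obtain A where "uf A" "s \<in> A" "fsrc A = F" using uf_src_ex F s by blast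
    then show "F \<in> fsrc ` V s" by (auto simp: mem_V)
  qed
qed

lemma inj_on_fsrc_V: "inj_on fsrc (V s)"
  by (rule inj_onI) (rule filter_eqI[of _ _ s], auto simp: mem_V uf_filter)

lemma V_inv: assumes s: "s \<in> carrier S" shows "finv ` V s = V (s\<star>)"
proof
  show "finv ` V s \<subseteq> V (s\<star>)" by (auto simp: mem_V uf_finv)
  show "V (s\<star>) \<subseteq> finv ` V s"
  proof
    fix F assume F: "F \<in> V (s\<star>)"
    then have f: "F \<subseteq> carrier S" by (auto simp: mem_V dest: uf_filter intro: filter_closed)
    have "finv F \<in> V s" using F f s by (auto simp: mem_V uf_finv mem_finv)
    then show "F \<in> finv ` V s" using finv_finv[OF f] by (metis imageI)
  qed
qed

lemma inj_on_frng_V: assumes s: "s \<in> carrier S" shows "inj_on frng (V s)"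
proof (rule inj_onI)
  fix A B assume AB: "A \<in> V s" "B \<in> V s" "frng A = frng B"
  then have f: "A \<subseteq> carrier S" "B \<subseteq> carrier S" by (auto simp: mem_V dest: uf_filter intro: filter_closed)
  have "finv A \<in> V (s\<star>)" "finv B \<in> V (s\<star>)" using AB V_inv[OF s] by auto
  moreover have "fsrc (finv A) = fsrc (finv B)" using AB(3) f by (simp add: finv_finv)
  ultimately have "finv A = finv B" using inj_on_fsrc_V[of "s\<star>"] by (meson inj_onD)
  then show "A = B" using finv_finv[OF f(1)] finv_finv[OF f(2)] by metis
qed

lemma V_local_bisection: assumes s: "s \<in> carrier S" shows "local_bisection UG (V s)"
proof -
  have "gsrc UG = fsrc" "gtgt UG = frng" by auto
  then show ?thesis unfolding UG.local_bisection_iff using inj_on_fsrc_V inj_on_frng_V[OF s] by (auto simp: mem_V)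
qed

text \<open>The content is the factorisation of an ultrafilter \<open>C\<close> through
  \<open>s \<cdot> t\<close>. Lift the source of \<open>C\<close> along \<open>t\<close> to get the
  right factor; the left factor is then forced.\<close>

lemma V_mult:
  assumes s: "s \<in> carrier S" and t: "t \<in> carrier S"
  shows "gset_mult UG (V s) (V t) = V (s \<cdot> t)"
proof
  show "gset_mult UG (V s) (V t) \<subseteq> V (s \<cdot> t)"
    using s t by (auto simp: gset_mult_def mem_V uf_fmul' mult_mem_fmul)
  show "V (s \<cdot> t) \<subseteq> gset_mult UG (V s) (V t)"
  proof
    fix C assume "C \<in> V (s \<cdot> t)"
    then have C: "uf C" "s \<cdot> t \<in> C" by (auto simp: mem_V)
    have c: "sg_filter S C" using C by (simp add: uf_filter)
    define F where "F = fsrc C"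
    have F: "uf F" "fsrc F = F" using C c by (auto simp: F_def uf_fsrc fsrc_fsrc)
    have "(s \<cdot> t)\<star> \<cdot> (s \<cdot> t) = t\<star> \<cdot> ((s\<star> \<cdot> s) \<cdot> t)" using s t by (simp add: assoc)
    also have "\<dots> \<preceq> t\<star> \<cdot> t" using s t by (intro le_mult_left leI_left) auto
    finally have "t\<star> \<cdot> t \<in> F"
      using filter_up[OF uf_filter[OF F(1)]] dom_mem_fsrc[OF c C(2)] t unfolding F_def by blast
    then obtain B where B: "uf B" "t \<in> B" "fsrc B = F" using uf_src_ex F t by blast
    have b: "sg_filter S B" "uf (finv B)" "sg_filter S (finv B)"
      using B by (auto intro: uf_filter uf_finv)
    have BB: "finv (finv B) = B" using b by (simp add: finv_finv filter_subset)
    \<comment> \<open>In a groupoid, a factorisation of \<open>C\<close> with right factor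
      \<open>B\<close> must have \<open>C\<close> times the inverse of \<open>B\<close> on the
      left.\<close>
    define A where "A = fmul C (finv B)"
    have comp: "fsrc C = frng (finv B)" using B(3) BB by (simp add: F_def)
    have A: "uf A" using uf_fmul[OF c b(2) comp] by (simp add: A_def)
    have srcA: "fsrc A = frng B" using fsrc_fmul[OF c b(3) comp] BB by (simp add: A_def)
    have "s \<cdot> t \<cdot> t\<star> \<in> A" unfolding A_def using C B s t by (intro mult_mem_fmul) auto
    moreover have "s \<cdot> t \<cdot> t\<star> \<preceq> s" using s t by (simp add: assoc leI_right)
    ultimately have sA: "s \<in> A" using filter_up[OF uf_filter[OF A]] s by blast
    have "fmul A B = fmul C (fsrc B)" unfolding A_def using c b by (intro fmul_assoc) (auto simp: filter_subset)
    also have "\<dots> = C" using fmul_fsrc[OF c] B(3) by (simp add: F_def)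
    finally have "C = gcomp UG A B" by simp
    then show "C \<in> gset_mult UG (V s) (V t)"
      unfolding gset_mult_def using A B sA srcA by (auto simp: mem_V)
  qed
qed

text \<open>If all ultrafilters through \<open>s\<close> are identities, the source map fixes
  \<open>V s\<close> pointwise. Then \<open>V s = V (s\<star> \<cdot> s)\<close>, and injectivity of
  \<open>V\<close> gives \<open>s = s\<star> \<cdot> s\<close>.\<close>

lemma V_gids_iff: assumes s: "s \<in> carrier S" shows "V s \<subseteq> gids UG \<longleftrightarrow> s \<in> E"
proof
  assume "V s \<subseteq> gids UG"
  then have "fsrc F = F" if "F \<in> V s" for F using that by (auto simp: gids_def)
  then have "V s = fsrc ` V s" by simp
  then have "s = s\<star> \<cdot> s" using V_dom[OF s] V_inj s by simp
  then show "s \<in> E" using s by (metis dom_idem)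
qed (auto simp: mem_V uf_gids_iff)

text \<open>Some \<open>t\<close> in \<open>A\<close> is missing from \<open>B\<close>, and
  \<open>B\<close> has a member \<open>x\<close> disjoint from \<open>t\<close>. The meet of
  \<open>t\<close> and \<open>x\<close> is zero, so \<open>V t\<close> and \<open>V x\<close> are
  disjoint neighbourhoods.\<close>

lemma Hausdorff_UT: "Hausdorff_space UT"
  unfolding Hausdorff_space_def
proof (intro allI impI)
  fix A B assume AB: "A \<in> topspace UT \<and> B \<in> topspace UT \<and> A \<noteq> B"
  then have A: "uf A" and B: "uf B" by auto
  then obtain t where t: "t \<in> A" "t \<notin> B" using AB uf_eqI by blast
  have tS: "t \<in> carrier S" using t A uf_closed by blast
  obtain b where "b \<in> B" using filter_nonempty[OF uf_filter[OF B]] by blast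
  then obtain x where x: "x \<in> B" "disj x t" using uf_sep[OF B tS t(2)] by blast
  have xS: "x \<in> carrier S" using x B uf_closed by blast
  have "t \<sqinter>\<^sub>n x = zero S" using x(2) meet_le1[OF tS xS] meet_le2[OF tS xS] by blast
  then have "disjnt (V t) (V x)" using V_meet[OF tS xS] by (simp add: disjnt_def)
  moreover have "A \<in> V t" "B \<in> V x" using A B t x by (auto simp: mem_V)
  ultimately show "\<exists>U W. openin UT U \<and> openin UT W \<and> A \<in> U \<and> B \<in> W \<and> disjnt U W"
    using openin_V[OF tS] openin_V[OF xS] by blast
qed

text \<open>If no finite part of a cover of \<open>V s\<close> suffices, the elements \<open>x\<close> such that \<open>V x\<close> contains
  \<open>V s\<close> up to finitely many covering sets form a filter, and an ultrafilter extending it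
  avoids the whole cover.\<close>

lemma compactin_V:
  assumes s: "s \<in> carrier S" shows "compactin UT (V s)"
  unfolding compactin_def
proof (intro conjI allI impI)
  show "V s \<subseteq> topspace UT" by (auto simp: mem_V)
  fix \<U> assume \<U>: "Ball \<U> (openin UT) \<and> V s \<subseteq> \<Union>\<U>"
  show "\<exists>\<F>. finite \<F> \<and> \<F> \<subseteq> \<U> \<and> V s \<subseteq> \<Union>\<F>"
  proof (rule ccontr)
    assume neg: "\<not> ?thesis"
    define C where "C = {t \<in> carrier S. \<exists>U\<in>\<U>. V t \<subseteq> U}"
    have nocover: "\<not> V s \<subseteq> \<Union>(V ` T)" if T: "finite T" "T \<subseteq> C" for T
    proof
      assume cover: "V s \<subseteq> \<Union>(V ` T)"
      have "\<forall>t\<in>T. \<exists>U\<in>\<U>. V t \<subseteq> U" using T by (auto simp: C_def)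
      then obtain u where u: "\<And>t. t \<in> T \<Longrightarrow> u t \<in> \<U> \<and> V t \<subseteq> u t" by metis
      have "V s \<subseteq> \<Union>(u ` T)" using cover u by blast
      then show False using neg T u by (metis finite_imageI image_subsetI)
    qed
    define F where "F = {x \<in> carrier S. \<exists>T. finite T \<and> T \<subseteq> C \<and> V s - \<Union>(V ` T) \<subseteq> V x}"
    have "sg_filter S F" unfolding sg_filter_def
    proof (intro conjI ballI impI)
      show "F \<subseteq> carrier S" by (auto simp: F_def)
      have "s \<in> F" unfolding F_def using s by (auto intro!: exI[of _ "{}"])
      then show "F \<noteq> {}" by blast
      show "zero S \<notin> F" using nocover by (auto simp: F_def)
      fix x y
      show "y \<in> F" if "x \<in> F" "y \<in> carrier S" "x \<preceq> y" using that V_mono[of x y] unfolding F_def by blast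
      assume "x \<in> F" "y \<in> F"
      then obtain T T' where T: "finite T" "T \<subseteq> C" "V s - \<Union>(V ` T) \<subseteq> V x" "x \<in> carrier S"
        "finite T'" "T' \<subseteq> C" "V s - \<Union>(V ` T') \<subseteq> V y" "y \<in> carrier S" unfolding F_def by blast
      have "V (x \<sqinter>\<^sub>n y) = V x \<inter> V y" using T(4,8) by (rule V_meet)
      then have "V s - \<Union>(V ` (T \<union> T')) \<subseteq> V (x \<sqinter>\<^sub>n y)" using T(3,7) by auto
      then have "x \<sqinter>\<^sub>n y \<in> F" unfolding F_def using T
        by (auto intro!: exI[of _ "T \<union> T'"])
      then show "\<exists>z\<in>F. z \<preceq> x \<and> z \<preceq> y" using T meet_le1 meet_le2 by blast
    qed
    then obtain H where H: "uf H" "F \<subseteq> H" using uf_extends by blast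
    have h: "sg_filter S H" using H uf_filter by blast
    have "s \<in> F" unfolding F_def using s by (auto intro!: exI[of _ "{}"])
    then have "H \<in> V s" using H by (auto simp: mem_V)
    then obtain U where U: "U \<in> \<U>" "H \<in> U" "openin UT U" using \<U> by blast
    then obtain t where t: "t \<in> carrier S" "H \<in> V t" "V t \<subseteq> U" unfolding openin_UT_iff by blast
    then have tC: "t \<in> C" using U by (auto simp: C_def)
    \<comment> \<open>Here \<open>x\<close> contains the complement of \<open>t\<close> in
      \<open>s\<close>, so it belongs to \<open>F\<close> with \<open>{t}\<close> as the finite
      exception; but the ultrafilter \<open>H\<close> also contains \<open>t\<close>.\<close>
    obtain x where x: "x \<in> carrier S" "disj x t" "\<And>z. z \<preceq> s \<Longrightarrow> disj z t \<Longrightarrow> z \<preceq> x"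
      using relative_complement[OF s t(1)] by blast
    have "V s - V t \<subseteq> V x"
    proof
      fix K assume K: "K \<in> V s - V t"
      then have k: "uf K" "s \<in> K" "t \<notin> K" by (auto simp: mem_V)
      then obtain z where "z \<in> K" "z \<preceq> s" "disj z t" using uf_sep t by blast
      then have "x \<in> K" using x filter_up[OF uf_filter[OF k(1)]] by blast
      then show "K \<in> V x" using k by (simp add: mem_V)
    qed
    then have "x \<in> F" unfolding F_def using x tC by (auto intro!: exI[of _ "{t}"])
    then have "x \<in> H" "t \<in> H" using H t by (auto simp: mem_V)
    then show False using filter_dir[OF h] x(2) filter_zero[OF h] by metis
  qed
qed

text \<open>The preimage of \<open>V s\<close> under multiplication is a union of boxes cut with the
  composable pairs. Membership of \<open>s\<close> in the carrier is part of the index set, which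
  makes both sides empty for any other \<open>s\<close>.\<close>

lemma mult_preimage:
  fixes s defines "W \<equiv> (\<Union>(a, b)\<in>{(a, b). a \<in> carrier S \<and> b \<in> carrier S \<and> a \<cdot> b \<preceq> s \<and> s \<in> carrier S}. V a \<times> V b)"
  shows "openin (prod_topology UT UT) W"
    "{(A, B). A \<in> ultrafilters S \<and> B \<in> ultrafilters S \<and> gsrc UG A = gtgt UG B \<and> s \<in> fmul A B} =
    W \<inter>
    {(A, B). gsrc UG A = gtgt UG B}" (is "?L = ?R")
proof -
  show "openin (prod_topology UT UT) W"
    unfolding W_def by (intro openin_Union) (auto simp: openin_prod_Times_iff openin_V)
  have "?L \<subseteq> ?R"
  proof
    fix x assume "x \<in> ?L"
    then obtain A B where AB: "x = (A, B)" "uf A" "uf B" "gsrc UG A = gtgt UG B" "s \<in> fmul A B"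
      by auto
    then obtain a b where ab: "a \<in> A" "b \<in> B" "a \<cdot> b \<preceq> s" "s \<in> carrier S" unfolding mem_fmul by blast
    then have "a \<in> carrier S" "b \<in> carrier S" using AB uf_filter filter_closed by blast+
    moreover have "A \<in> V a" "B \<in> V b" using AB ab by (auto simp: mem_V)
    ultimately show "x \<in> ?R" using AB(1,4) ab(3,4) unfolding W_def by blast
  qed
  moreover have "?R \<subseteq> ?L"
  proof
    fix x assume "x \<in> ?R"
    then obtain a b A B where "x = (A, B)" "A \<in> V a" "B \<in> V b" "a \<cdot> b \<preceq> s" "s \<in> carrier S" "gsrc UG A = gtgt UG B"
      unfolding W_def by blast
    then show "x \<in> ?L" unfolding mem_V by (auto simp: mem_fmul)
  qed
  ultimately show "?L = ?R" ..
qed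

lemma topological_uf_groupoid: "topological_groupoid UG"
  unfolding topological_groupoid_def
proof (intro conjI)
  show "groupoid UG" by (rule uf_groupoid)
  show "topspace (gtop UG) = carrier UG" by simp
  let ?D = "{(A, B). gsrc UG A = gtgt UG B}"
  let ?X = "subtopology (prod_topology UT UT) ?D"
  have "continuous_map ?X UT (\<lambda>(A, B). fmul A B)"
    unfolding continuous_on_generated_topo_iff
  proof (intro conjI allI impI)
    fix U assume "U \<in> V ` carrier S"
    then obtain s where s: "s \<in> carrier S" "U = V s" by blast
    have "(\<lambda>(A, B). fmul A B) -` U \<inter> topspace ?X =
      {(A, B). A \<in> ultrafilters S \<and> B \<in> ultrafilters S \<and> gsrc UG A = gtgt UG B \<and> s \<in> fmul A B}"
      using s by (auto simp: mem_V uf_fmul')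
    also have "openin ?X \<dots>"
      unfolding mult_preimage(2) by (intro openin_subtopology_Int mult_preimage(1))
    finally show "openin ?X ((\<lambda>(A, B). fmul A B) -` U \<inter> topspace ?X)" .
  next
    have "(\<lambda>(A, B). fmul A B) ` topspace ?X \<subseteq> topspace UT"
      by (auto intro: uf_fmul')
    then show "(\<lambda>(A, B). fmul A B) ` topspace ?X \<subseteq> \<Union>(V ` carrier S)"
      unfolding Union_V topspace_UT .
  qed
  then show "continuous_map (subtopology (prod_topology (gtop UG) (gtop UG)) ?D) (gtop UG) (\<lambda>(A, B). gcomp UG A B)"
    by simp
  have "continuous_map UT UT finv"
    unfolding continuous_on_generated_topo_iff
  proof (intro conjI allI impI)
    fix U assume "U \<in> V ` carrier S"
    then obtain s where s: "s \<in> carrier S" "U = V s" by blast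
    have "finv -` U \<inter> topspace UT = V (s\<star>)"
    proof (rule Set.set_eqI)
      fix F show "F \<in> finv -` U \<inter> topspace UT \<longleftrightarrow> F \<in> V (s\<star>)"
        using s mem_finv[OF uf_subset, of F s] uf_finv[of F] by (auto simp: mem_V)
    qed
    then show "openin UT (finv -` U \<inter> topspace UT)" using s by (simp add: openin_V)
  next
    have "finv ` topspace UT \<subseteq> topspace UT" by (auto intro: uf_finv)
    then show "finv ` topspace UT \<subseteq> \<Union>(V ` carrier S)"
      unfolding Union_V topspace_UT .
  qed
  then have "continuous_map UT UT (ginv UG)"
    by (rule continuous_map_eq) (simp add: uf_ginv)
  then show "continuous_map (gtop UG) (gtop UG) (ginv UG)" by simp
qed

lemma continuous_fsrc: "continuous_map UT UT fsrc"
  unfolding continuous_on_generated_topo_iff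
proof (intro conjI allI impI)
  fix U assume "U \<in> V ` carrier S"
  then obtain s where s: "s \<in> carrier S" "U = V s" by blast
  have eq: "fsrc -` U \<inter> topspace UT = (\<Union>a\<in>{a \<in> carrier S. a\<star> \<cdot> a \<preceq> s}. V a)" (is "?L = ?R")
  proof (rule Set.set_eqI)
    fix F
    have "s \<in> fsrc F \<longleftrightarrow> (\<exists>a\<in>F. a\<star> \<cdot> a \<preceq> s)" "F \<subseteq> carrier S" if "uf F"
      using uf_filter[OF that] s by (auto simp: mem_fsrc)
    then show "F \<in> ?L \<longleftrightarrow> F \<in> ?R" using s uf_fsrc unfolding s(2) vimage_def by (auto simp: mem_V)
  qed
  show "openin UT (fsrc -` U \<inter> topspace UT)" unfolding eq by (intro openin_Union) (auto simp: openin_V)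
next
  have "fsrc ` topspace UT \<subseteq> topspace UT" by (auto intro: uf_fsrc)
  then show "fsrc ` topspace UT \<subseteq> \<Union>(V ` carrier S)"
    unfolding Union_V topspace_UT .
qed

text \<open>Each \<open>V s\<close> is an open set on which the source map is injective, and by
  \<open>V_dom\<close> its image is the basic open set \<open>V (s\<star> \<cdot> s)\<close>; the
  same identity makes the source map open.\<close>

lemma etale_uf_groupoid: "etale_groupoid UG"
  unfolding etale_groupoid_def local_homeomorphism_def
proof (intro conjI ballI)
  show "topological_groupoid UG" by (rule topological_uf_groupoid)
  let ?Y = "subtopology UT (gids UG)"
  have op: "openin UT (fsrc ` U)" if U: "openin UT U" for U
    unfolding openin_UT_iff
  proof
    fix F assume "F \<in> fsrc ` U"
    then obtain A where A: "A \<in> U" "F = fsrc A" by blast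
    then obtain s where s: "s \<in> carrier S" "A \<in> V s" "V s \<subseteq> U" using U unfolding openin_UT_iff by blast
    then have "F \<in> V (s\<star> \<cdot> s)" "V (s\<star> \<cdot> s) \<subseteq> fsrc ` U" using A V_dom by (auto simp flip: V_dom)
    then show "\<exists>s\<in>carrier S. F \<in> V s \<and> V s \<subseteq> fsrc ` U" using s by blast
  qed
  fix A assume "A \<in> topspace (gtop UG)"
  then have A: "uf A" by simp
  then obtain s where s: "s \<in> A" using filter_nonempty[OF uf_filter[OF A]] by blast
  have sS: "s \<in> carrier S" using s A uf_closed by blast
  have ids: "V (s\<star> \<cdot> s) \<subseteq> gids UG" using sS by (simp add: V_gids_iff)
  have "homeomorphic_map (subtopology UT (V s)) (subtopology ?Y (fsrc ` V s)) fsrc"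
  proof (rule bijective_open_imp_homeomorphic_map)
    have t1: "topspace (subtopology UT (V s)) = V s" by (auto simp: mem_V)
    have t2: "topspace (subtopology ?Y (fsrc ` V s)) = fsrc ` V s"
      unfolding V_dom[OF sS] using ids by (auto simp: mem_V)
    show "fsrc ` topspace (subtopology UT (V s)) = topspace (subtopology ?Y (fsrc ` V s))"
      unfolding t1 t2 ..
    show "inj_on fsrc (topspace (subtopology UT (V s)))" unfolding t1 by (rule inj_on_fsrc_V)
    show "continuous_map (subtopology UT (V s)) (subtopology ?Y (fsrc ` V s)) fsrc"
      using continuous_fsrc V_dom[OF sS] ids
      by (auto simp: continuous_map_in_subtopology t1 intro: continuous_map_from_subtopology)
    show "open_map (subtopology UT (V s)) (subtopology ?Y (fsrc ` V s)) fsrc"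
      unfolding open_map_def
    proof (intro allI impI)
      fix U assume "openin (subtopology UT (V s)) U"
      then have U: "openin UT U" "U \<subseteq> V s" using openin_V[OF sS] by (auto simp: openin_open_subtopology)
      have "fsrc ` U \<inter> gids UG \<inter> fsrc ` V s = fsrc ` U"
        using U(2) ids V_dom[OF sS] by blast
      moreover have "openin (subtopology ?Y (fsrc ` V s)) (fsrc ` U \<inter> gids UG \<inter> fsrc ` V s)"
        using op[OF U(1)] by (intro openin_subtopology_Int)
      ultimately show "openin (subtopology ?Y (fsrc ` V s)) (fsrc ` U)" by simp
    qed
  qed
  moreover have "openin ?Y (fsrc ` V s)"
    using op[OF openin_V[OF sS]] ids V_dom[OF sS] by (metis inf.absorb1 openin_subtopology_Int)
  moreover have "A \<in> V s" using A s by (simp add: mem_V)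
  moreover have "gsrc UG = fsrc" by auto
  ultimately show "\<exists>U. A \<in> U \<and> openin (gtop UG) U \<and> openin (subtopology (gtop UG) (gids UG)) (gsrc UG ` U) \<and>
    homeomorphic_map (subtopology (gtop UG) U) (subtopology (subtopology (gtop UG) (gids UG)) (gsrc UG ` U)) (gsrc UG)"
    using openin_V[OF sS] by auto
qed

lemma hausdorff_boolean_uf_groupoid: "hausdorff_boolean_groupoid UG"
  unfolding hausdorff_boolean_groupoid_def boolean_groupoid_def
proof (intro conjI)
  show "etale_groupoid UG" by (rule etale_uf_groupoid)
  show "Hausdorff_space (gtop UG)" using Hausdorff_UT by simp
  show "has_basis_of (gtop UG) (\<lambda>V. compactin (gtop UG) V \<and> local_bisection UG V)"
    unfolding has_basis_of_def
  proof (intro allI impI)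
    fix U x assume "openin (gtop UG) U \<and> x \<in> U"
    then obtain s where "s \<in> carrier S" "x \<in> V s \<and> V s \<subseteq> U" unfolding uf_groupoid_simps openin_UT_iff by blast
    then show "\<exists>W. openin (gtop UG) W \<and> (compactin (gtop UG) W \<and> local_bisection UG W) \<and> x \<in> W \<and> W \<subseteq> U"
      using openin_V compactin_V V_local_bisection by (intro exI[of _ "V s"]) simp
  qed
  have "has_basis_of (subtopology UT (gids UG)) (compactin (subtopology UT (gids UG)))"
    unfolding has_basis_of_def
  proof (intro allI impI)
    fix U x assume U: "openin (subtopology UT (gids UG)) U \<and> x \<in> U"
    then obtain U' where U': "openin UT U'" "U = U' \<inter> gids UG" by (auto simp: openin_subtopology)
    then obtain s where s: "s \<in> carrier S" "x \<in> V s" "V s \<subseteq> U'" using U unfolding openin_UT_iff by blast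
    \<comment> \<open>An identity contains an idempotent. Meeting \<open>s\<close> with it gives an
      idempotent, whose basic set lies entirely among the identities.\<close>
    obtain e where e: "e \<in> x" "e \<in> E" using U U' uf_gids_iff by blast
    have m: "s \<sqinter>\<^sub>n e \<in> E" using s e le_idem[OF meet_le2] by simp
    have V: "V (s \<sqinter>\<^sub>n e) = V s \<inter> V e" using s e by (simp add: V_meet)
    have "V (s \<sqinter>\<^sub>n e) \<subseteq> gids UG" using m by (simp add: V_gids_iff)
    moreover have "x \<in> V (s \<sqinter>\<^sub>n e)" unfolding V using s e by (auto simp: mem_V)
    moreover have "V (s \<sqinter>\<^sub>n e) \<subseteq> U" using V calculation s U' by blast
    moreover have "openin UT (V (s \<sqinter>\<^sub>n e))" "compactin UT (V (s \<sqinter>\<^sub>n e))"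
      using s e by (auto simp: openin_V compactin_V)
    ultimately show "\<exists>W. openin (subtopology UT (gids UG)) W \<and> compactin (subtopology UT (gids UG)) W \<and> x \<in> W \<and> W \<subseteq> U"
      by (metis compactin_subtopology inf.absorb1 openin_subtopology_Int)
  qed
  then show "boolean_space (subtopology (gtop UG) (gids UG))"
    using Hausdorff_UT by (simp add: boolean_space_def Hausdorff_space_subtopology)
qed

end

subsection \<open>Functoriality\<close>

locale bim_morphism = S: bim S + T: bim T
  for S :: "'a zero_semigroup" and T :: "'b zero_semigroup" +
  fixes \<theta> :: "'a \<Rightarrow> 'b"
  assumes hom: "\<theta> \<in> bim_hom S T"
begin

lemma hom_closed [simp]: "s \<in> carrier S \<Longrightarrow> \<theta> s \<in> carrier T"
  and hom_mult: "s \<in> carrier S \<Longrightarrow> t \<in> carrier S \<Longrightarrow> \<theta> (s \<cdot>\<^bsub>S\<^esub> t) = \<theta> s \<cdot>\<^bsub>T\<^esub> \<theta> t"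
  and hom_meet: "s \<in> carrier S \<Longrightarrow> t \<in> carrier S \<Longrightarrow>
    \<theta> (s \<sqinter>\<^bsub>nat_order S\<^esub> t) = \<theta> s \<sqinter>\<^bsub>nat_order T\<^esub> \<theta> t"
  and hom_idem_meet: "e \<in> idems S \<Longrightarrow> d \<in> idems S \<Longrightarrow>
    \<theta> (e \<sqinter>\<^bsub>idem_order S\<^esub> d) = \<theta> e \<sqinter>\<^bsub>idem_order T\<^esub> \<theta> d"
  and hom_idem_join: "e \<in> idems S \<Longrightarrow> d \<in> idems S \<Longrightarrow>
    \<theta> (e \<squnion>\<^bsub>idem_order S\<^esub> d) = \<theta> e \<squnion>\<^bsub>idem_order T\<^esub> \<theta> d"
  and hom_zero: "\<theta> (zero S) = zero T"
  and preimage_ultrafilter: "T.uf F \<Longrightarrow> S.uf {s \<in> carrier S. \<theta> s \<in> F}"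
  using hom by (auto simp: bim_hom_def)

lemma hom_inv: "s \<in> carrier S \<Longrightarrow> \<theta> (sg_inv S s) = sg_inv T (\<theta> s)"
  by (rule sym, rule T.inv_unique) (auto simp flip: hom_mult simp: S.inv_left S.inv_right)

lemma hom_le: "nat_le S s t \<Longrightarrow> t \<in> carrier S \<Longrightarrow> nat_le T (\<theta> s) (\<theta> t)"
  unfolding nat_le_def using hom_mult by (metis S.idem_closed S.idem_idem T.idemI hom_closed)

abbreviation pre where "pre F \<equiv> {s \<in> carrier S. \<theta> s \<in> F}"

text \<open>A homomorphism transports inequalities forward only, which gives one inclusion. Both
  sides are ultrafilters, so that inclusion is an equality. The same device proves
  \<open>pre_fmul\<close>.\<close>

lemma pre_fsrc:
  assumes F: "T.uf F" shows "S.fsrc (pre F) = pre (T.fsrc F)"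
proof (rule S.uf_eqI)
  have P: "S.uf (pre F)" using F by (rule preimage_ultrafilter)
  show "S.uf (S.fsrc (pre F))" "S.uf (pre (T.fsrc F))"
    using S.uf_fsrc[OF P] preimage_ultrafilter[OF T.uf_fsrc[OF F]] .
  show "S.fsrc (pre F) \<subseteq> pre (T.fsrc F)"
  proof
    fix x assume "x \<in> S.fsrc (pre F)"
    then obtain a where a: "x \<in> carrier S" "a \<in> carrier S" "\<theta> a \<in> F" "nat_le S (sg_inv S a \<cdot>\<^bsub>S\<^esub> a) x"
      using S.mem_fsrc[OF S.uf_filter[OF P]] by blast
    then have "nat_le T (sg_inv T (\<theta> a) \<cdot>\<^bsub>T\<^esub> \<theta> a) (\<theta> x)"
      using hom_le[OF a(4,1)] by (simp add: hom_mult hom_inv)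
    then have "\<theta> x \<in> T.fsrc F" using T.mem_fsrc[OF T.uf_filter[OF F]] a by auto
    then show "x \<in> pre (T.fsrc F)" using a by simp
  qed
qed

lemma pre_finv:
  assumes F: "T.uf F" shows "S.finv (pre F) = pre (T.finv F)"
proof -
  have f: "F \<subseteq> carrier T" using F T.uf_filter T.filter_subset by blast
  have sub: "pre F \<subseteq> carrier S" by auto
  show ?thesis by (rule Set.set_eqI) (auto simp: S.mem_finv[OF sub] T.mem_finv[OF f] hom_inv)
qed

lemma pre_frng:
  assumes F: "T.uf F" shows "S.frng (pre F) = pre (T.frng F)"
proof -
  have "F \<subseteq> carrier T" using F T.uf_filter T.filter_subset by blast
  then show ?thesis
    using pre_fsrc[OF T.uf_finv[OF F]] pre_finv[OF F] S.finv_finv[of "pre F"]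
    by (simp add: T.finv_finv subset_iff flip: pre_finv)
qed

lemma pre_fmul:
  assumes A: "T.uf A" and B: "T.uf B" and AB: "T.fsrc A = T.frng B"
  shows "S.fmul (pre A) (pre B) = pre (T.fmul A B)"
proof (rule S.uf_eqI)
  have P: "S.uf (pre A)" "S.uf (pre B)" using A B by (auto intro: preimage_ultrafilter)
  have "S.fsrc (pre A) = S.frng (pre B)" using AB by (simp only: pre_fsrc[OF A] pre_frng[OF B])
  then show "S.uf (S.fmul (pre A) (pre B))"
    using P S.uf_filter by (intro S.uf_fmul) auto
  show "S.uf (pre (T.fmul A B))"
    using A B AB T.uf_filter by (intro preimage_ultrafilter T.uf_fmul) auto
  show "S.fmul (pre A) (pre B) \<subseteq> pre (T.fmul A B)"
  proof
    fix x assume "x \<in> S.fmul (pre A) (pre B)"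
    then obtain a b where a: "x \<in> carrier S" "a \<in> carrier S" "\<theta> a \<in> A" "b \<in> carrier S" "\<theta> b \<in> B"
      "nat_le S (a \<cdot>\<^bsub>S\<^esub> b) x" unfolding S.mem_fmul by blast
    then have "nat_le T (\<theta> a \<cdot>\<^bsub>T\<^esub> \<theta> b) (\<theta> x)" using hom_le[OF a(6,1)] by (simp add: hom_mult)
    then show "x \<in> pre (T.fmul A B)" using a unfolding T.mem_fmul by auto
  qed
qed

lemma uf_map_apply [simp]: "T.uf F \<Longrightarrow> uf_map S T \<theta> F = pre F"
  by (simp add: uf_map_def)

text \<open>Continuity, properness and later the naturality of the unit are all read off from this
  identity.\<close>

lemma vimage_uf_map:
  assumes "s \<in> carrier S" shows "{F \<in> ultrafilters T. uf_map S T \<theta> F \<in> S.V s} = T.V (\<theta> s)"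
  using assms by (auto simp: S.mem_V T.mem_V preimage_ultrafilter)

text \<open>Both covering conditions come from \<open>T.filter_eqI\<close> and
  \<open>S.filter_eqI\<close>. Two ultrafilters with equal preimages share an element
  \<open>\<theta> s\<close>, so equal sources make them equal. For star-surjectivity,
  \<open>F\<close> is lifted along \<open>\<theta> s\<close> with \<open>s\<close> in
  \<open>H\<close>; the preimage of the lift shares \<open>s\<close> and its source with
  \<open>H\<close>.\<close>

lemma covering_uf_map: "covering_functor T.UG S.UG (uf_map S T \<theta>)"
  unfolding covering_functor_def groupoid_functor_def uf_groupoid_simps
proof (intro conjI ballI impI)
  show "uf_map S T \<theta> \<in> ultrafilters T \<rightarrow> ultrafilters S" by (auto simp: preimage_ultrafilter)
  show "uf_map S T \<theta> (T.fsrc F) = S.fsrc (uf_map S T \<theta> F)"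
    "uf_map S T \<theta> (T.frng F) = S.frng (uf_map S T \<theta> F)" if "F \<in> ultrafilters T" for F
    using that T.uf_fsrc T.uf_frng pre_fsrc pre_frng by simp_all
  show "uf_map S T \<theta> (T.fmul A B) = S.fmul (uf_map S T \<theta> A) (uf_map S T \<theta> B)"
    if "A \<in> ultrafilters T" "B \<in> ultrafilters T" "T.fsrc A = T.frng B" for A B
    using that T.uf_fmul[OF T.uf_filter, of A B] pre_fmul[of A B] by simp
next
  fix A B assume A: "A \<in> ultrafilters T" and B: "B \<in> ultrafilters T"
    and *: "uf_map S T \<theta> A = uf_map S T \<theta> B \<and> T.fsrc A = T.fsrc B"
  have eq: "pre A = pre B" using A B * by simp
  have "pre A \<noteq> {}"
    using S.filter_nonempty[OF S.uf_filter[OF preimage_ultrafilter]] A unfolding ultrafilters_iff .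
  then obtain s where "\<theta> s \<in> A" "\<theta> s \<in> B" using eq by blast
  then show "A = B"
    by (intro T.filter_eqI[of A B "\<theta> s"]) (use A B * in \<open>simp_all add: T.uf_filter\<close>)
next
  fix F H assume "F \<in> gids T.UG" and H: "H \<in> ultrafilters S" and HF: "S.fsrc H = uf_map S T \<theta> F"
  then have F: "T.uf F" "T.fsrc F = F" by (auto simp: gids_def)
  have h: "S.uf H" "sg_filter S H" using H by (auto intro: S.uf_filter)
  obtain s where s: "s \<in> H" using S.filter_nonempty[OF h(2)] by blast
  have sS: "s \<in> carrier S" using s h by simp
  have "sg_inv S s \<cdot>\<^bsub>S\<^esub> s \<in> pre F" using S.dom_mem_fsrc[OF h(2) s] HF F by simp
  then have "sg_inv T (\<theta> s) \<cdot>\<^bsub>T\<^esub> \<theta> s \<in> F" using sS by (simp add: hom_mult hom_inv)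
  then obtain A where A: "T.uf A" "\<theta> s \<in> A" "T.fsrc A = F"
    using T.uf_src_ex[OF F hom_closed[OF sS]] by blast
  have "pre A = H"
  proof (rule S.filter_eqI[of _ _ s])
    show "S.fsrc (pre A) = S.fsrc H" using pre_fsrc[OF A(1)] A(3) HF F by simp
  qed (use A h s sS preimage_ultrafilter S.uf_filter in auto)
  then show "\<exists>A\<in>ultrafilters T. T.fsrc A = F \<and> uf_map S T \<theta> A = H" using A by auto
qed

lemma continuous_uf_map: "continuous_map T.UT S.UT (uf_map S T \<theta>)"
  unfolding continuous_on_generated_topo_iff
proof (intro conjI allI impI)
  fix U assume "U \<in> S.V ` carrier S"
  then obtain s where s: "s \<in> carrier S" "U = S.V s" by blast
  have "uf_map S T \<theta> -` U \<inter> topspace T.UT = {F \<in> ultrafilters T. uf_map S T \<theta> F \<in> S.V s}"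
    using s(2) by auto
  also have "\<dots> = T.V (\<theta> s)" using vimage_uf_map[OF s(1)] .
  finally have "uf_map S T \<theta> -` U \<inter> topspace T.UT = T.V (\<theta> s)" .
  then show "openin T.UT (uf_map S T \<theta> -` U \<inter> topspace T.UT)" using s by (simp add: T.openin_V)
next
  have "uf_map S T \<theta> ` topspace T.UT \<subseteq> topspace S.UT" by (auto simp: preimage_ultrafilter)
  then show "uf_map S T \<theta> ` topspace T.UT \<subseteq> \<Union>(S.V ` carrier S)"
    unfolding S.Union_V S.topspace_UT .
qed

text \<open>A compact \<open>K\<close> is covered by finitely many sets \<open>S.V s\<close>. Its
  preimage is closed and lies in the union of the corresponding sets
  \<open>T.V (\<theta> s)\<close>, which is compact.\<close>

lemma proper_uf_map:
  assumes K: "compactin S.UT K" shows "compactin T.UT {F \<in> ultrafilters T. uf_map S T \<theta> F \<in> K}"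
proof -
  have sub: "K \<subseteq> \<Union>(S.V ` carrier S)"
    using compactin_subset_topspace[OF K] unfolding S.Union_V S.topspace_UT .
  then obtain Z where Z: "finite Z" "Z \<subseteq> S.V ` carrier S" "K \<subseteq> \<Union>Z"
    using K S.openin_V unfolding compactin_def by (metis (no_types, lifting) imageE)
  then obtain C where C: "finite C" "C \<subseteq> carrier S" "Z = S.V ` C" by (meson finite_subset_image)
  have "compactin T.UT (\<Union>s\<in>C. T.V (\<theta> s))"
    using C by (intro compactin_Union) (auto simp: T.compactin_V subset_iff)
  moreover have "closedin T.UT {F \<in> topspace T.UT. uf_map S T \<theta> F \<in> K}"
    by (rule closedin_continuous_map_preimage[OF continuous_uf_map])
      (rule compactin_imp_closedin[OF S.Hausdorff_UT K])
  moreover have "{F \<in> topspace T.UT. uf_map S T \<theta> F \<in> K} \<subseteq> (\<Union>s\<in>C. T.V (\<theta> s))"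
  proof
    fix F assume F: "F \<in> {F \<in> topspace T.UT. uf_map S T \<theta> F \<in> K}"
    then obtain s where "s \<in> C" "uf_map S T \<theta> F \<in> S.V s" using Z C by blast
    moreover from this have "F \<in> {F \<in> ultrafilters T. uf_map S T \<theta> F \<in> S.V s}" using F by simp
    ultimately show "F \<in> (\<Union>s\<in>C. T.V (\<theta> s))" using C(2) vimage_uf_map[of s] by blast
  qed
  ultimately show ?thesis using closed_compactin by auto
qed

lemma uf_map_hom: "uf_map S T \<theta> \<in> hbg_hom T.UG S.UG"
  unfolding hbg_hom_def
  using S.hausdorff_boolean_uf_groupoid T.hausdorff_boolean_uf_groupoid covering_uf_map
    continuous_uf_map proper_uf_map preimage_ultrafilter
  by (auto simp: PiE_iff uf_map_def extensional_def)

end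

section \<open>Compact-open local bisections\<close>

locale hbg =
  fixes G :: "'g top_groupoid"
  assumes hbg: "hausdorff_boolean_groupoid G"

sublocale hbg \<subseteq> grpd G
  by unfold_locales (use hbg in \<open>simp add: hausdorff_boolean_groupoid_def boolean_groupoid_def
    etale_groupoid_def topological_groupoid_def\<close>)

context hbg
begin

abbreviation T where "T \<equiv> gtop G"

lemma topspace_T [simp]: "topspace T = carrier G"
  and continuous_gcomp: "continuous_map (subtopology (prod_topology T T) {(g, h). src g = tgt h}) T (\<lambda>(g, h). g \<odot> h)"
  and continuous_iv: "continuous_map T T iv"
  and local_homeo_src: "local_homeomorphism T (subtopology T (gids G)) src"
  and Hausdorff_T: "Hausdorff_space T"
  and basis_T: "has_basis_of T (\<lambda>V. compactin T V \<and> local_bisection G V)"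
  using hbg by (simp_all add: hausdorff_boolean_groupoid_def boolean_groupoid_def
    etale_groupoid_def topological_groupoid_def)

abbreviation KS where "KS \<equiv> kb_semigroup G"
abbreviation KB where "KB \<equiv> carrier KS"

lemma KB_iff: "A \<in> KB \<longleftrightarrow> compactin T A \<and> openin T A \<and> local_bisection G A"
  by (simp add: kb_semigroup_def)

lemma KB_D:
  assumes "A \<in> KB"
  shows "compactin T A" "openin T A" "local_bisection G A" "A \<subseteq> carrier G" "closedin T A"
    "inj_on src A" "inj_on tgt A"
  using assms compactin_imp_closedin[OF Hausdorff_T] by (auto simp: KB_iff local_bisection_iff)

lemma KB_I: "compactin T A \<Longrightarrow> openin T A \<Longrightarrow> inj_on src A \<Longrightarrow> inj_on tgt A \<Longrightarrow> A \<in> KB"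
  using compactin_subset_topspace by (fastforce simp: KB_iff local_bisection_iff)

lemma KB_inj: "A \<in> KB \<Longrightarrow> a \<in> A \<Longrightarrow> b \<in> A \<Longrightarrow> src a = src b \<or> tgt a = tgt b \<Longrightarrow> a = b"
  using KB_D(6,7) by (auto dest: inj_onD)

lemma KB_closed [simp]: "A \<in> KB \<Longrightarrow> a \<in> A \<Longrightarrow> a \<in> carrier G"
  using KB_D(4) by blast

lemma KB_basis: "openin T U \<Longrightarrow> x \<in> U \<Longrightarrow> \<exists>A\<in>KB. x \<in> A \<and> A \<subseteq> U"
proof -
  assume "openin T U" "x \<in> U"
  then obtain A where "openin T A" "compactin T A \<and> local_bisection G A" "x \<in> A" "A \<subseteq> U"
    using basis_T unfolding has_basis_of_def by blast
  moreover from this have "A \<in> KB" by (simp add: KB_iff)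
  ultimately show ?thesis by blast
qed

text \<open>The source is the map \<open>g \<mapsto> (iv g, g)\<close> followed by
  composition.\<close>

lemma continuous_src: "continuous_map T T src"
proof -
  have "continuous_map T (prod_topology T T) (\<lambda>g. (iv g, g))"
    using continuous_iv by (simp add: continuous_map_pairedI)
  then have "continuous_map T (subtopology (prod_topology T T) {(g, h). src g = tgt h}) (\<lambda>g. (iv g, g))"
    by (rule continuous_map_into_subtopology) auto
  from continuous_map_compose[OF this continuous_gcomp] show ?thesis
    by (rule continuous_map_eq) auto
qed

lemma continuous_tgt: "continuous_map T T tgt"
  using continuous_map_compose[OF continuous_iv continuous_src] by (rule continuous_map_eq) auto

text \<open>Near an identity \<open>e\<close>, any \<open>g\<close> lying together with its source in a local bisection
  equals its source.\<close>

lemma openin_gids: "openin T (gids G)"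
proof (subst openin_subopen, intro ballI)
  fix e assume e: "e \<in> gids G"
  then obtain A where A: "A \<in> KB" "e \<in> A" using KB_basis[of "carrier G" e]
    by (metis gids_iff openin_topspace topspace_T)
  define U where "U = {g \<in> A. src g \<in> A}"
  have "openin T U" unfolding U_def
    using A KB_D(2) continuous_src by (auto intro: openin_continuous_map_preimage_gen)
  moreover have "e \<in> U" using A e by (simp add: U_def gids_iff)
  moreover have "U \<subseteq> gids G"
  proof
    fix g assume "g \<in> U"
    then have g: "g \<in> A" "src g \<in> A" "g \<in> carrier G" using A by (auto simp: U_def)
    then have "src g = g" using KB_inj[OF A(1), of "src g" g] by simp
    then show "g \<in> gids G" using g by (simp add: gids_iff)
  qed
  ultimately show "\<exists>U. openin T U \<and> e \<in> U \<and> U \<subseteq> gids G" by blast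
qed

text \<open>The local homeomorphisms give images open in the space of identities, which is itself
  open in the groupoid by \<open>openin_gids\<close>.\<close>

lemma open_src: assumes U: "openin T U" shows "openin T (src ` U)"
proof (subst openin_subopen, intro ballI)
  fix y assume "y \<in> src ` U"
  then obtain x where x: "x \<in> U" "y = src x" by blast
  let ?Y = "subtopology T (gids G)"
  have "x \<in> topspace T" using x U openin_subset by blast
  then obtain W where W: "x \<in> W" "openin T W" "openin ?Y (src ` W)"
    "homeomorphic_map (subtopology T W) (subtopology ?Y (src ` W)) src"
    using local_homeo_src unfolding local_homeomorphism_def by blast
  have "openin (subtopology T W) (U \<inter> W)" using U by (simp add: openin_subtopology_Int)
  then have "openin (subtopology ?Y (src ` W)) (src ` (U \<inter> W))"
    using homeomorphic_imp_open_map[OF W(4)] by (simp add: open_map_def)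
  then have "openin ?Y (src ` (U \<inter> W))" using W(3) by (rule openin_trans_full)
  then have "openin T (src ` (U \<inter> W))" using openin_gids by (rule openin_trans_full)
  then show "\<exists>V. openin T V \<and> y \<in> V \<and> V \<subseteq> src ` U" using x W(1) by blast
qed

lemma open_iv: assumes U: "openin T U" shows "openin T (iv ` U)"
proof -
  have sub: "U \<subseteq> carrier G" using openin_subset[OF U] by simp
  have "iv ` U = {g \<in> topspace T. iv g \<in> U}"
  proof
    show "iv ` U \<subseteq> {g \<in> topspace T. iv g \<in> U}" using sub by auto
    show "{g \<in> topspace T. iv g \<in> U} \<subseteq> iv ` U"
    proof
      fix g assume g: "g \<in> {g \<in> topspace T. iv g \<in> U}"
      then have "g = iv (iv g)" by simp
      then show "g \<in> iv ` U" using g by blast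
    qed
  qed
  then show ?thesis using openin_continuous_map_preimage[OF continuous_iv U] by simp
qed

lemma open_tgt: assumes U: "openin T U" shows "openin T (tgt ` U)"
proof -
  have "U \<subseteq> carrier G" using openin_subset[OF U] by simp
  then have "tgt ` U = src ` iv ` U" by (force simp: image_image)
  then show ?thesis using open_src[OF open_iv[OF U]] by simp
qed

section \<open>Products of open sets and of compact sets\<close>

lemma mem_gset_mult: "x \<in> gset_mult G A B \<longleftrightarrow> (\<exists>a\<in>A. \<exists>b\<in>B. src a = tgt b \<and> x = a \<odot> b)"
  by (auto simp: gset_mult_def)

lemma gset_multI: "a \<in> A \<Longrightarrow> b \<in> B \<Longrightarrow> src a = tgt b \<Longrightarrow> a \<odot> b \<in> gset_mult G A B"
  by (auto simp: gset_mult_def)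

text \<open>Instead of the product, the division map \<open>(g, h) \<mapsto> iv g \<odot> h\<close>
  on pairs with a common target is used. Near \<open>(a, x)\<close> it stays in \<open>B\<close>, so
  a point \<open>y\<close> near \<open>x\<close> is the product of a suitable \<open>a'\<close> near
  \<open>a\<close> with the quotient \<open>iv a' \<odot> y\<close>.\<close>

lemma openin_gset_mult:
  assumes A: "openin T A" and B: "openin T B" shows "openin T (gset_mult G A B)"
proof (subst openin_subopen, intro ballI)
  fix x assume "x \<in> gset_mult G A B"
  then obtain a b where ab: "a \<in> A" "b \<in> B" "src a = tgt b" "x = a \<odot> b" by (auto simp: mem_gset_mult)
  have subA: "A \<subseteq> carrier G" and "B \<subseteq> carrier G" using openin_subset[OF A] openin_subset[OF B] by auto
  then have c: "a \<in> carrier G" "b \<in> carrier G" using ab by auto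
  let ?P = "prod_topology T T"
  let ?D = "{(g, h). tgt g = tgt h}"
  let ?Z = "{z \<in> topspace (subtopology ?P ?D). (\<lambda>(g, h). iv g \<odot> h) z \<in> B}"
  have "continuous_map ?P ?P (\<lambda>(g, h). (iv g, h))"
    using continuous_iv unfolding case_prod_beta
    by (intro continuous_map_pairedI continuous_map_snd continuous_map_of_fst[unfolded o_def, THEN iffD2] disjI2)
      (auto intro: continuous_map_compose[OF continuous_map_fst continuous_iv, unfolded o_def])
  then have "continuous_map (subtopology ?P ?D) (subtopology ?P {(g, h). src g = tgt h}) (\<lambda>(g, h). (iv g, h))"
    by (intro continuous_map_into_subtopology continuous_map_from_subtopology) auto
  from continuous_map_compose[OF this continuous_gcomp]
  have "continuous_map (subtopology ?P ?D) T (\<lambda>(g, h). iv g \<odot> h)"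
    by (rule continuous_map_eq) auto
  from openin_continuous_map_preimage[OF this B]
  have "openin (subtopology ?P ?D) ?Z" .
  then obtain W where W: "openin ?P W"
    "?Z = W \<inter> ?D"
    by (auto simp: openin_subtopology)
  have "(a, x) \<in> ?Z" using ab c by simp
  then have "(a, x) \<in> W" using W(2) by blast
  then have "\<exists>A' X. openin T A' \<and> openin T X \<and> a \<in> A' \<and> x \<in> X \<and> A' \<times> X \<subseteq> W"
    using W(1) by (simp add: openin_prod_topology_alt)
  then obtain A' X where AX: "openin T A'" "openin T X" "a \<in> A'" "x \<in> X" "A' \<times> X \<subseteq> W" by blast
  \<comment> \<open>Division by \<open>a'\<close> needs an \<open>a'\<close> near \<open>a\<close>
    with the same target as \<open>y\<close>. Those \<open>y\<close> for which one exists form an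
    open set, because the target map is open and continuous.\<close>
  define N where "N = {y \<in> X. tgt y \<in> tgt ` (A \<inter> A')}"
  have "openin T N" unfolding N_def
    using AX A by (intro openin_continuous_map_preimage_gen[OF continuous_tgt] open_tgt) auto
  moreover have "x \<in> N" using AX ab c by (auto simp: N_def)
  moreover have "N \<subseteq> gset_mult G A B"
  proof
    fix y assume "y \<in> N"
    then obtain a' where a': "y \<in> X" "a' \<in> A" "a' \<in> A'" "tgt y = tgt a'" by (auto simp: N_def)
    then have "(a', y) \<in> W \<inter> ?D" using AX by auto
    then have "(a', y) \<in> ?Z" using W(2) by blast
    then have "iv a' \<odot> y \<in> B" by simp
    moreover have y: "y \<in> carrier G" "a' \<in> carrier G" using openin_subset[OF AX(2)] a' subA by auto
    moreover have "y = a' \<odot> (iv a' \<odot> y)" "src a' = tgt (iv a' \<odot> y)" using a' y by simp_all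
    ultimately show "y \<in> gset_mult G A B" using a' unfolding mem_gset_mult by blast
  qed
  ultimately show "\<exists>U. openin T U \<and> x \<in> U \<and> U \<subseteq> gset_mult G A B" by blast
qed

text \<open>The composable pairs are the equaliser of two continuous maps into a Hausdorff space,
  hence closed. Within \<open>A \<times> B\<close> they form a compact set, and the product is its
  continuous image.\<close>

lemma compactin_gset_mult:
  assumes A: "compactin T A" and B: "compactin T B" shows "compactin T (gset_mult G A B)"
proof -
  let ?P = "prod_topology T T"
  let ?D = "{(g, h). src g = tgt h}"
  let ?C = "{z \<in> topspace ?P. (src \<circ> fst) z = (tgt \<circ> snd) z}"
  have "closedin ?P ?C"
    by (rule closedin_continuous_maps_eq[OF Hausdorff_T])
      (rule continuous_map_compose[OF continuous_map_fst continuous_src]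
        continuous_map_compose[OF continuous_map_snd continuous_tgt])+
  moreover have "compactin ?P (A \<times> B)" using A B by (simp add: compactin_Times)
  ultimately have "compactin ?P (A \<times> B \<inter> ?C)"
    by (simp add: compact_Int_closedin)
  then have "compactin (subtopology ?P ?D) (A \<times> B \<inter> ?C)"
    by (auto simp: compactin_subtopology)
  from image_compactin[OF this continuous_gcomp]
  have "compactin T ((\<lambda>(g, h). g \<odot> h) ` (A \<times> B \<inter> ?C))" .
  moreover have "(\<lambda>(g, h). g \<odot> h) ` (A \<times> B \<inter> ?C) = gset_mult G A B"
    using compactin_subset_topspace[OF A] compactin_subset_topspace[OF B]
    by (force simp: gset_mult_def)
  ultimately show ?thesis by simp
qed

lemma KB_mult:
  assumes A: "A \<in> KB" and B: "B \<in> KB" shows "gset_mult G A B \<in> KB"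
proof (rule KB_I)
  show "compactin T (gset_mult G A B)" "openin T (gset_mult G A B)"
    using KB_D[OF A] KB_D[OF B] compactin_gset_mult openin_gset_mult by auto
  have "x = y" if xy: "x \<in> gset_mult G A B" "y \<in> gset_mult G A B" "src x = src y \<or> tgt x = tgt y" for x y
  proof -
    obtain a b c d where *: "a \<in> A" "b \<in> B" "src a = tgt b" "x = a \<odot> b" "c \<in> A" "d \<in> B" "src c = tgt d" "y = c \<odot> d"
      using xy by (auto simp: mem_gset_mult)
    have cl: "a \<in> carrier G" "b \<in> carrier G" "c \<in> carrier G" "d \<in> carrier G" using * A B by auto
    from xy(3) show ?thesis
    proof
      assume "src x = src y"
      then have "b = d" using * cl KB_inj[OF B] by auto
      then have "a = c" using * KB_inj[OF A] by auto
      with \<open>b = d\<close> * show ?thesis by simp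
    next
      assume "tgt x = tgt y"
      then have "a = c" using * cl KB_inj[OF A] by auto
      then have "b = d" using * KB_inj[OF B] by auto
      with \<open>a = c\<close> * show ?thesis by simp
    qed
  qed
  then show "inj_on src (gset_mult G A B)" "inj_on tgt (gset_mult G A B)" by (auto intro: inj_onI)
qed

lemma gset_mult_assoc:
  assumes "A \<subseteq> carrier G" "B \<subseteq> carrier G" "C \<subseteq> carrier G"
  shows "gset_mult G (gset_mult G A B) C = gset_mult G A (gset_mult G B C)"
proof
  show "gset_mult G (gset_mult G A B) C \<subseteq> gset_mult G A (gset_mult G B C)"
  proof
    fix x assume "x \<in> gset_mult G (gset_mult G A B) C"
    then obtain a b c where *: "a \<in> A" "b \<in> B" "c \<in> C" "src a = tgt b" "src (a \<odot> b) = tgt c" "x = (a \<odot> b) \<odot> c"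
      by (auto simp: mem_gset_mult)
    then have cl: "a \<in> carrier G" "b \<in> carrier G" "c \<in> carrier G" using assms by auto
    have "src b = tgt c" "src a = tgt (b \<odot> c)" "x = a \<odot> (b \<odot> c)" using * cl by (simp_all add: comp_assoc)
    then show "x \<in> gset_mult G A (gset_mult G B C)" using *(1-3) by (simp add: gset_multI)
  qed
  show "gset_mult G A (gset_mult G B C) \<subseteq> gset_mult G (gset_mult G A B) C"
  proof
    fix x assume "x \<in> gset_mult G A (gset_mult G B C)"
    then obtain a b c where *: "a \<in> A" "b \<in> B" "c \<in> C" "src a = tgt (b \<odot> c)" "src b = tgt c" "x = a \<odot> (b \<odot> c)"
      by (auto simp: mem_gset_mult)
    then have cl: "a \<in> carrier G" "b \<in> carrier G" "c \<in> carrier G" using assms by auto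
    have "src a = tgt b" "src (a \<odot> b) = tgt c" "x = (a \<odot> b) \<odot> c" using * cl by (simp_all add: comp_assoc)
    then show "x \<in> gset_mult G (gset_mult G A B) C" using *(1-3) by (simp add: gset_multI)
  qed
qed

lemma KB_iv: assumes A: "A \<in> KB" shows "iv ` A \<in> KB"
proof (rule KB_I)
  show "compactin T (iv ` A)" "openin T (iv ` A)"
    using KB_D[OF A] image_compactin[OF _ continuous_iv] open_iv by auto
  show "inj_on src (iv ` A)" "inj_on tgt (iv ` A)"
    using KB_D(4,6,7)[OF A] by (auto simp: inj_on_def subset_iff)
qed

lemma KB_regular: assumes A: "A \<in> KB" shows "gset_mult G (gset_mult G A (iv ` A)) A = A"
proof
  show "gset_mult G (gset_mult G A (iv ` A)) A \<subseteq> A"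
  proof
    fix x assume "x \<in> gset_mult G (gset_mult G A (iv ` A)) A"
    then obtain a b c where *: "a \<in> A" "b \<in> A" "c \<in> A" "src a = tgt (iv b)" "src (a \<odot> iv b) = tgt c" "x = (a \<odot> iv b) \<odot> c"
      by (auto simp: mem_gset_mult)
    then have cl: "a \<in> carrier G" "b \<in> carrier G" "c \<in> carrier G" using A by auto
    then have "a = b" using * KB_inj[OF A, of a b] by simp
    then have "b = c" using * cl KB_inj[OF A, of b c] by simp
    then show "x \<in> A" using * cl \<open>a = b\<close> by simp
  qed
  show "A \<subseteq> gset_mult G (gset_mult G A (iv ` A)) A"
  proof
    fix a assume a: "a \<in> A"
    then have "a \<in> carrier G" using A by simp
    then have "a = (a \<odot> iv a) \<odot> a" "src a = tgt (iv a)" "src (a \<odot> iv a) = tgt a" by simp_all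
    moreover have "(a \<odot> iv a) \<odot> a \<in> gset_mult G (gset_mult G A (iv ` A)) A"
      by (intro gset_multI imageI a calculation(2,3))
    ultimately show "a \<in> gset_mult G (gset_mult G A (iv ` A)) A" by metis
  qed
qed

lemma iv_image_iv: "A \<subseteq> carrier G \<Longrightarrow> iv ` iv ` A = A"
  by (force simp: image_image)

text \<open>An element \<open>b\<close> of \<open>B\<close> is a product
  \<open>(c \<odot> a) \<odot> d\<close> with \<open>c\<close> and \<open>d\<close> in
  \<open>B\<close>. Comparing targets and sources in the bisection forces \<open>c = d = b\<close>,
  hence \<open>a\<close> is the inverse of \<open>b\<close>. The two inclusions use this with the
  roles of \<open>A\<close> and \<open>B\<close> exchanged.\<close>

lemma KB_inverse_unique:
  assumes A: "A \<in> KB" and B: "B \<in> KB"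
    and ABA: "gset_mult G (gset_mult G A B) A = A" and BAB: "gset_mult G (gset_mult G B A) B = B"
  shows "B = iv ` A"
proof -
  have *: "iv b \<in> A" if A: "A \<in> KB" and B: "B \<in> KB" and BAB: "gset_mult G (gset_mult G B A) B = B" and b: "b \<in> B" for A B b
  proof -
    obtain c a d where e: "c \<in> B" "a \<in> A" "d \<in> B" "src c = tgt a" "src (c \<odot> a) = tgt d" "b = (c \<odot> a) \<odot> d"
      using b BAB by (metis mem_gset_mult)
    have cl: "a \<in> carrier G" "b \<in> carrier G" "c \<in> carrier G" "d \<in> carrier G" using e A B b by auto
    have "tgt b = tgt c" "src b = src d" using e cl by auto
    then have "c = b" "d = b" using KB_inj[OF B] e b by metis+
    then have b1: "src b = tgt a" and b3: "b = (b \<odot> a) \<odot> b" using e(4,6) by metis+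
    have "src a = tgt b" using e(5) b1 cl \<open>c = b\<close> \<open>d = b\<close> by simp
    note ba = b1 this b3
    have "b \<odot> a = tgt b" using ba cl by (metis comp_laws(1,2) inv_cancel(3) inv_laws(5))
    moreover have "a \<odot> b = src b" using ba cl by (metis comp_assoc comp_laws(1,3) inv_cancel(1) inv_laws(4))
    ultimately have "iv b = a" using ba cl by (intro inv_eqI) auto
    then show ?thesis using e by simp
  qed
  show ?thesis
  proof
    show "B \<subseteq> iv ` A"
    proof
      fix b assume b: "b \<in> B"
      then have "iv b \<in> A" "b = iv (iv b)" using *[OF A B BAB] B by simp_all
      then show "b \<in> iv ` A" by blast
    qed
    show "iv ` A \<subseteq> B" using *[OF B A ABA] by blast
  qed
qed

section \<open>The inverse semigroup of bisections and its order\<close>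

lemma kb_simps [simp]: "mult KS = gset_mult G" "zero KS = {}"
  by (simp_all add: kb_semigroup_def)

lemma empty_KB [simp]: "{} \<in> KB"
  by (rule KB_I) auto

lemma gset_mult_empty [simp]: "gset_mult G {} A = {}" "gset_mult G A {} = {}"
  by (auto simp: gset_mult_def)

lemma inverse_semigroup_KB: "inverse_semigroup KS"
  unfolding inverse_semigroup_def kb_simps
proof (intro conjI ballI)
  fix A B C assume "A \<in> KB" "B \<in> KB" "C \<in> KB"
  then show "gset_mult G (gset_mult G A B) C = gset_mult G A (gset_mult G B C)"
    by (intro gset_mult_assoc KB_D)
next
  fix A assume A: "A \<in> KB"
  show "\<exists>!B. B \<in> KB \<and> gset_mult G (gset_mult G A B) A = A \<and> gset_mult G (gset_mult G B A) B = B"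
  proof (rule ex1I)
    show "iv ` A \<in> KB \<and> gset_mult G (gset_mult G A (iv ` A)) A = A \<and> gset_mult G (gset_mult G (iv ` A) A) (iv ` A) = iv ` A"
      using KB_iv[OF A] KB_regular[OF A] KB_regular[OF KB_iv[OF A]] iv_image_iv[OF KB_D(4)[OF A]] by simp
  qed (use KB_inverse_unique[OF A] in blast)
qed (auto intro: KB_mult)

end

sublocale hbg \<subseteq> KB: inverse_sg "kb_semigroup G"
  by unfold_locales (rule inverse_semigroup_KB)

context hbg
begin

declare KB.le_closed [simp del, rule del]

lemma KB_sg_inv: "A \<in> KB \<Longrightarrow> sg_inv KS A = iv ` A"
  using KB_iv[of A] KB_regular[of A] KB_regular[of "iv ` A"] iv_image_iv[of A] KB_D(4)[of A]
  by (intro KB.inv_unique) auto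

text \<open>Comparing source and target inside the bisection shows that a factorisation of
  \<open>a\<close> in \<open>A\<close> can only be \<open>a = a \<odot> a\<close>, which makes
  \<open>a\<close> an identity.\<close>

lemma gset_mult_idem_iff: assumes A: "A \<in> KB" shows "gset_mult G A A = A \<longleftrightarrow> A \<subseteq> gids G"
proof
  assume AA: "gset_mult G A A = A"
  show "A \<subseteq> gids G"
  proof
    fix a assume a: "a \<in> A"
    then obtain b c where *: "b \<in> A" "c \<in> A" "src b = tgt c" "a = b \<odot> c" using AA by (metis mem_gset_mult)
    then have cl: "b \<in> carrier G" "c \<in> carrier G" "a \<in> carrier G" using A a by auto
    have "tgt a = tgt b" "src a = src c" using *(3,4) cl by simp_all
    then have "b = a" "c = a" by (auto intro: KB_inj[OF A *(1) a] KB_inj[OF A *(2) a])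
    then have "a = a \<odot> a" "src a = tgt a" using *(3,4) by metis+
    then have "src a = a" using cl by (metis inv_cancel(1) inv_laws(4))
    then show "a \<in> gids G" using cl by (simp add: gids_iff)
  qed
next
  assume ids: "A \<subseteq> gids G"
  show "gset_mult G A A = A"
  proof
    show "gset_mult G A A \<subseteq> A"
    proof
      fix x assume "x \<in> gset_mult G A A"
      then obtain a b where *: "a \<in> A" "b \<in> A" "src a = tgt b" "x = a \<odot> b" by (auto simp: mem_gset_mult)
      then have "src a = a" "tgt b = b" "a \<in> carrier G" using ids gids_tgt by (auto simp: gids_iff)
      then show "x \<in> A" using * unit_laws(7)[of a] by auto
    qed
    show "A \<subseteq> gset_mult G A A"
    proof
      fix a assume a: "a \<in> A"
      then have "src a = a" "tgt a = a" "a \<in> carrier G" using ids gids_tgt by (auto simp: gids_iff)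
      then show "a \<in> gset_mult G A A" using a unit_laws(7)[of a] unfolding mem_gset_mult by metis
    qed
  qed
qed

lemma KB_idems: "A \<in> idems KS \<longleftrightarrow> A \<in> KB \<and> A \<subseteq> gids G"
  using gset_mult_idem_iff unfolding idems_def by auto

text \<open>For \<open>A \<subseteq> B\<close> the idempotent witness is the domain of
  \<open>A\<close>: multiplying \<open>B\<close> by it on the right keeps just the arrows whose
  sources are sources of \<open>A\<close>.\<close>

lemma KB_le_iff:
  assumes A: "A \<in> KB" and B: "B \<in> KB" shows "nat_le KS A B \<longleftrightarrow> A \<subseteq> B"
proof
  assume "nat_le KS A B"
  then obtain C where "C \<in> idems KS" "A = B \<cdot>\<^bsub>KS\<^esub> C" unfolding nat_le_def by blast
  then have C: "C \<subseteq> gids G" "A = gset_mult G B C" by (simp_all add: KB_idems)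
  show "A \<subseteq> B"
  proof
    fix x assume "x \<in> A"
    then obtain b c where *: "b \<in> B" "c \<in> C" "src b = tgt c" "x = b \<odot> c" using C by (auto simp: mem_gset_mult)
    then have "c = src b" "b \<in> carrier G" using C gids_tgt[of c] KB_closed[OF B] by auto
    then have "x = b" using *(4) by simp
    then show "x \<in> B" using *(1) by simp
  qed
next
  assume AB: "A \<subseteq> B"
  have "gset_mult G B (gset_mult G (iv ` A) A) = A"
  proof
    show "gset_mult G B (gset_mult G (iv ` A) A) \<subseteq> A"
    proof
      fix x assume "x \<in> gset_mult G B (gset_mult G (iv ` A) A)"
      then obtain b a c where *: "b \<in> B" "a \<in> A" "c \<in> A" "src (iv a) = tgt c" "src b = tgt (iv a \<odot> c)" "x = b \<odot> (iv a \<odot> c)"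
        by (auto simp: mem_gset_mult)
      then have cl: "a \<in> carrier G" "b \<in> carrier G" "c \<in> carrier G" using A B by auto
      then have "a = c" using * KB_inj[OF A, of a c] by simp
      then have "b = a" using * cl AB KB_inj[OF B, of b a] by auto
      then show "x \<in> A" using * cl \<open>a = c\<close> by simp
    qed
    show "A \<subseteq> gset_mult G B (gset_mult G (iv ` A) A)"
    proof
      fix a assume a: "a \<in> A"
      then have "a \<in> carrier G" using A by simp
      then have "a = a \<odot> (iv a \<odot> a)" "src (iv a) = tgt a" "src a = tgt (iv a \<odot> a)" by simp_all
      moreover have "a \<odot> (iv a \<odot> a) \<in> gset_mult G B (gset_mult G (iv ` A) A)"
        using a AB by (intro gset_multI imageI calculation(2,3)) auto
      ultimately show "a \<in> gset_mult G B (gset_mult G (iv ` A) A)" by metis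
    qed
  qed
  moreover have "gset_mult G (iv ` A) A \<in> idems KS"
    using KB.dom_idem[OF A] KB_sg_inv[OF A] by simp
  ultimately show "nat_le KS A B" unfolding nat_le_def by force
qed

lemma KB_subset: "A \<in> KB \<Longrightarrow> B \<subseteq> A \<Longrightarrow> compactin T B \<Longrightarrow> openin T B \<Longrightarrow> B \<in> KB"
  using KB_D(6,7) by (intro KB_I) (auto intro: inj_on_subset)

text \<open>Compact sets are closed because the groupoid is Hausdorff, so the intersection stays
  compact. This is the source of the meets.\<close>

lemma KB_Int: "A \<in> KB \<Longrightarrow> B \<in> KB \<Longrightarrow> A \<inter> B \<in> KB"
  by (rule KB_subset[of A]) (auto intro: compact_Int_closedin KB_D)

lemma KB_Diff:
  assumes A: "A \<in> KB" and B: "B \<in> KB" shows "A - B \<in> KB"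
proof (rule KB_subset[OF A])
  show "openin T (A - B)" using KB_D[OF A] KB_D[OF B] by (simp add: openin_diff)
  have "closedin T (A - B)" using KB_D[OF A] KB_D[OF B] by (simp add: closedin_diff)
  then show "compactin T (A - B)" using KB_D[OF A] by (auto intro: closed_compactin)
qed auto

text \<open>On identities source and target are the identity map, so injectivity survives the
  union.\<close>

lemma KB_Un_gids:
  assumes "A \<in> KB" "B \<in> KB" "A \<subseteq> gids G" "B \<subseteq> gids G" shows "A \<union> B \<in> KB"
proof (rule KB_I)
  have "src x = x" "tgt x = x" if "x \<in> A \<union> B" for x using that assms gids_tgt by (auto simp: gids_iff)
  then show "inj_on src (A \<union> B)" "inj_on tgt (A \<union> B)" by (auto simp: inj_on_def)
qed (use assms KB_D in \<open>auto intro: compactin_Un\<close>)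

lemma lower_semilattice_KB: "lower_semilattice (nat_order KS)"
proof (rule lower_semilattice.intro[OF KB.nat_order_partial_order], unfold_locales)
  fix A B assume "A \<in> carrier (nat_order KS)" "B \<in> carrier (nat_order KS)"
  then show "\<exists>C. greatest (nat_order KS) C (Lower (nat_order KS) {A, B})"
    by (intro exI[of _ "A \<inter> B"]) (auto simp: greatest_Lower2_iff KB_le_iff KB_Int)
qed

lemma KB_meet: "A \<in> KB \<Longrightarrow> B \<in> KB \<Longrightarrow> meet (nat_order KS) A B = A \<inter> B"
  by (rule partial_order.meet_eqI[OF KB.nat_order_partial_order]) (auto simp: KB_le_iff KB_Int)

abbreviation EO where "EO \<equiv> idem_order KS"

lemma lattice_KB_idems: "lattice EO"
proof (intro lattice.intro upper_semilattice.intro lower_semilattice.intro KB.idem_order_partial_order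
    upper_semilattice_axioms.intro lower_semilattice_axioms.intro)
  fix A B assume "A \<in> carrier EO" "B \<in> carrier EO"
  then have AB: "A \<in> KB" "B \<in> KB" "A \<subseteq> gids G" "B \<subseteq> gids G" by (auto simp: KB_idems)
  show "\<exists>C. greatest EO C (Lower EO {A, B})"
    using AB KB_Int[OF AB(1,2)]
    by (intro exI[of _ "A \<inter> B"]) (subst greatest_Lower2_iff, auto simp: KB_le_iff KB_idems)
  show "\<exists>C. least EO C (Upper EO {A, B})"
    using AB KB_Un_gids[OF AB]
    by (intro exI[of _ "A \<union> B"]) (subst least_Upper2_iff, auto simp: KB_le_iff KB_idems)
qed

lemma KB_idem_meet:
  assumes "A \<in> KB" "B \<in> KB" "A \<subseteq> gids G" "B \<subseteq> gids G"
  shows "meet EO A B = A \<inter> B"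
  by (rule partial_order.meet_eqI[OF KB.idem_order_partial_order])
    (use assms KB_Int[OF assms(1,2)] in \<open>auto simp: KB_le_iff KB_idems\<close>)

lemma KB_idem_join:
  assumes "A \<in> KB" "B \<in> KB" "A \<subseteq> gids G" "B \<subseteq> gids G"
  shows "join EO A B = A \<union> B"
  by (rule partial_order.join_eqI[OF KB.idem_order_partial_order])
    (use assms KB_Un_gids[OF assms] in \<open>auto simp: KB_le_iff KB_idems\<close>)

lemma gen_boolean_algebra_KB: "gen_boolean_algebra EO (zero KS)"
  unfolding gen_boolean_algebra_def idem_order_simps
proof (intro conjI ballI)
  show "lattice EO" by (rule lattice_KB_idems)
  show "least EO (zero KS) (idems KS)"
    by (auto simp: least_def KB_idems KB_le_iff)
  fix A B assume "A \<in> idems KS" "B \<in> idems KS"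
  then have AB: "A \<in> KB" "B \<in> KB" "A \<subseteq> gids G" "B \<subseteq> gids G" by (auto simp: KB_idems)
  show "\<exists>C\<in>idems KS. join EO A B = join EO A C \<and>
      meet EO A C = zero KS"
  proof (intro bexI conjI)
    have D: "B - A \<in> KB" "B - A \<subseteq> gids G" using AB KB_Diff by auto
    then show "B - A \<in> idems KS" by (simp add: KB_idems)
    show "join EO A B = join EO A (B - A)"
      "meet EO A (B - A) = zero KS"
      using AB D by (auto simp: KB_idem_join KB_idem_meet)
  qed
  fix C assume "C \<in> idems KS"
  then have C: "C \<in> KB" "C \<subseteq> gids G" by (auto simp: KB_idems)
  have "B \<union> C \<in> KB" "A \<inter> B \<in> KB" "A \<inter> C \<in> KB" "B \<union> C \<subseteq> gids G" "A \<inter> B \<subseteq> gids G" "A \<inter> C \<subseteq> gids G"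
    using AB C KB_Un_gids KB_Int by auto
  then show "meet EO A (join EO B C) =
      join EO (meet EO A B) (meet EO A C)"
    using AB C by (auto simp: KB_idem_join KB_idem_meet)
qed

text \<open>With this, distributivity reduces to the fact that \<open>gset_mult\<close> commutes
  with unions.\<close>

lemma KB_is_join:
  assumes A: "\<A> \<subseteq> KB" and U: "\<Union>\<A> \<in> KB"
  shows "is_join KS \<A> J \<longleftrightarrow> J = \<Union>\<A>"
proof
  assume J: "is_join KS \<A> J"
  then have J': "J \<in> KB" "\<And>X. X \<in> \<A> \<Longrightarrow> nat_le KS X J"
    "\<And>K. K \<in> KB \<Longrightarrow> (\<And>X. X \<in> \<A> \<Longrightarrow> nat_le KS X K) \<Longrightarrow> nat_le KS J K"
    unfolding KB.is_join_iff[OF A] by auto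
  have "X \<subseteq> J" if "X \<in> \<A>" for X using J'(1,2) that A KB_le_iff by blast
  moreover have "nat_le KS J (\<Union>\<A>)"
    by (rule J'(3)[OF U]) (use A U KB_le_iff in blast)
  ultimately show "J = \<Union>\<A>" using KB_le_iff[OF J'(1) U] by blast
next
  assume J: "J = \<Union>\<A>"
  show "is_join KS \<A> J"
    unfolding KB.is_join_iff[OF A] J
  proof (intro conjI ballI impI U)
    show "nat_le KS X (\<Union>\<A>)" if "X \<in> \<A>" for X using that A U KB_le_iff by blast
    show "nat_le KS (\<Union>\<A>) K" if "K \<in> KB" "\<forall>X\<in>\<A>. nat_le KS X K" for K
    proof -
      have "\<Union>\<A> \<subseteq> K" using that A KB_le_iff by blast
      then show ?thesis using KB_le_iff[OF U that(1)] by simp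
    qed
  qed
qed

text \<open>If the sources agree, \<open>a \<odot> iv b\<close> lies in a set of identities, hence
  \<open>a = b\<close>; similarly for targets. This keeps source and target injective on the union
  of compatible bisections.\<close>

lemma KB_compatible:
  assumes A: "A \<in> KB" and B: "B \<in> KB" and AB: "compatible KS A B"
    and ab: "a \<in> A" "b \<in> B" "src a = src b \<or> tgt a = tgt b"
  shows "a = b"
proof -
  have 1: "gset_mult G (iv ` A) B \<subseteq> gids G" "gset_mult G A (iv ` B) \<subseteq> gids G"
    using AB KB_sg_inv[OF A] KB_sg_inv[OF B] by (auto simp: compatible_def KB_idems)
  have cl: "a \<in> carrier G" "b \<in> carrier G" using A B ab by auto
  from ab(3) show ?thesis
  proof
    assume s: "src a = src b"
    then have "a \<odot> iv b \<in> gset_mult G A (iv ` B)" using ab cl by (intro gset_multI) auto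
    then have "a \<odot> iv b \<in> gids G" using 1 by blast
    then have "tgt (a \<odot> iv b) = a \<odot> iv b" "src (a \<odot> iv b) = a \<odot> iv b" using gids_tgt gids_iff by blast+
    then have "a \<odot> iv b = tgt b" using s cl by simp
    then show ?thesis using inv_cancel(4)[of b a] s cl by simp
  next
    assume s: "tgt a = tgt b"
    then have "iv a \<odot> b \<in> gset_mult G (iv ` A) B" using ab cl by (intro gset_multI) auto
    then have "iv a \<odot> b \<in> gids G" using 1 by blast
    then have "tgt (iv a \<odot> b) = iv a \<odot> b" using gids_tgt by blast
    then have "iv a \<odot> b = src a" using s cl by simp
    then show ?thesis using inv_cancel(2)[of a b] s cl by simp
  qed
qed

lemma KB_Union_compatible:
  assumes "finite \<A>" and A: "\<A> \<subseteq> KB" "\<And>X Y. X \<in> \<A> \<Longrightarrow> Y \<in> \<A> \<Longrightarrow> compatible KS X Y"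
  shows "\<Union>\<A> \<in> KB"
proof (rule KB_I)
  show "compactin T (\<Union>\<A>)" using assms KB_D(1) by (intro compactin_Union) auto
  show "openin T (\<Union>\<A>)" using A KB_D(2) by (intro openin_Union) auto
  have "a = b" if "a \<in> \<Union>\<A>" "b \<in> \<Union>\<A>" "src a = src b \<or> tgt a = tgt b" for a b
    using that A KB_compatible by blast
  then show "inj_on src (\<Union>\<A>)" "inj_on tgt (\<Union>\<A>)" by (auto intro!: inj_onI)
qed

lemma distributive_KB: "distributive_inverse_semigroup KS"
  unfolding distributive_inverse_semigroup_def
proof (intro conjI allI impI ballI)
  show "inverse_semigroup KS" by (rule inverse_semigroup_KB)
  fix \<A> assume "finite \<A> \<and> \<A> \<noteq> {} \<and> \<A> \<subseteq> KB \<and> (\<forall>s\<in>\<A>. \<forall>t\<in>\<A>. compatible KS s t)"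
  then have A: "\<A> \<subseteq> KB" and U: "\<Union>\<A> \<in> KB" by (auto intro: KB_Union_compatible)
  show "\<exists>J. is_join KS \<A> J" using KB_is_join[OF A U] by blast
  fix J C assume "is_join KS \<A> J" and C: "C \<in> KB"
  then have J: "J = \<Union>\<A>" using KB_is_join[OF A U] by blast
  have "\<Union>((\<lambda>a. gset_mult G C a) ` \<A>) = gset_mult G C J" "\<Union>((\<lambda>a. gset_mult G a C) ` \<A>) = gset_mult G J C"
    unfolding J gset_mult_def by blast+
  moreover have "gset_mult G C J \<in> KB" "gset_mult G J C \<in> KB" using U C J KB_mult by auto
  moreover have "(\<lambda>a. gset_mult G C a) ` \<A> \<subseteq> KB" "(\<lambda>a. gset_mult G a C) ` \<A> \<subseteq> KB"
    using A C KB_mult by auto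
  ultimately show "is_join KS ((\<lambda>a. C \<cdot>\<^bsub>KS\<^esub> a) ` \<A>) (C \<cdot>\<^bsub>KS\<^esub> J)"
    "is_join KS ((\<lambda>a. a \<cdot>\<^bsub>KS\<^esub> C) ` \<A>) (J \<cdot>\<^bsub>KS\<^esub> C)"
    by (simp_all add: KB_is_join)
qed

lemma boolean_inverse_meet_semigroup_KB: "boolean_inverse_meet_semigroup KS"
  by (simp add: boolean_inverse_meet_semigroup_def distributive_KB gen_boolean_algebra_KB
      lower_semilattice_KB del: kb_simps)

end

sublocale hbg \<subseteq> KB: bim "kb_semigroup G"
  by unfold_locales (rule boolean_inverse_meet_semigroup_KB)

subsection \<open>Ultrafilters of compact-open local bisections are points\<close>

context hbg
begin

abbreviation pt where "pt g \<equiv> {A \<in> KB. g \<in> A}"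

lemma filter_pt: assumes g: "g \<in> carrier G" shows "sg_filter KS (pt g)"
  unfolding sg_filter_def
proof (intro conjI ballI impI)
  show "pt g \<noteq> {}" using KB_basis[of "carrier G" g] g openin_topspace[of T] by auto
  show "pt g \<subseteq> KB" by auto
  show "B \<in> pt g" if "A \<in> pt g" "B \<in> KB" "nat_le KS A B" for A B
    using that KB_le_iff by auto
  show "\<exists>C\<in>pt g. nat_le KS C A \<and> nat_le KS C B" if "A \<in> pt g" "B \<in> pt g" for A B
    using that by (intro bexI[of _ "A \<inter> B"]) (auto simp: KB_le_iff KB_Int)
qed simp

text \<open>For a bisection \<open>B\<close> that misses \<open>g\<close>, the difference
  \<open>A - B\<close> with any bisection \<open>A\<close> through \<open>g\<close> is again a
  bisection through \<open>g\<close>, and it is disjoint from \<open>B\<close>.\<close>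

lemma uf_pt:
  assumes g: "g \<in> carrier G" shows "KB.uf (pt g)"
proof (rule KB.ufI[OF filter_pt[OF g]])
  fix B assume B: "B \<in> KB" "B \<notin> pt g"
  obtain A where A: "A \<in> KB" "g \<in> A" using filter_pt[OF g] KB.filter_nonempty by blast
  have D: "A - B \<in> KB" using A B KB_Diff by blast
  have "Z = zero KS" if "nat_le KS Z (A - B)" "nat_le KS Z B" for Z
  proof -
    have "Z \<in> KB" using KB.le_closed[OF that(2)] B by simp
    then show ?thesis using that B D KB_le_iff by auto
  qed
  then show "\<exists>X\<in>pt g. KB.disj X B" using A B D by (intro bexI[of _ "A - B"]) auto
qed

lemma uf_is_pt:
  assumes U: "KB.uf \<U>" shows "\<exists>g\<in>carrier G. \<U> = pt g"
proof -
  have F: "sg_filter KS \<U>" using U by (rule KB.uf_filter)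
  have sub: "\<U> \<subseteq> KB" using F by (rule KB.filter_subset)
  obtain A where A: "A \<in> \<U>" using KB.filter_nonempty[OF F] by blast
  \<comment> \<open>A single member lies inside every finite intersection, and it is nonempty
    because the empty bisection is the zero; this is the finite intersection property on the compact
    set \<open>A\<close>.\<close>
  have fin: "\<exists>Z\<in>\<U>. Z \<subseteq> A \<inter> \<Inter>\<F>" if "finite \<F>" "\<F> \<subseteq> \<U>" for \<F>
    using that
  proof induction
    case (insert X \<F>)
    then obtain Z where Z: "Z \<in> \<U>" "Z \<subseteq> A \<inter> \<Inter>\<F>" by auto
    then obtain W where W: "W \<in> \<U>" "nat_le KS W Z" "nat_le KS W X"
      using KB.filter_dir[OF F Z(1), of X] insert by blast
    have "W \<in> KB" "Z \<in> KB" "X \<in> KB" using W(1) Z(1) insert.prems sub by auto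
    then have "W \<subseteq> Z" "W \<subseteq> X" using W(2,3) by (simp_all add: KB_le_iff)
    then show ?case using W(1) Z by (intro bexI[of _ W]) auto
  qed (use A in auto)
  have "A \<inter> \<Inter>\<U> \<noteq> {}"
  proof -
    have "compactin T A" using A sub KB_D(1) by blast
    moreover have "\<forall>C\<in>\<U>. closedin T C" using sub KB_D(5) by blast
    moreover have "A \<inter> \<Inter>\<F> \<noteq> {}" if F': "finite \<F>" "\<F> \<subseteq> \<U>" for \<F>
      using fin[OF F'] KB.filter_zero[OF F] by (metis kb_simps(2) subset_empty)
    ultimately show ?thesis unfolding compactin_fip by blast
  qed
  then obtain g where g: "g \<in> A" "\<And>X. X \<in> \<U> \<Longrightarrow> g \<in> X" by blast
  have gG: "g \<in> carrier G" using g(1) A sub by auto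
  have "\<U> = pt g"
    by (rule KB.uf_eqI[OF U uf_pt[OF gG]]) (use sub g in auto)
  then show ?thesis using gG by blast
qed

end

subsection \<open>Functoriality\<close>

locale hbg_morphism = G: hbg G + H: hbg H
  for G :: "'g top_groupoid" and H :: "'h top_groupoid" +
  fixes \<phi> :: "'g \<Rightarrow> 'h"
  assumes hom: "\<phi> \<in> hbg_hom G H"
begin

lemma hom_closed [simp]: "g \<in> carrier G \<Longrightarrow> \<phi> g \<in> carrier H"
  and hom_src: "g \<in> carrier G \<Longrightarrow> \<phi> (G.src g) = H.src (\<phi> g)"
  and hom_tgt: "g \<in> carrier G \<Longrightarrow> \<phi> (G.tgt g) = H.tgt (\<phi> g)"
  and hom_comp: "g \<in> carrier G \<Longrightarrow> h \<in> carrier G \<Longrightarrow> G.src g = G.tgt h \<Longrightarrow> \<phi> (gcomp G g h) = gcomp H (\<phi> g) (\<phi> h)"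
  and hom_continuous: "continuous_map (gtop G) (gtop H) \<phi>"
  and hom_proper: "compactin (gtop H) K \<Longrightarrow> compactin (gtop G) {g \<in> carrier G. \<phi> g \<in> K}"
  using hom by (auto simp: hbg_hom_def covering_functor_def groupoid_functor_def)

lemma star_inj: "g \<in> carrier G \<Longrightarrow> g' \<in> carrier G \<Longrightarrow> \<phi> g = \<phi> g' \<Longrightarrow> G.src g = G.src g' \<Longrightarrow> g = g'"
  and star_surj: "e \<in> gids G \<Longrightarrow> h \<in> carrier H \<Longrightarrow> H.src h = \<phi> e \<Longrightarrow> \<exists>g\<in>carrier G. G.src g = e \<and> \<phi> g = h"
  using hom by (simp_all add: hbg_hom_def covering_functor_def)

lemma hom_iv: "g \<in> carrier G \<Longrightarrow> \<phi> (ginv G g) = ginv H (\<phi> g)"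
  by (rule sym, rule H.inv_eqI) (auto simp flip: hom_src hom_tgt hom_comp)

lemma star_inj_tgt:
  assumes "g \<in> carrier G" "g' \<in> carrier G" "\<phi> g = \<phi> g'" "G.tgt g = G.tgt g'" shows "g = g'"
proof -
  have "ginv G g = ginv G g'" by (rule star_inj) (use assms in \<open>simp_all add: hom_iv\<close>)
  then show ?thesis using assms by (metis G.iv_iv)
qed

abbreviation pre where "pre B \<equiv> {g \<in> carrier G. \<phi> g \<in> B}"

text \<open>Properness gives compactness and continuity gives openness. Injectivity of the source
  and the target comes from the bisection downstairs together with star-injectivity.\<close>

lemma pre_KB: assumes B: "B \<in> H.KB" shows "pre B \<in> G.KB"
proof (rule G.KB_I)
  show "compactin (gtop G) (pre B)" using hom_proper H.KB_D(1)[OF B] .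
  show "openin (gtop G) (pre B)"
    using openin_continuous_map_preimage[OF hom_continuous H.KB_D(2)[OF B]] by simp
  show "inj_on G.src (pre B)"
  proof (rule inj_onI)
    fix g g' assume *: "g \<in> pre B" "g' \<in> pre B" "G.src g = G.src g'"
    then have "H.src (\<phi> g) = H.src (\<phi> g')" by (simp flip: hom_src)
    then have "\<phi> g = \<phi> g'" using * H.KB_inj[OF B] by blast
    then show "g = g'" using * star_inj by blast
  qed
  show "inj_on G.tgt (pre B)"
  proof (rule inj_onI)
    fix g g' assume *: "g \<in> pre B" "g' \<in> pre B" "G.tgt g = G.tgt g'"
    then have "H.tgt (\<phi> g) = H.tgt (\<phi> g')" by (simp flip: hom_tgt)
    then have "\<phi> g = \<phi> g'" using * H.KB_inj[OF B] by blast
    then show "g = g'" using * star_inj_tgt by blast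
  qed
qed

text \<open>Star-surjectivity is what allows a factorisation of \<open>\<phi> g\<close> to be lifted
  to a factorisation of \<open>g\<close>.\<close>

lemma pre_mult:
  assumes A: "A \<in> H.KB" and B: "B \<in> H.KB"
  shows "pre (gset_mult H A B) = gset_mult G (pre A) (pre B)"
proof
  show "pre (gset_mult H A B) \<subseteq> gset_mult G (pre A) (pre B)"
  proof
    fix g assume "g \<in> pre (gset_mult H A B)"
    then obtain a b where *: "g \<in> carrier G" "a \<in> A" "b \<in> B" "H.src a = H.tgt b" "\<phi> g = gcomp H a b"
      by (auto simp: H.mem_gset_mult)
    have cl: "a \<in> carrier H" "b \<in> carrier H" using * A B by auto
    have "H.src b = \<phi> (G.src g)" using * cl by (simp add: hom_src)
    \<comment> \<open>The right factor \<open>b\<close> is lifted to an arrow \<open>y\<close> with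
      the source of \<open>g\<close>; the left factor must then be \<open>g\<close> composed with
      the inverse of \<open>y\<close>.\<close>
    then obtain y where y: "y \<in> carrier G" "G.src y = G.src g" "\<phi> y = b"
      using star_surj[of "G.src g" b] * cl by auto
    define x where "x = gcomp G g (ginv G y)"
    have x: "x \<in> carrier G" "G.src x = G.tgt y" "g = gcomp G x y"
      using * y by (simp_all add: x_def)
    have "\<phi> x = a" unfolding x_def using * y cl by (simp add: hom_comp hom_iv)
    then show "g \<in> gset_mult G (pre A) (pre B)" unfolding G.mem_gset_mult using * x y by blast
  qed
  show "gset_mult G (pre A) (pre B) \<subseteq> pre (gset_mult H A B)"
  proof
    fix x assume "x \<in> gset_mult G (pre A) (pre B)"
    then obtain a b where *: "a \<in> pre A" "b \<in> pre B" "G.src a = G.tgt b" "x = gcomp G a b"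
      by (auto simp: G.mem_gset_mult)
    then have "\<phi> x = gcomp H (\<phi> a) (\<phi> b)" "H.src (\<phi> a) = H.tgt (\<phi> b)" by (auto simp: hom_comp simp flip: hom_src hom_tgt)
    then show "x \<in> pre (gset_mult H A B)" using * unfolding H.mem_gset_mult by auto
  qed
qed

lemma kb_map_apply [simp]: "B \<in> H.KB \<Longrightarrow> kb_map G H \<phi> B = pre B"
  by (simp add: kb_map_def)

text \<open>If \<open>\<phi> g\<close> is an identity, then \<open>g\<close> and its source have the
  same image and the same source, so star-injectivity identifies them.\<close>

lemma pre_gids: "B \<in> H.KB \<Longrightarrow> B \<subseteq> gids H \<Longrightarrow> pre B \<subseteq> gids G"
  using star_inj[of "G.src _"] by (fastforce simp: G.gids_iff H.gids_iff hom_src)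

text \<open>Ultrafilters are points, so this shows that preimages of ultrafilters are ultrafilters;
  it also yields the naturality of the groupoid unit.\<close>

lemma pre_pt: "g \<in> carrier G \<Longrightarrow> {B \<in> H.KB. kb_map G H \<phi> B \<in> G.pt g} = H.pt (\<phi> g)"
  by (rule Collect_cong, rule conj_cong[OF refl]) (simp add: pre_KB)

lemma kb_map_hom: "kb_map G H \<phi> \<in> bim_hom H.KS G.KS"
  unfolding bim_hom_def
proof (intro CollectI conjI ballI)
  show "kb_map G H \<phi> \<in> H.KB \<rightarrow>\<^sub>E G.KB" using pre_KB by (auto simp: kb_map_def)
  show "boolean_inverse_meet_semigroup H.KS" "boolean_inverse_meet_semigroup G.KS"
    by (rule H.boolean_inverse_meet_semigroup_KB G.boolean_inverse_meet_semigroup_KB)+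
  show "kb_map G H \<phi> (zero H.KS) = zero G.KS" by simp
next
  fix A B assume AB: "A \<in> H.KB" "B \<in> H.KB"
  show "kb_map G H \<phi> (A \<cdot>\<^bsub>H.KS\<^esub> B) = kb_map G H \<phi> A \<cdot>\<^bsub>G.KS\<^esub> kb_map G H \<phi> B"
    using AB pre_mult H.KB_mult by simp
  show "kb_map G H \<phi> (A \<sqinter>\<^bsub>nat_order H.KS\<^esub> B) = kb_map G H \<phi> A \<sqinter>\<^bsub>nat_order G.KS\<^esub> kb_map G H \<phi> B"
    using AB by (auto simp: H.KB_meet G.KB_meet H.KB_Int pre_KB)
next
  fix A B assume "A \<in> idems H.KS" "B \<in> idems H.KS"
  then have AB: "A \<in> H.KB" "B \<in> H.KB" "A \<subseteq> gids H" "B \<subseteq> gids H" by (auto simp: H.KB_idems)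
  have P: "pre A \<in> G.KB" "pre B \<in> G.KB" "pre A \<subseteq> gids G" "pre B \<subseteq> gids G" using AB pre_KB pre_gids by blast+
  show "kb_map G H \<phi> (A \<sqinter>\<^bsub>idem_order H.KS\<^esub> B) = kb_map G H \<phi> A \<sqinter>\<^bsub>idem_order G.KS\<^esub> kb_map G H \<phi> B"
    unfolding H.KB_idem_meet[OF AB] using AB G.KB_idem_meet[OF P] H.KB_Int by auto
  show "kb_map G H \<phi> (A \<squnion>\<^bsub>idem_order H.KS\<^esub> B) = kb_map G H \<phi> A \<squnion>\<^bsub>idem_order G.KS\<^esub> kb_map G H \<phi> B"
    unfolding H.KB_idem_join[OF AB] using AB G.KB_idem_join[OF P] H.KB_Un_gids[OF AB] by auto
next
  fix F assume "F \<in> ultrafilters G.KS"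
  then obtain g where "g \<in> carrier G" "F = G.pt g" using G.uf_is_pt by auto
  then show "{B \<in> H.KB. kb_map G H \<phi> B \<in> F} \<in> ultrafilters H.KS"
    using pre_pt H.uf_pt by simp
qed

end

section \<open>Isomorphisms and composites\<close>

text \<open>Order, idempotents, meets, joins, zero and ultrafilters are all determined by the
  multiplication, so these assumptions suffice for an isomorphism. Both the identity morphism and
  the semigroup unit are instances.\<close>

locale bim_bijection = S: bim S + T: bim T
  for S :: "'a zero_semigroup" and T :: "'b zero_semigroup" +
  fixes f :: "'a \<Rightarrow> 'b"
  assumes ext: "f \<in> extensional (carrier S)"
    and bij: "bij_betw f (carrier S) (carrier T)"
    and mult: "s \<in> carrier S \<Longrightarrow> t \<in> carrier S \<Longrightarrow> f (s \<cdot>\<^bsub>S\<^esub> t) = f s \<cdot>\<^bsub>T\<^esub> f t"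
begin

definition g where "g = restrict (inv_into (carrier S) f) (carrier T)"

lemma f_closed [simp]: "s \<in> carrier S \<Longrightarrow> f s \<in> carrier T"
  and g_closed [simp]: "t \<in> carrier T \<Longrightarrow> g t \<in> carrier S"
  and gf [simp]: "s \<in> carrier S \<Longrightarrow> g (f s) = s"
  and fg [simp]: "t \<in> carrier T \<Longrightarrow> f (g t) = t"
  using bij by (auto simp: g_def bij_betw_def inv_into_into f_inv_into_f)

lemma f_inj: "s \<in> carrier S \<Longrightarrow> t \<in> carrier S \<Longrightarrow> f s = f t \<Longrightarrow> s = t"
  by (metis gf)

lemma inverse_bijection: "bim_bijection T S g"
proof unfold_locales
  show "g \<in> extensional (carrier T)" by (simp add: g_def)
  show "bij_betw g (carrier T) (carrier S)" by (rule bij_betwI[of _ _ _ f]) auto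
  fix s t assume "s \<in> carrier T" "t \<in> carrier T"
  then show "g (s \<cdot>\<^bsub>T\<^esub> t) = g s \<cdot>\<^bsub>S\<^esub> g t" by (intro f_inj) (simp_all add: mult)
qed

lemma f_idem_iff: "s \<in> carrier S \<Longrightarrow> f s \<in> idems T \<longleftrightarrow> s \<in> idems S"
  by (metis S.idemI S.idem_idem S.mult_closed T.idemI T.idem_idem f_closed f_inj mult)

lemma f_le_iff:
  assumes "s \<in> carrier S" "t \<in> carrier S" shows "nat_le T (f s) (f t) \<longleftrightarrow> nat_le S s t"
proof
  assume "nat_le T (f s) (f t)"
  then obtain e where e: "e \<in> idems T" "f s = f t \<cdot>\<^bsub>T\<^esub> e" by (auto simp: nat_le_def)
  then have c: "g e \<in> carrier S" "f (g e) = e" by auto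
  then have "g e \<in> idems S" using e f_idem_iff by metis
  moreover have "s = t \<cdot>\<^bsub>S\<^esub> g e" using e c assms by (intro f_inj) (simp_all add: mult)
  ultimately show "nat_le S s t" by (auto simp: nat_le_def)
next
  assume "nat_le S s t"
  then obtain e where "e \<in> idems S" "s = t \<cdot>\<^bsub>S\<^esub> e" by (auto simp: nat_le_def)
  then have "f e \<in> idems T" "f s = f t \<cdot>\<^bsub>T\<^esub> f e" using assms by (simp_all add: f_idem_iff mult)
  then show "nat_le T (f s) (f t)" by (auto simp: nat_le_def)
qed

lemma f_le_g: "s \<in> carrier S \<Longrightarrow> z \<in> carrier T \<Longrightarrow> nat_le T z (f s) \<longleftrightarrow> nat_le S (g z) s"
  and f_ge_g: "s \<in> carrier S \<Longrightarrow> z \<in> carrier T \<Longrightarrow> nat_le T (f s) z \<longleftrightarrow> nat_le S s (g z)"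
  using f_le_iff[of "g z" s] f_le_iff[of s "g z"] by simp_all

text \<open>Zero absorbs the preimage \<open>g (zero T)\<close>, and its image is absorbed by
  \<open>zero T\<close>.\<close>

lemma f_zero: "f (zero S) = zero T"
proof -
  have "f (zero S) = f (zero S \<cdot>\<^bsub>S\<^esub> g (zero T))" by simp
  also have "\<dots> = zero T" by (subst mult) auto
  finally show ?thesis .
qed

lemma preimage_filter:
  assumes F: "sg_filter T F" shows "sg_filter S {s \<in> carrier S. f s \<in> F}"
  unfolding sg_filter_def
proof (intro conjI ballI impI)
  obtain t where t: "t \<in> F" "t \<in> carrier T" using T.filter_nonempty[OF F] T.filter_subset[OF F] by blast
  then have "g t \<in> {s \<in> carrier S. f s \<in> F}" by simp
  then show "{s \<in> carrier S. f s \<in> F} \<noteq> {}" by blast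
  show "zero S \<notin> {s \<in> carrier S. f s \<in> F}" using T.filter_zero[OF F] by (simp add: f_zero)
  fix x y
  show "y \<in> {s \<in> carrier S. f s \<in> F}"
    if "x \<in> {s \<in> carrier S. f s \<in> F}" "y \<in> carrier S" "nat_le S x y"
    using that T.filter_up[OF F, of "f x" "f y"] f_le_iff by simp
  assume xy: "x \<in> {s \<in> carrier S. f s \<in> F}" "y \<in> {s \<in> carrier S. f s \<in> F}"
  then obtain z where z: "z \<in> F" "nat_le T z (f x)" "nat_le T z (f y)" using T.filter_dir[OF F] by blast
  then have zT: "z \<in> carrier T" using T.filter_subset[OF F] by blast
  have "g z \<in> {s \<in> carrier S. f s \<in> F}" "nat_le S (g z) x" "nat_le S (g z) y"
    using z zT xy f_le_g by simp_all
  then show "\<exists>z\<in>{s \<in> carrier S. f s \<in> F}. nat_le S z x \<and> nat_le S z y" by blast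
qed simp

text \<open>A filter \<open>H\<close> above the preimage of \<open>F\<close> is pulled back along
  the inverse bijection to a filter above \<open>F\<close>, where maximality applies.\<close>

lemma preimage_ultrafilter:
  assumes F: "T.uf F" shows "S.uf {s \<in> carrier S. f s \<in> F}"
  unfolding sg_ultrafilter_def
proof (intro conjI allI impI)
  have f: "sg_filter T F" using F by (rule T.uf_filter)
  show "sg_filter S {s \<in> carrier S. f s \<in> F}" using preimage_filter[OF f] .
  interpret I: bim_bijection T S g by (rule inverse_bijection)
  fix H assume H: "sg_filter S H \<and> {s \<in> carrier S. f s \<in> F} \<subseteq> H"
  have "F \<subseteq> {t \<in> carrier T. g t \<in> H}"
  proof
    fix t assume t: "t \<in> F"
    then have tT: "t \<in> carrier T" using T.filter_subset[OF f] by blast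
    then have "g t \<in> {s \<in> carrier S. f s \<in> F}" using t by simp
    then show "t \<in> {t \<in> carrier T. g t \<in> H}" using H tT by blast
  qed
  then have eq: "{t \<in> carrier T. g t \<in> H} = F"
    using F I.preimage_filter H unfolding sg_ultrafilter_def by blast
  have "H \<subseteq> {s \<in> carrier S. f s \<in> F}"
  proof
    fix s assume s: "s \<in> H"
    then have sS: "s \<in> carrier S" using H S.filter_subset by blast
    then have "f s \<in> {t \<in> carrier T. g t \<in> H}" using s by simp
    then show "s \<in> {s \<in> carrier S. f s \<in> F}" using eq sS by simp
  qed
  then show "H = {s \<in> carrier S. f s \<in> F}" using H by blast
qed

lemma f_hom: "f \<in> bim_hom S T"
  unfolding bim_hom_def
proof (intro CollectI conjI ballI)
  show "f \<in> carrier S \<rightarrow>\<^sub>E carrier T" using ext by (auto simp: PiE_iff)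
  show "boolean_inverse_meet_semigroup S" "boolean_inverse_meet_semigroup T" by (rule S.bim T.bim)+
  show "f (zero S) = zero T" by (rule f_zero)
  show "{s \<in> carrier S. f s \<in> F} \<in> ultrafilters S" if "F \<in> ultrafilters T" for F
    using that preimage_ultrafilter by simp
next
  fix s t assume st: "s \<in> carrier S" "t \<in> carrier S"
  show "f (s \<cdot>\<^bsub>S\<^esub> t) = f s \<cdot>\<^bsub>T\<^esub> f t" using st by (rule mult)
  show "f (s \<sqinter>\<^bsub>nat_order S\<^esub> t) = f s \<sqinter>\<^bsub>nat_order T\<^esub> f t"
    by (rule sym, rule partial_order.meet_eqI[OF T.nat_order_partial_order])
      (use st in \<open>simp_all add: f_le_iff f_le_g S.le_meet\<close>)
next
  fix e d assume ed: "e \<in> idems S" "d \<in> idems S"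
  then have c: "e \<in> carrier S" "d \<in> carrier S" "f e \<in> idems T" "f d \<in> idems T" by (simp_all add: f_idem_iff)
  show "f (e \<sqinter>\<^bsub>idem_order S\<^esub> d) = f e \<sqinter>\<^bsub>idem_order T\<^esub> f d"
    using ed c by (simp add: S.idem_meet T.idem_meet mult)
  interpret L: lattice "idem_order S"
    using S.idem_gen_boolean_algebra by (simp add: gen_boolean_algebra_def)
  define j where "j = e \<squnion>\<^bsub>idem_order S\<^esub> d"
  have j: "j \<in> idems S" "nat_le S e j" "nat_le S d j"
    using L.join_closed[of e d] L.join_left[of e d] L.join_right[of e d] ed by (simp_all add: j_def)
  have least: "nat_le S j z" if "z \<in> idems S" "nat_le S e z" "nat_le S d z" for z
    using L.join_le[of e z d] ed that by (simp add: j_def)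
  have "f e \<squnion>\<^bsub>idem_order T\<^esub> f d = f j"
  proof (rule partial_order.join_eqI[OF T.idem_order_partial_order], unfold idem_order_simps)
    fix z assume z: "z \<in> idems T" "nat_le T (f e) z" "nat_le T (f d) z"
    then have zT: "z \<in> carrier T" "g z \<in> carrier S" by simp_all
    then have "g z \<in> idems S" using f_idem_iff[of "g z"] z by simp
    then have "nat_le S j (g z)" using z zT c least by (simp add: f_ge_g)
    then show "nat_le T (f j) z" using zT j by (simp add: f_ge_g)
  qed (use c j in \<open>simp_all add: f_idem_iff f_le_iff\<close>)
  then show "f (e \<squnion>\<^bsub>idem_order S\<^esub> d) = f e \<squnion>\<^bsub>idem_order T\<^esub> f d" by (simp add: j_def)
qed

lemma f_iso: "bim_iso S T f"
proof -
  interpret I: bim_bijection T S g by (rule inverse_bijection)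
  have "compose (carrier S) g f = (\<lambda>s\<in>carrier S. s)" "compose (carrier T) f g = (\<lambda>t\<in>carrier T. t)"
    by (auto simp: compose_def restrict_def)
  then show ?thesis unfolding bim_iso_def using f_hom I.f_hom by blast
qed

end

section \<open>Identities and composites of morphisms\<close>

lemma id_bim_hom:
  assumes "boolean_inverse_meet_semigroup S" shows "(\<lambda>s\<in>carrier S. s) \<in> bim_hom S S"
proof -
  interpret bim S by unfold_locales (rule assms)
  interpret bim_bijection S S "\<lambda>s\<in>carrier S. s"
    by unfold_locales (auto simp: bij_betw_def inj_on_def)
  show ?thesis by (rule f_hom)
qed

lemma bim_morphismI: "\<theta> \<in> bim_hom S T \<Longrightarrow> bim_morphism S T \<theta>"
  by unfold_locales (auto simp: bim_hom_def)

lemma compose_bim_hom: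
  assumes \<theta>: "\<theta> \<in> bim_hom S T" and \<psi>: "\<psi> \<in> bim_hom T U"
  shows "compose (carrier S) \<psi> \<theta> \<in> bim_hom S U"
proof -
  interpret A: bim_morphism S T \<theta> using \<theta> by (rule bim_morphismI)
  interpret B: bim_morphism T U \<psi> using \<psi> by (rule bim_morphismI)
  have idem: "\<theta> e \<in> idems T" if "e \<in> idems S" for e
    using that A.hom_mult[of e e] by (intro A.T.idemI) auto
  interpret L: lattice "idem_order S"
    using A.S.idem_gen_boolean_algebra by (simp add: gen_boolean_algebra_def)
  \<comment> \<open>The map \<open>compose\<close> is \<open>undefined\<close> off the carrier, so
    it can be unfolded at a join only once the join is known to lie there.\<close>
  have join_closed: "e \<squnion>\<^bsub>idem_order S\<^esub> d \<in> carrier S" if "e \<in> idems S" "d \<in> idems S" for e d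
    using L.join_closed[of e d] that by simp
  have uf: "{s \<in> carrier S. compose (carrier S) \<psi> \<theta> s \<in> F} \<in> ultrafilters S" if F: "F \<in> ultrafilters U" for F
  proof -
    have "{s \<in> carrier S. compose (carrier S) \<psi> \<theta> s \<in> F} = {s \<in> carrier S. \<theta> s \<in> {t \<in> carrier T. \<psi> t \<in> F}}"
      by (auto simp: compose_def)
    then show ?thesis using F A.preimage_ultrafilter[OF B.preimage_ultrafilter, of F] by simp
  qed
  show ?thesis unfolding bim_hom_def
  proof (intro CollectI conjI ballI uf)
    fix e d assume ed: "e \<in> idems S" "d \<in> idems S"
    have "e \<sqinter>\<^bsub>idem_order S\<^esub> d \<in> carrier S" using ed by (simp add: A.S.idem_meet)
    then show "compose (carrier S) \<psi> \<theta> (e \<sqinter>\<^bsub>idem_order S\<^esub> d) =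
        compose (carrier S) \<psi> \<theta> e \<sqinter>\<^bsub>idem_order U\<^esub> compose (carrier S) \<psi> \<theta> d"
      using ed idem by (simp add: compose_def A.hom_idem_meet B.hom_idem_meet A.hom_idem_join B.hom_idem_join)
    show "compose (carrier S) \<psi> \<theta> (e \<squnion>\<^bsub>idem_order S\<^esub> d) =
        compose (carrier S) \<psi> \<theta> e \<squnion>\<^bsub>idem_order U\<^esub> compose (carrier S) \<psi> \<theta> d"
      using ed idem join_closed[OF ed] by (simp add: compose_def A.hom_idem_meet B.hom_idem_meet A.hom_idem_join B.hom_idem_join)
  qed (use A.S.bim B.T.bim in \<open>simp_all add: compose_def A.hom_zero B.hom_zero A.hom_meet B.hom_meet A.hom_mult B.hom_mult\<close>)
qed

lemma compose_id_bim_hom: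
  assumes "\<theta> \<in> bim_hom S T"
  shows "compose (carrier S) \<theta> (\<lambda>s\<in>carrier S. s) = \<theta>" "compose (carrier S) (\<lambda>t\<in>carrier T. t) \<theta> = \<theta>"
  using assms by (auto intro!: compose_Id Id_compose simp: bim_hom_def PiE_iff)

lemma compose_bim_hom_assoc:
  "\<theta> \<in> bim_hom S T \<Longrightarrow>
    compose (carrier S) (compose (carrier T) \<xi> \<psi>) \<theta> = compose (carrier S) \<xi> (compose (carrier S) \<psi> \<theta>)"
  by (rule compose_assoc[symmetric]) (auto simp: bim_hom_def)

lemma hbg_morphismI: "\<phi> \<in> hbg_hom G H \<Longrightarrow> hbg_morphism G H \<phi>"
  by unfold_locales (auto simp: hbg_hom_def)

lemma homeomorphic_mapsD:
  assumes "homeomorphic_maps X Y f g"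
  shows "x \<in> topspace X \<Longrightarrow> f x \<in> topspace Y" "x \<in> topspace X \<Longrightarrow> g (f x) = x"
    "y \<in> topspace Y \<Longrightarrow> g y \<in> topspace X" "y \<in> topspace Y \<Longrightarrow> f (g y) = y"
    "continuous_map X Y f" "continuous_map Y X g"
  using assms unfolding homeomorphic_maps_def by (auto dest: continuous_map_funspace)

text \<open>Star-injectivity is plain injectivity, the lift of \<open>h\<close> is
  \<open>g h\<close>, and preimages of compact sets are their images under the continuous
  inverse.\<close>

lemma homeomorphism_hbg_hom:
  assumes G: "hausdorff_boolean_groupoid G" and H: "hausdorff_boolean_groupoid H"
    and ext: "f \<in> extensional (carrier G)" and homeo: "homeomorphic_maps (gtop G) (gtop H) f g"
    and func: "groupoid_functor G H f"
  shows "f \<in> hbg_hom G H"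
proof -
  interpret G: hbg G by unfold_locales (rule G)
  interpret H: hbg H by unfold_locales (rule H)
  note maps = homeomorphic_mapsD[OF homeo, unfolded G.topspace_T H.topspace_T]
  have cover: "covering_functor G H f"
    unfolding covering_functor_def
  proof (intro conjI ballI impI func)
    show "x = y" if "x \<in> carrier G" "y \<in> carrier G" "f x = f y \<and> G.src x = G.src y" for x y
      using that maps(2) by metis
    fix e h assume e: "e \<in> gids G" and h: "h \<in> carrier H" and he: "H.src h = f e"
    have c: "g h \<in> carrier G" "f (g h) = h" using maps h by auto
    then have "f (G.src (g h)) = f e" using func he by (simp add: groupoid_functor_def)
    then have "G.src (g h) = e" using maps(2) c e by (metis G.gids_iff G.unit_laws(1))
    then show "\<exists>x\<in>carrier G. G.src x = e \<and> f x = h" using c by blast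
  qed
  have proper: "compactin (gtop G) {x \<in> carrier G. f x \<in> K}" if K: "compactin (gtop H) K" for K
  proof -
    have "K \<subseteq> carrier H" using compactin_subset_topspace[OF K] by simp
    then have "{x \<in> carrier G. f x \<in> K} = g ` K" using maps by (auto simp: image_iff subset_iff) metis
    then show ?thesis using image_compactin[OF K maps(6)] by simp
  qed
  show ?thesis unfolding hbg_hom_def
    using ext maps G H cover proper by (auto simp: PiE_iff)
qed

lemma homeomorphism_hbg_iso:
  assumes G: "hausdorff_boolean_groupoid G" and H: "hausdorff_boolean_groupoid H"
    and ext: "f \<in> extensional (carrier G)" and homeo: "homeomorphic_map (gtop G) (gtop H) f"
    and func: "groupoid_functor G H f"
  shows "hbg_iso G H f"
proof -
  interpret G: hbg G by unfold_locales (rule G)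
  interpret H: hbg H by unfold_locales (rule H)
  obtain g0 where g0: "homeomorphic_maps (gtop G) (gtop H) f g0" using homeo by (auto simp: homeomorphic_map_maps)
  \<comment> \<open>Arrows are extensional, whereas the inverse supplied by the homeomorphism is
    arbitrary off the carrier.\<close>
  define g where "g = restrict g0 (carrier H)"
  have fg: "homeomorphic_maps (gtop G) (gtop H) f g"
    by (rule homeomorphic_maps_eq[OF g0]) (auto simp: g_def)
  then have gf: "homeomorphic_maps (gtop H) (gtop G) g f" by (rule iffD1[OF homeomorphic_maps_sym])
  note maps = homeomorphic_mapsD[OF fg, unfolded G.topspace_T H.topspace_T]
  have f_src: "f (G.src x) = H.src (f x)" "f (G.tgt x) = H.tgt (f x)" if "x \<in> carrier G" for x
    using func that by (simp_all add: groupoid_functor_def)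
  have f_comp: "f (gcomp G x y) = gcomp H (f x) (f y)" if "x \<in> carrier G" "y \<in> carrier G" "G.src x = G.tgt y" for x y
    using func that by (simp add: groupoid_functor_def)
  have g_src: "g (H.src y) = G.src (g y)" "g (H.tgt y) = G.tgt (g y)" if "y \<in> carrier H" for y
    using that maps(2)[of "G.src (g y)"] maps(2)[of "G.tgt (g y)"] maps by (simp_all add: f_src)
  have "groupoid_functor H G g"
    unfolding groupoid_functor_def
  proof (intro conjI ballI impI)
    show "g (gcomp H x y) = gcomp G (g x) (g y)" if "x \<in> carrier H" "y \<in> carrier H" "H.src x = H.tgt y" for x y
    proof -
      have "G.src (g x) = G.tgt (g y)" using that by (simp flip: g_src)
      then show ?thesis using that maps maps(2)[of "gcomp G (g x) (g y)"] by (simp add: f_comp)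
    qed
  qed (use maps g_src in auto)
  then have "g \<in> hbg_hom H G" by (intro homeomorphism_hbg_hom[OF H G _ gf]) (simp_all add: g_def)
  moreover have "f \<in> hbg_hom G H" by (rule homeomorphism_hbg_hom[OF G H ext fg func])
  moreover have "compose (carrier G) g f = (\<lambda>x\<in>carrier G. x)" "compose (carrier H) f g = (\<lambda>y\<in>carrier H. y)"
    using maps by (auto simp: compose_def restrict_def)
  ultimately show ?thesis unfolding hbg_iso_def by blast
qed

lemma id_hbg_hom:
  assumes "hausdorff_boolean_groupoid G" shows "(\<lambda>g\<in>carrier G. g) \<in> hbg_hom G G"
proof -
  interpret hbg G by unfold_locales (rule assms)
  have "homeomorphic_maps (gtop G) (gtop G) id id" by (simp add: homeomorphic_maps_id)
  then have "homeomorphic_maps (gtop G) (gtop G) (\<lambda>g\<in>carrier G. g) (\<lambda>g\<in>carrier G. g)"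
    by (rule homeomorphic_maps_eq) auto
  moreover have "groupoid_functor G G (\<lambda>g\<in>carrier G. g)" by (auto simp: groupoid_functor_def)
  ultimately show ?thesis by (intro homeomorphism_hbg_hom assms) auto
qed

lemma compose_hbg_hom:
  assumes \<theta>: "\<theta> \<in> hbg_hom G H" and \<psi>: "\<psi> \<in> hbg_hom H K"
  shows "compose (carrier G) \<psi> \<theta> \<in> hbg_hom G K"
proof -
  interpret A: hbg_morphism G H \<theta> using \<theta> by (rule hbg_morphismI)
  interpret B: hbg_morphism H K \<psi> using \<psi> by (rule hbg_morphismI)
  have "covering_functor G K (compose (carrier G) \<psi> \<theta>)"
    unfolding covering_functor_def groupoid_functor_def
  proof (intro conjI ballI impI)
    fix g h assume "g \<in> carrier G" "h \<in> carrier G" and gh: "A.G.src g = A.G.tgt h"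
    moreover from this have "A.H.src (\<theta> g) = A.H.tgt (\<theta> h)" by (simp flip: A.hom_src A.hom_tgt)
    ultimately show "compose (carrier G) \<psi> \<theta> (gcomp G g h) =
        gcomp K (compose (carrier G) \<psi> \<theta> g) (compose (carrier G) \<psi> \<theta> h)"
      by (simp add: compose_def A.hom_comp B.hom_comp)
  next
    fix g h assume g: "g \<in> carrier G" "h \<in> carrier G"
      and *: "compose (carrier G) \<psi> \<theta> g = compose (carrier G) \<psi> \<theta> h \<and> A.G.src g = A.G.src h"
    then have "A.H.src (\<theta> g) = A.H.src (\<theta> h)" by (simp flip: A.hom_src)
    then have "\<theta> g = \<theta> h" using * g B.star_inj[of "\<theta> g" "\<theta> h"] by (simp add: compose_def)
    then show "g = h" using A.star_inj[OF g] * by simp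
  next
    fix e k assume e: "e \<in> gids G" and k: "k \<in> carrier K" "B.H.src k = compose (carrier G) \<psi> \<theta> e"
    have eG: "e \<in> carrier G" "A.G.src e = e" using e by (simp_all add: A.G.gids_iff)
    then have "\<theta> e \<in> gids H" using A.hom_src[of e] by (simp add: A.H.gids_iff)
    then obtain h where h: "h \<in> carrier H" "A.H.src h = \<theta> e" "\<psi> h = k"
      using B.star_surj[of "\<theta> e" k] k eG by (auto simp: compose_def)
    then obtain g where "g \<in> carrier G" "A.G.src g = e" "\<theta> g = h" using A.star_surj[OF e] by blast
    then show "\<exists>g\<in>carrier G. A.G.src g = e \<and> compose (carrier G) \<psi> \<theta> g = k"
      using h by (auto simp: compose_def)
  qed (simp_all add: compose_def A.hom_src A.hom_tgt B.hom_src B.hom_tgt)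
  moreover have "continuous_map (gtop G) (gtop K) (compose (carrier G) \<psi> \<theta>)"
    using continuous_map_compose[OF A.hom_continuous B.hom_continuous]
    by (rule continuous_map_eq) (simp add: compose_def)
  moreover have "compactin (gtop G) {g \<in> carrier G. compose (carrier G) \<psi> \<theta> g \<in> C}" if C: "compactin (gtop K) C" for C
  proof -
    have "{g \<in> carrier G. compose (carrier G) \<psi> \<theta> g \<in> C} = {g \<in> carrier G. \<theta> g \<in> {h \<in> carrier H. \<psi> h \<in> C}}"
      by (auto simp: compose_def)
    then show ?thesis using A.hom_proper[OF B.hom_proper[OF C]] by simp
  qed
  ultimately show ?thesis
    unfolding hbg_hom_def using A.G.hbg B.H.hbg by (auto simp: compose_def)
qed

lemma compose_id_hbg_hom:
  assumes "\<theta> \<in> hbg_hom G H"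
  shows "compose (carrier G) \<theta> (\<lambda>g\<in>carrier G. g) = \<theta>" "compose (carrier G) (\<lambda>h\<in>carrier H. h) \<theta> = \<theta>"
  using assms by (auto intro!: compose_Id Id_compose simp: hbg_hom_def PiE_iff)

lemma compose_hbg_hom_assoc:
  "\<theta> \<in> hbg_hom G H \<Longrightarrow>
    compose (carrier G) (compose (carrier H) \<xi> \<psi>) \<theta> = compose (carrier G) \<xi> (compose (carrier G) \<psi> \<theta>)"
  by (rule compose_assoc[symmetric]) (auto simp: hbg_hom_def)

section \<open>The two units\<close>

context bim
begin

lemma hbg_UG: "hbg UG"
  by unfold_locales (rule hausdorff_boolean_uf_groupoid)

lemma V_KB: "s \<in> carrier S \<Longrightarrow> V s \<in> carrier (kb_semigroup UG)"
  by (simp add: kb_semigroup_def compactin_V openin_V V_local_bisection)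

text \<open>Compactness writes \<open>\<A>\<close> as a finite union of sets \<open>V s\<close>
  contained in it. For two such elements \<open>s\<close> and \<open>t\<close>, the sets
  \<open>V (s\<star> \<cdot> t)\<close> and \<open>V (s \<cdot> t\<star>)\<close> lie in products of
  \<open>\<A>\<close> with its inverse, hence among the identities. So the elements are compatible,
  and their join represents the union.\<close>

lemma KB_is_V:
  assumes A: "\<A> \<in> carrier (kb_semigroup UG)" shows "\<exists>s\<in>carrier S. \<A> = V s"
proof -
  have comp: "compactin UT \<A>" and op: "openin UT \<A>" and bis: "local_bisection UG \<A>"
    using A by (simp_all add: kb_semigroup_def)
  define \<V> where "\<V> = V ` {s \<in> carrier S. V s \<subseteq> \<A>}"
  have "\<A> \<subseteq> \<Union>\<V>" using op unfolding openin_UT_iff \<V>_def by blast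
  moreover have "\<forall>U\<in>\<V>. openin UT U" by (auto simp: \<V>_def openin_V)
  ultimately obtain \<F> where F: "finite \<F>" "\<F> \<subseteq> \<V>" "\<A> \<subseteq> \<Union>\<F>" using comp unfolding compactin_def by meson
  then obtain C where C: "finite C" "C \<subseteq> {s \<in> carrier S. V s \<subseteq> \<A>}" "\<F> = V ` C"
    unfolding \<V>_def by (meson finite_subset_image)
  have eq: "\<A> = \<Union>(V ` C)" using F C by blast
  show ?thesis
  proof (cases "C = {}")
    \<comment> \<open>Joins are provided for nonempty sets only; the empty bisection is represented
      by zero.\<close>
    case True
    then show ?thesis using eq by (intro bexI[of _ "zero S"]) auto
  next
    case False
    have compat: "compatible S s t" if st: "s \<in> C" "t \<in> C" for s t
    proof -
      have c: "s \<in> carrier S" "t \<in> carrier S" "V s \<subseteq> \<A>" "V t \<subseteq> \<A>" using st C by auto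
      have inv: "V (u\<star>) \<subseteq> ginv UG ` \<A>" if "u \<in> carrier S" "V u \<subseteq> \<A>" for u
      proof -
        have "V (u\<star>) = ginv UG ` V u" unfolding V_inv[OF that(1), symmetric]
          by (rule image_cong) (auto simp: mem_V uf_ginv)
        then show ?thesis using that by blast
      qed
      have mono: "gset_mult UG A B \<subseteq> gset_mult UG A' B'" if "A \<subseteq> A'" "B \<subseteq> B'" for A B A' B'
        using that unfolding gset_mult_def by blast
      have "V (s\<star> \<cdot> t) \<subseteq> gids UG"
        using mono[OF inv[OF c(1,3)] c(4)] bis V_mult[of "s\<star>" t] c unfolding local_bisection_def by auto
      moreover have "V (s \<cdot> t\<star>) \<subseteq> gids UG"
        using mono[OF c(3) inv[OF c(2,4)]] bis V_mult[of s "t\<star>"] c unfolding local_bisection_def by auto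
      ultimately show ?thesis using c V_gids_iff by (simp add: compatible_def)
    qed
    have CS: "C \<subseteq> carrier S" using C by auto
    obtain j where j: "is_join S C j" using joins_exist(1)[OF C(1) False CS compat] by blast
    then have "j \<in> carrier S" using CS by (simp add: is_join_iff)
    moreover have "\<A> = V j" using V_join[OF C(1) False CS compat j] eq by simp
    ultimately show ?thesis by blast
  qed
qed

text \<open>Injectivity is the separation property, surjectivity is \<open>KB_is_V\<close> and
  multiplicativity is \<open>V_mult\<close>.\<close>

lemma bim_unit_iso: "bim_iso S (kb_semigroup UG) (bim_unit S)"
proof -
  interpret UGH: hbg UG by (rule hbg_UG)
  interpret bim_bijection S "kb_semigroup UG" "bim_unit S"
  proof unfold_locales
    show "bim_unit S \<in> extensional (carrier S)" by (simp add: bim_unit_def)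
    show "bij_betw (bim_unit S) (carrier S) (carrier (kb_semigroup UG))"
      unfolding bij_betw_def
    proof (intro conjI inj_onI subset_antisym subsetI)
      show "s = t" if "s \<in> carrier S" "t \<in> carrier S" "bim_unit S s = bim_unit S t" for s t
        using that V_inj by (simp add: bim_unit_def)
      show "\<A> \<in> carrier (kb_semigroup UG)" if "\<A> \<in> bim_unit S ` carrier S" for \<A>
        using that V_KB by (auto simp: bim_unit_def)
      show "\<A> \<in> bim_unit S ` carrier S" if "\<A> \<in> carrier (kb_semigroup UG)" for \<A>
        using KB_is_V[OF that] by (auto simp: bim_unit_def)
    qed
    show "bim_unit S (s \<cdot> t) = bim_unit S s \<cdot>\<^bsub>kb_semigroup UG\<^esub> bim_unit S t" if "s \<in> carrier S" "t \<in> carrier S" for s t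
      using that V_mult by (simp add: bim_unit_def)
  qed
  show ?thesis by (rule f_iso)
qed

end

lemma (in bim_morphism) bim_unit_natural:
  "compose (carrier S) (kb_map T.UG S.UG (uf_map S T \<theta>)) (bim_unit S) = compose (carrier S) (bim_unit T) \<theta>"
proof (rule ext)
  fix s
  show "compose (carrier S) (kb_map T.UG S.UG (uf_map S T \<theta>)) (bim_unit S) s = compose (carrier S) (bim_unit T) \<theta> s"
    using S.V_KB[of s] vimage_uf_map[of s]
    by (cases "s \<in> carrier S") (simp_all add: compose_def bim_unit_def kb_map_def del: ultrafilters_iff)
qed

context hbg
begin

lemma hbg_unit_apply [simp]: "g \<in> carrier G \<Longrightarrow> hbg_unit G g = pt g"
  by (simp add: hbg_unit_def)

text \<open>Both sides are ultrafilters, so it suffices that every bisection above a domain of some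
  \<open>A\<close> through \<open>g\<close> contains \<open>iv g \<odot> g\<close>.
  \<open>pt_comp\<close> follows the same pattern.\<close>

lemma pt_src: assumes g: "g \<in> carrier G" shows "KB.fsrc (pt g) = pt (src g)"
proof (rule KB.uf_eqI)
  have P: "KB.uf (pt g)" using uf_pt[OF g] .
  show "KB.uf (KB.fsrc (pt g))" using KB.uf_fsrc[OF P] .
  show "KB.uf (pt (src g))" using g uf_pt by simp
  show "KB.fsrc (pt g) \<subseteq> pt (src g)"
  proof
    fix B assume "B \<in> KB.fsrc (pt g)"
    then obtain A where A: "B \<in> KB" "A \<in> KB" "g \<in> A" "nat_le KS (sg_inv KS A \<cdot>\<^bsub>KS\<^esub> A) B"
      using KB.mem_fsrc[OF filter_pt[OF g]] by blast
    then have "gset_mult G (iv ` A) A \<subseteq> B"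
      using KB_sg_inv[OF A(2)] KB_le_iff[OF KB_mult[OF KB_iv[OF A(2)] A(2)] A(1)] by simp
    moreover have "iv g \<odot> g \<in> gset_mult G (iv ` A) A" using g A by (intro gset_multI) auto
    ultimately show "B \<in> pt (src g)" using A g by auto
  qed
qed

lemma pt_comp:
  assumes g: "g \<in> carrier G" and h: "h \<in> carrier G" and gh: "src g = tgt h"
    and src_eq: "KB.fsrc (pt g) = KB.frng (pt h)"
  shows "KB.fmul (pt g) (pt h) = pt (g \<odot> h)"
proof (rule KB.uf_eqI)
  have P: "KB.uf (pt g)" "KB.uf (pt h)" using uf_pt g h by auto
  show "KB.uf (KB.fmul (pt g) (pt h))" using KB.uf_fmul'[OF P src_eq] .
  show "KB.uf (pt (g \<odot> h))" using g h gh uf_pt by simp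
  show "KB.fmul (pt g) (pt h) \<subseteq> pt (g \<odot> h)"
  proof
    fix C assume "C \<in> KB.fmul (pt g) (pt h)"
    then obtain A B where A: "C \<in> KB" "A \<in> KB" "g \<in> A" "B \<in> KB" "h \<in> B" "nat_le KS (A \<cdot>\<^bsub>KS\<^esub> B) C"
      unfolding KB.mem_fmul by blast
    then have "gset_mult G A B \<subseteq> C" using KB_le_iff[OF KB_mult[OF A(2,4)] A(1)] by simp
    moreover have "g \<odot> h \<in> gset_mult G A B" using A gh by (intro gset_multI)
    ultimately show "C \<in> pt (g \<odot> h)" using A by auto
  qed
qed

lemma pt_inv: assumes g: "g \<in> carrier G" shows "KB.finv (pt g) = pt (iv g)"
proof -
  have sub: "pt g \<subseteq> KB" by auto
  have *: "g \<in> iv ` A \<longleftrightarrow> iv g \<in> A" if A: "A \<in> KB" for A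
  proof
    assume "g \<in> iv ` A"
    then show "iv g \<in> A" using KB_D(4)[OF A] by auto
  next
    assume "iv g \<in> A"
    then have "iv (iv g) \<in> iv ` A" by blast
    then show "g \<in> iv ` A" using g by simp
  qed
  show ?thesis
  proof (rule Set.set_eqI)
    fix A show "A \<in> KB.finv (pt g) \<longleftrightarrow> A \<in> pt (iv g)"
      unfolding KB.mem_finv[OF sub] using *[of A] KB_sg_inv[of A] KB_iv[of A] by auto
  qed
qed

lemma pt_tgt: assumes g: "g \<in> carrier G" shows "KB.frng (pt g) = pt (tgt g)"
proof -
  have "KB.frng (pt g) = KB.fsrc (KB.finv (pt g))" by (rule KB.frng_eq) auto
  also have "\<dots> = pt (tgt g)" unfolding pt_inv[OF g] using pt_src[of "iv g"] g by simp
  finally show ?thesis .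
qed

text \<open>Distinct points have disjoint open neighbourhoods, and a basic bisection inside one of
  them tells the two ultrafilters apart.\<close>

lemma pt_inj: assumes "g \<in> carrier G" "h \<in> carrier G" "pt g = pt h" shows "g = h"
proof (rule ccontr)
  assume "g \<noteq> h"
  then obtain U W where UW: "openin T U" "openin T W" "g \<in> U" "h \<in> W" "disjnt U W"
    using Hausdorff_T assms(1,2) unfolding Hausdorff_space_def topspace_T by blast
  obtain A where A: "A \<in> KB" "g \<in> A" "A \<subseteq> U" using KB_basis UW by blast
  then have "A \<in> pt h" using assms by blast
  then show False using A UW by (auto simp: disjnt_def)
qed

lemma hbg_unit_iso: "hbg_iso G KB.UG (hbg_unit G)"
proof (rule homeomorphism_hbg_iso)
  show "hausdorff_boolean_groupoid G" by (rule hbg)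
  show "hausdorff_boolean_groupoid KB.UG" by (rule KB.hausdorff_boolean_uf_groupoid)
  show "hbg_unit G \<in> extensional (carrier G)" by (simp add: hbg_unit_def)
  show "groupoid_functor G KB.UG (hbg_unit G)"
    unfolding groupoid_functor_def uf_groupoid_simps
  proof (intro conjI ballI impI)
    show "hbg_unit G \<in> carrier G \<rightarrow> ultrafilters KS" using uf_pt by auto
    fix g assume g: "g \<in> carrier G"
    show "hbg_unit G (src g) = KB.fsrc (hbg_unit G g)" "hbg_unit G (tgt g) = KB.frng (hbg_unit G g)"
      using g pt_src pt_tgt by simp_all
    fix h assume h: "h \<in> carrier G" and gh: "src g = tgt h"
    have "KB.fsrc (pt g) = KB.frng (pt h)" unfolding pt_src[OF g] pt_tgt[OF h] gh ..
    then show "hbg_unit G (g \<odot> h) = KB.fmul (hbg_unit G g) (hbg_unit G h)"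
      using pt_comp[OF g h gh] g h gh by simp
  qed
  have "homeomorphic_map T KB.UT (hbg_unit G)"
  proof (rule bijective_open_imp_homeomorphic_map)
    show "hbg_unit G ` topspace T = topspace KB.UT"
    proof
      show "hbg_unit G ` topspace T \<subseteq> topspace KB.UT" using uf_pt by auto
      show "topspace KB.UT \<subseteq> hbg_unit G ` topspace T"
      proof
        fix \<U> assume "\<U> \<in> topspace KB.UT"
        then obtain g where "g \<in> carrier G" "\<U> = pt g" using uf_is_pt by auto
        then show "\<U> \<in> hbg_unit G ` topspace T" by (intro image_eqI[of _ _ g]) auto
      qed
    qed
    show "inj_on (hbg_unit G) (topspace T)"
    proof (rule inj_onI)
      fix g h assume *: "g \<in> topspace T" "h \<in> topspace T" "hbg_unit G g = hbg_unit G h"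
      show "g = h" by (rule pt_inj) (use * in simp_all)
    qed
    show "continuous_map T KB.UT (hbg_unit G)"
      unfolding continuous_on_generated_topo_iff
    proof (intro conjI allI impI)
      fix U assume "U \<in> KB.V ` KB"
      then obtain A where A: "A \<in> KB" "U = KB.V A" by blast
      \<comment> \<open>The basic open set of ultrafilters containing \<open>A\<close> pulls back to
        \<open>A\<close> itself, so continuity is the openness of bisections.\<close>
      have "hbg_unit G -` U \<inter> topspace T = A"
      proof (rule Set.set_eqI)
        fix g show "g \<in> hbg_unit G -` U \<inter> topspace T \<longleftrightarrow> g \<in> A"
          using A KB_closed[OF A(1), of g] uf_pt[of g]
          by (cases "g \<in> carrier G") (auto simp: KB.mem_V)
      qed
      then show "openin T (hbg_unit G -` U \<inter> topspace T)" using KB_D(2)[OF A(1)] by simp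
    next
      have "hbg_unit G ` topspace T \<subseteq> topspace KB.UT" using uf_pt by auto
      then show "hbg_unit G ` topspace T \<subseteq> \<Union>(KB.V ` KB)" unfolding KB.Union_V KB.topspace_UT .
    qed
    show "open_map T KB.UT (hbg_unit G)"
      unfolding open_map_def
    proof (intro allI impI)
      fix U assume U: "openin T U"
      have UG': "U \<subseteq> carrier G" using openin_subset[OF U] by simp
      show "openin KB.UT (hbg_unit G ` U)"
        unfolding KB.openin_UT_iff
      proof
        fix F assume "F \<in> hbg_unit G ` U"
        then obtain g where g: "g \<in> U" "F = pt g" "g \<in> carrier G" using UG' by auto
        obtain A where A: "A \<in> KB" "g \<in> A" "A \<subseteq> U" using KB_basis[OF U g(1)] by blast
        have "F \<in> KB.V A" using A g uf_pt by (simp add: KB.mem_V)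
        moreover have "KB.V A \<subseteq> hbg_unit G ` U"
        proof
          fix H assume "H \<in> KB.V A"
          then have H: "KB.uf H" "A \<in> H" by (simp_all add: KB.mem_V)
          \<comment> \<open>Every ultrafilter containing \<open>A\<close> is the point ultrafilter
            of some \<open>h\<close>, and then \<open>h\<close> lies in \<open>A\<close>, hence in
            \<open>U\<close>.\<close>
          then obtain h where h: "h \<in> carrier G" "H = pt h" using uf_is_pt by blast
          then have "h \<in> U" using H A by blast
          then show "H \<in> hbg_unit G ` U" using h by (intro image_eqI[of _ _ h]) auto
        qed
        ultimately show "\<exists>A\<in>KB. F \<in> KB.V A \<and> KB.V A \<subseteq> hbg_unit G ` U" using A(1) by blast
      qed
    qed
  qed
  then show "homeomorphic_map T (gtop KB.UG) (hbg_unit G)" by simp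
qed

end

lemma (in hbg_morphism) hbg_unit_natural:
  "compose (carrier G) (uf_map H.KS G.KS (kb_map G H \<phi>)) (hbg_unit G) = compose (carrier G) (hbg_unit H) \<phi>"
proof (rule ext)
  fix g
  show "compose (carrier G) (uf_map H.KS G.KS (kb_map G H \<phi>)) (hbg_unit G) g = compose (carrier G) (hbg_unit H) \<phi> g"
  proof (cases "g \<in> carrier G")
    case True
    then have "G.pt g \<in> ultrafilters G.KS" using G.uf_pt by simp
    then have "uf_map H.KS G.KS (kb_map G H \<phi>) (G.pt g) = {B \<in> H.KB. kb_map G H \<phi> B \<in> G.pt g}"
      unfolding uf_map_def by (rule restrict_apply')
    also have "\<dots> = H.pt (\<phi> g)" using pre_pt[OF True] .
    finally show ?thesis using True by (simp add: compose_def)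
  qed (simp add: compose_def)
qed

section \<open>Both functors preserve identities and reverse composites\<close>

lemma uf_map_id:
  assumes "boolean_inverse_meet_semigroup S"
  shows "uf_map S S (\<lambda>s\<in>carrier S. s) = (\<lambda>F\<in>carrier (uf_groupoid S). F)"
proof (rule ext)
  interpret bim S by unfold_locales (rule assms)
  fix F show "uf_map S S (\<lambda>s\<in>carrier S. s) F = (\<lambda>F\<in>carrier (uf_groupoid S). F) F"
    using uf_subset[of F] by (auto simp: uf_map_def restrict_def)
qed

lemma kb_map_id:
  assumes "hausdorff_boolean_groupoid G"
  shows "kb_map G G (\<lambda>g\<in>carrier G. g) = (\<lambda>A\<in>carrier (kb_semigroup G). A)"
proof (rule ext)
  interpret hbg G by unfold_locales (rule assms)
  fix A show "kb_map G G (\<lambda>g\<in>carrier G. g) A = (\<lambda>A\<in>carrier (kb_semigroup G). A) A"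
    using KB_D(4)[of A] by (auto simp: kb_map_def restrict_def)
qed

lemma uf_map_compose:
  assumes \<theta>: "\<theta> \<in> bim_hom S T" and \<psi>: "\<psi> \<in> bim_hom T U"
  shows "uf_map S U (compose (carrier S) \<psi> \<theta>) =
    compose (carrier (uf_groupoid U)) (uf_map S T \<theta>) (uf_map T U \<psi>)"
proof (rule ext)
  interpret A: bim_morphism S T \<theta> using \<theta> by (rule bim_morphismI)
  interpret B: bim_morphism T U \<psi> using \<psi> by (rule bim_morphismI)
  fix F
  show "uf_map S U (compose (carrier S) \<psi> \<theta>) F =
      compose (carrier (uf_groupoid U)) (uf_map S T \<theta>) (uf_map T U \<psi>) F"
    using B.preimage_ultrafilter[of F]
    by (cases "F \<in> ultrafilters U") (auto simp: uf_map_def compose_def)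
qed

lemma kb_map_compose:
  assumes \<theta>: "\<theta> \<in> hbg_hom G H" and \<psi>: "\<psi> \<in> hbg_hom H K"
  shows "kb_map G K (compose (carrier G) \<psi> \<theta>) =
    compose (carrier (kb_semigroup K)) (kb_map G H \<theta>) (kb_map H K \<psi>)"
proof (rule ext)
  interpret A: hbg_morphism G H \<theta> using \<theta> by (rule hbg_morphismI)
  interpret B: hbg_morphism H K \<psi> using \<psi> by (rule hbg_morphismI)
  fix C
  show "kb_map G K (compose (carrier G) \<psi> \<theta>) C =
      compose (carrier (kb_semigroup K)) (kb_map G H \<theta>) (kb_map H K \<psi>) C"
  proof (cases "C \<in> carrier (kb_semigroup K)")
    case True
    have "kb_map G H \<theta> (kb_map H K \<psi> C) = {g \<in> carrier G. \<theta> g \<in> {h \<in> carrier H. \<psi> h \<in> C}}"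
      unfolding B.kb_map_apply[OF True] A.kb_map_apply[OF B.pre_KB[OF True]] ..
    also have "\<dots> = {g \<in> carrier G. compose (carrier G) \<psi> \<theta> g \<in> C}" by (auto simp: compose_def)
    also have "\<dots> = kb_map G K (compose (carrier G) \<psi> \<theta>) C" using True by (simp add: kb_map_def)
    finally have "kb_map G K (compose (carrier G) \<psi> \<theta>) C = kb_map G H \<theta> (kb_map H K \<psi> C)" by (rule sym)
    then show ?thesis using True by (simp only: compose_eq)
  qed (simp add: kb_map_def compose_def)
qed

section \<open>The duality\<close>

theorem mainTheorem2:
  shows
    \<comment> \<open>Boolean inverse meet-semigroups and proper morphisms form a category\<close>
    "(\<forall>S :: 'a zero_semigroup. boolean_inverse_meet_semigroup S \<longrightarrow>
        (\<lambda>s\<in>carrier S. s) \<in> bim_hom S S) \<and>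
     (\<forall>(S :: 'a zero_semigroup) (T :: 'b zero_semigroup) (U :: 'c zero_semigroup).
        \<forall>\<theta>\<in>bim_hom S T. \<forall>\<psi>\<in>bim_hom T U. compose (carrier S) \<psi> \<theta> \<in> bim_hom S U) \<and>
     (\<forall>(S :: 'a zero_semigroup) (T :: 'b zero_semigroup). \<forall>\<theta>\<in>bim_hom S T.
        compose (carrier S) \<theta> (\<lambda>s\<in>carrier S. s) = \<theta> \<and>
        compose (carrier S) (\<lambda>t\<in>carrier T. t) \<theta> = \<theta>) \<and>
     (\<forall>(S :: 'a zero_semigroup) (T :: 'b zero_semigroup)
        (U :: 'c zero_semigroup) (V :: 'd zero_semigroup).
        \<forall>\<theta>\<in>bim_hom S T. \<forall>\<psi>\<in>bim_hom T U. \<forall>\<xi>\<in>bim_hom U V.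
          compose (carrier S) (compose (carrier T) \<xi> \<psi>) \<theta> =
          compose (carrier S) \<xi> (compose (carrier S) \<psi> \<theta>)) \<and>
     \<comment> \<open>Hausdorff Boolean groupoids and proper continuous covering functors form a category\<close>
     (\<forall>G :: 'g top_groupoid. hausdorff_boolean_groupoid G \<longrightarrow>
        (\<lambda>g\<in>carrier G. g) \<in> hbg_hom G G) \<and>
     (\<forall>(G :: 'g top_groupoid) (H :: 'h top_groupoid) (K :: 'k top_groupoid).
        \<forall>\<theta>\<in>hbg_hom G H. \<forall>\<psi>\<in>hbg_hom H K. compose (carrier G) \<psi> \<theta> \<in> hbg_hom G K) \<and>
     (\<forall>(G :: 'g top_groupoid) (H :: 'h top_groupoid). \<forall>\<theta>\<in>hbg_hom G H.
        compose (carrier G) \<theta> (\<lambda>g\<in>carrier G. g) = \<theta> \<and>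
        compose (carrier G) (\<lambda>h\<in>carrier H. h) \<theta> = \<theta>) \<and>
     (\<forall>(G :: 'g top_groupoid) (H :: 'h top_groupoid)
        (K :: 'k top_groupoid) (L :: 'l top_groupoid).
        \<forall>\<theta>\<in>hbg_hom G H. \<forall>\<psi>\<in>hbg_hom H K. \<forall>\<xi>\<in>hbg_hom K L.
          compose (carrier G) (compose (carrier H) \<xi> \<psi>) \<theta> =
          compose (carrier G) \<xi> (compose (carrier G) \<psi> \<theta>)) \<and>
     \<comment> \<open>contravariant functor from semigroups to groupoids\<close>
     (\<forall>S :: 'a zero_semigroup. boolean_inverse_meet_semigroup S \<longrightarrow>
        hausdorff_boolean_groupoid (uf_groupoid S) \<and>
        uf_map S S (\<lambda>s\<in>carrier S. s) = (\<lambda>F\<in>carrier (uf_groupoid S). F)) \<and>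
     (\<forall>(S :: 'a zero_semigroup) (T :: 'b zero_semigroup). \<forall>\<theta>\<in>bim_hom S T.
        uf_map S T \<theta> \<in> hbg_hom (uf_groupoid T) (uf_groupoid S)) \<and>
     (\<forall>(S :: 'a zero_semigroup) (T :: 'b zero_semigroup) (U :: 'c zero_semigroup).
        \<forall>\<theta>\<in>bim_hom S T. \<forall>\<psi>\<in>bim_hom T U.
          uf_map S U (compose (carrier S) \<psi> \<theta>) =
          compose (carrier (uf_groupoid U)) (uf_map S T \<theta>) (uf_map T U \<psi>)) \<and>
     \<comment> \<open>contravariant functor from groupoids to semigroups\<close>
     (\<forall>G :: 'g top_groupoid. hausdorff_boolean_groupoid G \<longrightarrow>
        boolean_inverse_meet_semigroup (kb_semigroup G) \<and>
        kb_map G G (\<lambda>g\<in>carrier G. g) = (\<lambda>A\<in>carrier (kb_semigroup G). A)) \<and>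
     (\<forall>(G :: 'g top_groupoid) (H :: 'h top_groupoid). \<forall>\<theta>\<in>hbg_hom G H.
        kb_map G H \<theta> \<in> bim_hom (kb_semigroup H) (kb_semigroup G)) \<and>
     (\<forall>(G :: 'g top_groupoid) (H :: 'h top_groupoid) (K :: 'k top_groupoid).
        \<forall>\<theta>\<in>hbg_hom G H. \<forall>\<psi>\<in>hbg_hom H K.
          kb_map G K (compose (carrier G) \<psi> \<theta>) =
          compose (carrier (kb_semigroup K)) (kb_map G H \<theta>) (kb_map H K \<psi>)) \<and>
     \<comment> \<open>natural isomorphism from the identity on semigroups to the composite functor\<close>
     (\<forall>S :: 'a zero_semigroup. boolean_inverse_meet_semigroup S \<longrightarrow>
        bim_iso S (kb_semigroup (uf_groupoid S)) (bim_unit S)) \<and>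
     (\<forall>(S :: 'a zero_semigroup) (T :: 'b zero_semigroup). \<forall>\<theta>\<in>bim_hom S T.
        compose (carrier S) (kb_map (uf_groupoid T) (uf_groupoid S) (uf_map S T \<theta>)) (bim_unit S) =
        compose (carrier S) (bim_unit T) \<theta>) \<and>
     \<comment> \<open>natural isomorphism from the identity on groupoids to the composite functor\<close>
     (\<forall>G :: 'g top_groupoid. hausdorff_boolean_groupoid G \<longrightarrow>
        hbg_iso G (uf_groupoid (kb_semigroup G)) (hbg_unit G)) \<and>
     (\<forall>(G :: 'g top_groupoid) (H :: 'h top_groupoid). \<forall>\<theta>\<in>hbg_hom G H.
        compose (carrier G) (uf_map (kb_semigroup H) (kb_semigroup G) (kb_map G H \<theta>)) (hbg_unit G) =
        compose (carrier G) (hbg_unit H) \<theta>)"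
  by (intro conjI allI ballI impI)
    (rule id_bim_hom compose_bim_hom compose_id_bim_hom compose_bim_hom_assoc
      id_hbg_hom compose_hbg_hom compose_id_hbg_hom compose_hbg_hom_assoc
      bim.hausdorff_boolean_uf_groupoid[OF bim.intro] uf_map_id
      bim_morphism.uf_map_hom[OF bim_morphismI] uf_map_compose
      hbg.boolean_inverse_meet_semigroup_KB[OF hbg.intro] kb_map_id
      hbg_morphism.kb_map_hom[OF hbg_morphismI] kb_map_compose
      bim.bim_unit_iso[OF bim.intro] bim_morphism.bim_unit_natural[OF bim_morphismI]
      hbg.hbg_unit_iso[OF hbg.intro] hbg_morphism.hbg_unit_natural[OF hbg_morphismI]; assumption)+

end
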